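(* Assume $\alpha>0$, $\lambda^o=\beta<A<\infty$, and that the jump sizes satisfy $\ell(n,Z_n)\sim\mathrm{Exp}(\theta)$ for every $n\ge1$. Then the invariant measure $\Pi$ for $\Lambda$ is given by $$\Pi(d\lambda)=\frac{K_0}{\beta}\,\delta_\beta(d\lambda)+\pi(\lambda)\,d\lambda,$$ where the density is given by $$\pi(\lambda)=\frac{K_0}{\beta}\,\frac{\beta\theta}{\alpha(\lambda-\beta)}\int_\lambda^A\left(\frac{u-\beta}{\lambda-\beta}\right)^{-\frac{\beta}{\alpha}}e^{-\left(\frac1\alpha-\theta\right)(u-\lambda)}\,du,\qquad \lambda\in(\beta,A),$$ with $\dfrac{K_0}{\beta}=\dfrac{\alpha}{\alpha+\beta\theta K_3}$ and $$K_3=\begin{cases}-\,{}_1F_1^{(1,0,0)}\!\left(0,\dfrac{\beta}{\alpha},\dfrac{(\alpha\theta-1)(A-\beta)}{\alpha}\right), & \alpha\ne1/\theta,\\[2mm] \dfrac{\alpha}{\beta}(A-\beta), & \alpha=1/\theta.\end{cases}$$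
   Context: $(Z_i)_{i\ge1}$ are i.i.d. $[0,\infty)$-valued random variables with distribution function $G$ and finite second moment. $\ell(n,z)$ ($n\ge1$, $z\ge0$) is a strictly positive function such that, for each $n$, $z\mapsto\ell(n,z)$ is non-decreasing and continuous. $\beta>0$, $\theta>0$, and $\mathrm{Exp}(\theta)$ is the exponential law with density $\theta e^{-\theta y}$, $y>0$. $(N,\Lambda)$ consists of the first two components of the self-exciting piecewise-deterministic Markov process with resetting: the right-continuous Markov process on $(\mathbb{N}\cup\{0\})\times[\lambda^o,A)$ such that between jumps $d\Lambda_t=\alpha(\beta-\Lambda_t)dt$ and $N$ is constant; jumps occur at rate $\Lambda$; at a jump, with mark $Z$ freshly drawn from $G$, $(N,\Lambda)$ moves from $(n,\lambda)$ to $(n+1,\lambda+\ell(n+1,Z))$ if $\lambda+\ell(n+1,Z)<A$, and to $(0,\lambda^o)$ (a reset) otherwise. The invariant measure $\Pi$ for $\Lambda$ is the $\Lambda$-marginal (sum over $n$) of the invariant measure of $(N,\Lambda)$. $\delta_\beta$ is the Dirac mass at $\beta$. ${}_1F_1(a,b,x)=\sum_{k\ge0}\frac{(a)_k}{(b)_k}\frac{x^k}{k!}$, with $(a)_k=a(a+1)\cdots(a+k-1)$ and $(a)_0=1$, is Kummer's confluent hypergeometric function, and ${}_1F_1^{(1,0,0)}$ denotes its partial derivative with respect to the first argument $a$.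
   Formalization: For α≠1/θ, K₃ carries the extra factor α/(1−αθ) missing in the printed formula, which is negative for αθ>1 so that Π could not have mass one; and ℓ(n,z)>0 is assumed only for z>0, since ℓ(n,0)>0 with monotonicity contradicts ℓ(n,Z_n)∼Exp(θ). *)

theory Defs
  imports "HOL-Probability.Probability"
begin

section \<open>The resetting process\<close>

text \<open>
  The process is built path by path from the driving sequence
  \<open>\<omega> = ((E\<^sub>0, Z\<^sub>0), (E\<^sub>1, Z\<^sub>1), \<dots>)\<close> of independent unit exponential clocks and marks with
  law \<open>G\<close>.  A mark is a point of \<open>[0,\<infinity>)\<close>, so \<open>G\<close> is a measure on \<open>restrict_space borel {0..}\<close>
  and the values of \<open>ell n\<close> on negative arguments play no role.
\<close>

definition flow :: "real \<Rightarrow> real \<Rightarrow> real \<Rightarrow> real \<Rightarrow> real" where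
  "flow \<alpha> \<beta> l t = \<beta> + (l - \<beta>) * exp (- (\<alpha> * t))"

lemma flow_0: "flow \<alpha> \<beta> l 0 = l"
  by (simp add: flow_def)

lemma flow_ode: "(flow \<alpha> \<beta> l has_real_derivative \<alpha> * (\<beta> - flow \<alpha> \<beta> l t)) (at t)"
  unfolding flow_def by (auto intro!: derivative_eq_intros simp: algebra_simps)

text \<open>
  The first jump after a visit to intensity \<open>l\<close> happens when the integrated intensity along the
  flow reaches the clock value \<open>e\<close>.  For a unit exponential \<open>e\<close> the waiting time exceeds \<open>t\<close> with
  probability \<open>exp (- \<integral>\<^sub>0\<^sup>t flow \<alpha> \<beta> l s ds)\<close>, that is, jumps occur at rate \<open>\<Lambda>\<close>.
\<close>

definition waiting_time :: "real \<Rightarrow> real \<Rightarrow> real \<Rightarrow> real \<Rightarrow> real" where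
  "waiting_time \<alpha> \<beta> l e = Inf {t. 0 \<le> t \<and> e \<le> integral {0..t} (flow \<alpha> \<beta> l)}"

definition jump_map ::
  "real \<Rightarrow> real \<Rightarrow> (nat \<Rightarrow> real \<Rightarrow> real) \<Rightarrow> nat \<times> real \<Rightarrow> real \<Rightarrow> nat \<times> real" where
  "jump_map lam0 A ell x z =
     (let n = fst x; l = snd x in
      if l + ell (Suc n) z < A then (Suc n, l + ell (Suc n) z) else (0, lam0))"

text \<open>\<open>skeleton \<dots> x \<omega> k\<close> is the pair of the \<open>k\<close>-th jump time and the state right after that jump.\<close>

primrec skeleton ::
  "real \<Rightarrow> real \<Rightarrow> real \<Rightarrow> real \<Rightarrow> (nat \<Rightarrow> real \<Rightarrow> real) \<Rightarrow> nat \<times> real \<Rightarrow> (nat \<Rightarrow> real \<times> real)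
     \<Rightarrow> nat \<Rightarrow> real \<times> (nat \<times> real)" where
  "skeleton \<alpha> \<beta> lam0 A ell x \<omega> 0 = (0, x)"
| "skeleton \<alpha> \<beta> lam0 A ell x \<omega> (Suc k) =
     (let (s, (n, l)) = skeleton \<alpha> \<beta> lam0 A ell x \<omega> k;
          w = waiting_time \<alpha> \<beta> l (fst (\<omega> k))
      in (s + w, jump_map lam0 A ell (n, flow \<alpha> \<beta> l w) (snd (\<omega> k))))"

text \<open>
  The state at time \<open>t\<close>, right-continuous in \<open>t\<close>: \<open>k\<close> is the number of jumps in \<open>[0,t]\<close>.  The
  intensity is bounded by \<open>A\<close>, so that almost surely there are only finitely many of them.
\<close>

definition process ::
  "real \<Rightarrow> real \<Rightarrow> real \<Rightarrow> real \<Rightarrow> (nat \<Rightarrow> real \<Rightarrow> real) \<Rightarrow> nat \<times> real \<Rightarrow> real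
     \<Rightarrow> (nat \<Rightarrow> real \<times> real) \<Rightarrow> nat \<times> real" where
  "process \<alpha> \<beta> lam0 A ell x t \<omega> =
     (let k = (LEAST k. t < fst (skeleton \<alpha> \<beta> lam0 A ell x \<omega> (Suc k)));
          (s, (n, l)) = skeleton \<alpha> \<beta> lam0 A ell x \<omega> k
      in (n, flow \<alpha> \<beta> l (t - s)))"

definition driving_space :: "real measure \<Rightarrow> (nat \<Rightarrow> real \<times> real) measure" where
  "driving_space G =
     (\<Pi>\<^sub>M k\<in>UNIV. density lborel (\<lambda>y. ennreal (exponential_density 1 y)) \<Otimes>\<^sub>M G)"

definition state_space :: "real \<Rightarrow> real \<Rightarrow> (nat \<times> real) measure" where
  "state_space lam0 A = count_space UNIV \<Otimes>\<^sub>M restrict_space borel {lam0..<A}"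

definition transition ::
  "real \<Rightarrow> real \<Rightarrow> real \<Rightarrow> real \<Rightarrow> (nat \<Rightarrow> real \<Rightarrow> real) \<Rightarrow> real measure
     \<Rightarrow> real \<Rightarrow> nat \<times> real \<Rightarrow> (nat \<times> real) measure" where
  "transition \<alpha> \<beta> lam0 A ell G t x =
     distr (driving_space G) (state_space lam0 A) (process \<alpha> \<beta> lam0 A ell x t)"

definition invariant_measure ::
  "real \<Rightarrow> real \<Rightarrow> real \<Rightarrow> real \<Rightarrow> (nat \<Rightarrow> real \<Rightarrow> real) \<Rightarrow> real measure
     \<Rightarrow> (nat \<times> real) measure \<Rightarrow> bool" where
  "invariant_measure \<alpha> \<beta> lam0 A ell G Q \<longleftrightarrow>
     prob_space Q \<and> sets Q = sets (state_space lam0 A) \<and>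
     (\<forall>t\<ge>0. \<forall>B\<in>sets (state_space lam0 A).
        (\<integral>\<^sup>+x. emeasure (transition \<alpha> \<beta> lam0 A ell G t x) B \<partial>Q) = emeasure Q B)"

definition intensity_marginal :: "(nat \<times> real) measure \<Rightarrow> real measure" where
  "intensity_marginal Q = distr Q borel snd"


section \<open>The closed form\<close>

definition kummer :: "real \<Rightarrow> real \<Rightarrow> real \<Rightarrow> real" where
  "kummer a b x = (\<Sum>k. pochhammer a k / pochhammer b k * (x ^ k / fact k))"

definition kummer_deriv1 :: "real \<Rightarrow> real \<Rightarrow> real \<Rightarrow> real" where
  "kummer_deriv1 a b x = deriv (\<lambda>a'. kummer a' b x) a"

text \<open>
  \<open>K\<^sub>3\<close> is the normalising integral of \<open>1 / (\<lambda> - \<beta>)\<close> times the integral in the density, over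
  \<open>\<lambda> \<in> (\<beta>,A)\<close>.  With \<open>c = 1/\<alpha> - \<theta> \<noteq> 0\<close> and \<open>L = A - \<beta>\<close> it equals
  \<open>\<integral>\<^sub>0\<^sup>1 s powr (\<beta>/\<alpha> - 1) * (1 - exp (- c L (1 - s))) / (c (1 - s)) ds\<close>, and expanding the
  exponential gives \<open>- 1/c\<close> times the derivative of the Kummer function.  The source prints the
  first case without the factor \<open>1/c = \<alpha> / (1 - \<alpha> \<theta>)\<close>; then the total mass would not be one
  (unless \<open>c = 1\<close>) and the value would be negative for \<open>\<alpha> \<theta> > 1\<close>.
\<close>

definition K3 :: "real \<Rightarrow> real \<Rightarrow> real \<Rightarrow> real \<Rightarrow> real" where
  "K3 \<alpha> \<beta> \<theta> A =
     (if \<alpha> \<noteq> 1 / \<theta>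
      then - (\<alpha> / (1 - \<alpha> * \<theta>)) * kummer_deriv1 0 (\<beta> / \<alpha>) ((\<alpha> * \<theta> - 1) * (A - \<beta>) / \<alpha>)
      else \<alpha> / \<beta> * (A - \<beta>))"

definition pi_density :: "real \<Rightarrow> real \<Rightarrow> real \<Rightarrow> real \<Rightarrow> real \<Rightarrow> real \<Rightarrow> real" where
  "pi_density \<alpha> \<beta> \<theta> A K0 l =
     K0 / \<beta> * (\<beta> * \<theta> / (\<alpha> * (l - \<beta>))) *
     integral {l..A}
       (\<lambda>u. ((u - \<beta>) / (l - \<beta>)) powr (- (\<beta> / \<alpha>)) * exp (- (1 / \<alpha> - \<theta>) * (u - l)))"

end

theory Submission
  imports Defs
begin

text \<open>
  Conditioning on the first jump gives a renewal equation for the transition semigroup.  Its bounded solution is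
  unique, which yields both the absence of explosions and the Markov property.  From every state the process is at
  \<open>(0, \<beta>)\<close> at time \<open>1\<close> with probability bounded below, so there is exactly one invariant law \<open>Q\<close>, and
  the integral of \<open>L g\<close> against \<open>Q\<close> vanishes for the generator \<open>L\<close> and suitable functions \<open>g\<close> of the intensity.

  Because the jumps are exponential, \<open>g = F - F' / \<theta>\<close> has mean \<open>F\<close> after a jump provided
  \<open>F A = F \<beta> - F' \<beta> / \<theta>\<close>.  For such \<open>g\<close> the equation \<open>L g l = of_bool (l \<le> a) - m\<close> is a first-order
  linear equation for \<open>F'\<close>, solved explicitly by Kummer's series, and the side condition determines \<open>m\<close>.  Hence
  \<open>m\<close> is the value at \<open>a\<close> of the distribution function of the marginal, and Fubini's theorem turns it into the
  integral of the stated density.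
\<close>

section \<open>Doeblin's criterion\<close>

text \<open>The jump law does not depend on the counter, so the mean after a jump depends on the
  intensity alone. Testing with functions of the intensity thus avoids the joint law, and determines
  the marginal of every invariant law instead of verifying a candidate. Write
  \<open>\<Gamma>\<close> for the mean of \<open>g\<close> after a jump. For exponential jumps
  \<open>\<Gamma>' = \<theta> * (\<Gamma> - g)\<close>, which turns the non-local generator into a
  differential operator: with \<open>x = l - \<beta>\<close>, \<open>w = \<Gamma>'\<close> and
  \<open>c = 1 / \<alpha> - \<theta>\<close> the equation is \<open>\<alpha> * (x * w' + (\<beta> /
  \<alpha> + c * x) * w) = \<theta> * (s - m)\<close>, where \<open>s\<close> is the indicator of
  \<open>l \<le> a\<close>. A jump beyond \<open>A\<close> leads to \<open>\<beta>\<close>, so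
  \<open>\<Gamma> A = g \<beta>\<close> is needed; this is the side condition. It ties the integral
  of \<open>w\<close> over \<open>{0..A - \<beta>}\<close> to \<open>w 0\<close>, and for the
  solution regular at \<open>x = 0\<close> it reads \<open>m * (\<alpha> + \<beta> * \<theta> * K3)
  = \<alpha> + \<beta> * \<theta> * R\<close>, with \<open>R\<close> the integral of
  \<open>truncated\<close>. This is the origin of \<open>K3\<close> and of the constant
  \<open>K0 / \<beta>\<close>.\<close>

lemma measurable_transfer_sets: "f \<in> measurable M N \<Longrightarrow> sets M' = sets M \<Longrightarrow> f \<in> measurable M' N"
  by (drule measurable_cong_sets[OF _ refl, of M' M N]) simp

text \<open>A regeneration argument at the atom \<open>o0\<close>: the normalised expected
  occupation measure of one excursion from \<open>o0\<close> is invariant, and every invariant law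
  is a multiple of it. The uniform bound \<epsilon> gives the excursion lengths a geometric tail, so
  this measure is finite.\<close>

lemma doeblin_unique_invariant:
  fixes P :: "'a \<Rightarrow> 'a measure" and \<epsilon> :: ennreal
  assumes P: "P \<in> measurable M (subprob_algebra M)"
    and prob: "\<And>x. x \<in> space M \<Longrightarrow> prob_space (P x)"
    and o: "o0 \<in> space M" "{o0} \<in> sets M"
    and eps: "\<epsilon> > 0" "\<And>x. x \<in> space M \<Longrightarrow> \<epsilon> \<le> emeasure (P x) {o0}"
  shows "\<exists>!Q. prob_space Q \<and> sets Q = sets M \<and> Q \<bind> P = Q"
proof -
  \<comment> \<open>The taboo kernel: \<open>P x\<close> restricted to the complement of
    \<open>o0\<close>. Writing the restriction as a bind with \<open>null_measure\<close> yields its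
    measurability as a kernel.\<close>
  define K where "K x = P x \<bind> (\<lambda>y. if y = o0 then null_measure M else return M y)" for x
  have ne: "space M \<noteq> {}" using o by auto
  have null: "null_measure M \<in> space (subprob_algebra M)"
    using ne by (simp add: space_subprob_algebra subprob_spaceI)
  have pr: "Measurable.pred M (\<lambda>y. y = o0)"
  proof -
    have "{x \<in> space M. x = o0} = {o0}" using o by auto
    then show ?thesis using o by (simp add: pred_def)
  qed
  have kill: "(\<lambda>y. if y = o0 then null_measure M else return M y) \<in> measurable M (subprob_algebra M)"
    by (intro measurable_If return_measurable) (use null pr in \<open>simp_all add: pred_def\<close>)
  have K: "K \<in> measurable M (subprob_algebra M)"
    unfolding K_def by (rule measurable_bind[OF P]) (use kill measurable_compose[OF measurable_snd kill] in simp)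
  have sP: "sets (P x) = sets M" "space (P x) = space M" if "x \<in> space M" for x
    using sets_kernel[OF P that] sets_eq_imp_space_eq by auto
  have split: "(\<integral>\<^sup>+y. f y \<partial>P x) = f o0 * emeasure (P x) {o0} + (\<integral>\<^sup>+y. f y \<partial>K x)"
    if x: "x \<in> space M" and f: "f \<in> borel_measurable M" for f x
  proof -
    have f': "f \<in> borel_measurable (P x)" by (rule measurable_transfer_sets[OF f sP(1)[OF x]])
    have kill': "(\<lambda>y. if y = o0 then null_measure M else return M y) \<in> measurable (P x) (subprob_algebra M)"
      using kill measurable_cong_sets[OF sP(1)[OF x] refl, of "subprob_algebra M"] by simp
    have "(\<integral>\<^sup>+y. f y \<partial>K x) = (\<integral>\<^sup>+y. f y * indicator (- {o0}) y \<partial>P x)"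
      unfolding K_def
      by (subst nn_integral_bind[OF f kill']) (intro nn_integral_cong, auto simp: sP[OF x] nn_integral_return f nn_integral_null_measure)
    moreover have "(\<integral>\<^sup>+y. f y \<partial>P x) = (\<integral>\<^sup>+y. f o0 * indicator {o0} y + f y * indicator (- {o0}) y \<partial>P x)"
      by (intro nn_integral_cong) (auto split: split_indicator)
    moreover have "\<dots> = f o0 * emeasure (P x) {o0} + (\<integral>\<^sup>+y. f y * indicator (- {o0}) y \<partial>P x)"
    proof -
      have s: "{o0} \<in> sets (P x)" "- {o0} \<inter> space (P x) \<in> sets (P x)"
        using o sP[OF x] by (auto simp: Diff_eq[symmetric] Int_commute)
      have m: "(\<lambda>y. f y * indicator (- {o0}) y) \<in> borel_measurable (P x)"
        using f' s by (intro borel_measurable_times_ennreal) (auto simp: borel_measurable_indicator_iff Int_commute)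
      show ?thesis using s m by (subst nn_integral_add) (auto simp: nn_integral_cmult_indicator)
    qed
    ultimately show ?thesis by simp
  qed
  define q where "q = 1 - \<epsilon>"
  have Kq: "emeasure (K x) (space M) \<le> q" if x: "x \<in> space M" for x
  proof -
    interpret p: prob_space "P x" using prob x by simp
    have "1 = emeasure (P x) {o0} + emeasure (K x) (space M)"
      using split[OF x, of "indicator (space M)"] o sP[OF x] sets_kernel[OF K x]
      by (simp add: p.emeasure_space_1[unfolded sP[OF x]])
    moreover have "emeasure (P x) {o0} \<noteq> \<infinity>" by simp
    ultimately have "emeasure (K x) (space M) = 1 - emeasure (P x) {o0}"
      using ennreal_add_diff_cancel_left[of "emeasure (P x) {o0}" "emeasure (K x) (space M)"] by simp
    then show ?thesis unfolding q_def using eps(2)[OF x] by (simp add: ennreal_minus_mono)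
  qed
  have q1: "q < 1" unfolding q_def using eps(1)
    by (intro ennreal_between) auto
  \<comment> \<open>\<open>kap k\<close> is the law after \<open>k\<close> steps from
    \<open>o0\<close> on the event that \<open>o0\<close> has not been revisited; its mass is at
    most \<open>q ^ k\<close>.\<close>
  define kap where "kap = rec_nat (return M o0) (\<lambda>_ m. m \<bind> K)"
  have kap0: "kap 0 = return M o0" and kapS: "kap (Suc k) = kap k \<bind> K" for k
    by (simp_all add: kap_def)
  have kap_in: "kap k \<in> space (subprob_algebra M)" for k
  proof (induction k)
    case 0 then show ?case using o return_measurable[of M] measurable_space kap0 by metis
  next
    case (Suc k)
    then have "(\<lambda>_. kap k) \<in> measurable (count_space {()}) (subprob_algebra M)" by simp
    then have "(\<lambda>_. kap k \<bind> K) \<in> measurable (count_space {()}) (subprob_algebra M)"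
      using K by (rule measurable_bind2)
    from measurable_space[OF this, of "()"] show ?case by (simp add: kapS)
  qed
  have skap: "sets (kap k) = sets M" "space (kap k) = space M" for k
    using kap_in[of k] sets_eq_imp_space_eq[of "kap k" M] by (simp_all add: space_subprob_algebra)
  have kap_meas: "kap \<in> measurable (count_space UNIV) (subprob_algebra M)" using kap_in by simp
  \<comment> \<open>The sum of all \<open>kap k\<close>, written as a bind over counting measure so
    that \<open>nn_integral_bind\<close> turns integrals into series.\<close>
  define \<kappa> where "\<kappa> = count_space UNIV \<bind> kap"
  have s\<kappa>: "sets \<kappa> = sets M" "space \<kappa> = space M"
    unfolding \<kappa>_def by (auto simp: sets_bind[of _ _ M] skap space_bind[of _ _ M])
  have int\<kappa>: "(\<integral>\<^sup>+y. f y \<partial>\<kappa>) = (\<Sum>k. \<integral>\<^sup>+y. f y \<partial>kap k)" if "f \<in> borel_measurable M" for f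
    unfolding \<kappa>_def using that kap_meas by (subst nn_integral_bind[of _ M]) (auto simp: nn_integral_count_space_nat)
  have Kk: "K \<in> measurable (kap k) (subprob_algebra M)" for k
    using K measurable_cong_sets[OF skap(1) refl, of k "subprob_algebra M"] by simp
  have mass: "emeasure (kap k) (space M) \<le> q ^ k" for k
  proof (induction k)
    case 0 then show ?case using o by (simp add: kap0 emeasure_return)
  next
    case (Suc k)
    have "emeasure (kap (Suc k)) (space M) = (\<integral>\<^sup>+x. emeasure (K x) (space M) \<partial>kap k)"
      unfolding kapS using ne skap by (subst emeasure_bind[OF _ Kk]) auto
    also have "\<dots> \<le> (\<integral>\<^sup>+x. q \<partial>kap k)" by (intro nn_integral_mono) (use Kq skap in auto)
    also have "\<dots> = q * emeasure (kap k) (space M)" by (simp add: skap)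
    also have "\<dots> \<le> q * q ^ k" using Suc by (rule mult_left_mono) simp
    finally show ?case by simp
  qed
  have tot: "emeasure \<kappa> (space M) = (\<Sum>k. emeasure (kap k) (space M))"
    using int\<kappa>[of "indicator (space M)"] s\<kappa> skap by simp
  obtain q' where q': "q = ennreal q'" "0 \<le> q'" "q' < 1"
    using q1 by (cases q) (auto simp: ennreal_less_one_iff)
  have fin: "emeasure \<kappa> (space M) < \<infinity>"
  proof -
    have "emeasure \<kappa> (space M) \<le> (\<Sum>k. q ^ k)" unfolding tot using mass by (intro suminf_le) auto
    also have "\<dots> = (\<Sum>k. ennreal (q' ^ k))" using q' by (simp add: ennreal_power)
    also have "\<dots> = ennreal (\<Sum>k. q' ^ k)" using q' by (intro suminf_ennreal2) (auto intro: summable_geometric)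
    also have "\<dots> < \<infinity>" by simp
    finally show ?thesis .
  qed
  have pos: "emeasure \<kappa> (space M) > 0"
  proof -
    have "emeasure (kap 0) (space M) \<le> emeasure \<kappa> (space M)"
      unfolding tot using sum_le_suminf[of "\<lambda>k. emeasure (kap k) (space M)" "{0}"] by simp
    then show ?thesis using o by (auto simp: kap0 emeasure_return intro: less_le_trans[of 0 1])
  qed
  define c where "c = emeasure \<kappa> (space M)"
  have c: "0 < c" "c < \<infinity>" "c \<noteq> 0" "c \<noteq> \<top>" using fin pos unfolding c_def by auto
  have iter: "(\<integral>\<^sup>+x. \<integral>\<^sup>+y. f y \<partial>K x \<partial>kap k) = (\<integral>\<^sup>+y. f y \<partial>kap (Suc k))" if "f \<in> borel_measurable M" for f k
    unfolding kapS by (rule nn_integral_bind[OF that Kk, symmetric])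
  have fK: "(\<lambda>x. \<integral>\<^sup>+y. f y \<partial>K x) \<in> borel_measurable M" if "f \<in> borel_measurable M" for f
    using nn_integral_measurable_subprob_algebra[OF that] K by (rule measurable_compose[rotated])
  have fP: "(\<lambda>x. \<integral>\<^sup>+y. f y \<partial>P x) \<in> borel_measurable M" if "f \<in> borel_measurable M" for f
    using nn_integral_measurable_subprob_algebra[OF that] P by (rule measurable_compose[rotated])
  have Po: "(\<lambda>x. emeasure (P x) {o0}) \<in> borel_measurable M"
    using P o(2) measurable_emeasure_subprob_algebra measurable_compose by blast
  have Qiff: "Q \<bind> P = Q \<longleftrightarrow> (\<forall>f\<in>borel_measurable M. (\<integral>\<^sup>+x. \<integral>\<^sup>+y. f y \<partial>P x \<partial>Q) = (\<integral>\<^sup>+y. f y \<partial>Q))"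
    if Q: "prob_space Q" "sets Q = sets M" for Q
  proof -
    have P': "P \<in> measurable Q (subprob_algebra M)" using P measurable_cong_sets[OF Q(2) refl, of "subprob_algebra M"] by simp
    have sp: "space Q \<noteq> {}" using Q ne sets_eq_imp_space_eq by metis
    have i: "(\<integral>\<^sup>+x. \<integral>\<^sup>+y. f y \<partial>P x \<partial>Q) = (\<integral>\<^sup>+y. f y \<partial>(Q \<bind> P))" if "f \<in> borel_measurable M" for f
      using nn_integral_bind[OF that P'] by simp
    have sb: "sets (Q \<bind> P) = sets M"
      by (rule sets_bind[OF _ sp]) (use sP sets_eq_imp_space_eq[OF Q(2)] in auto)
    show ?thesis
    proof
      assume "Q \<bind> P = Q" then show "\<forall>f\<in>borel_measurable M. (\<integral>\<^sup>+x. \<integral>\<^sup>+y. f y \<partial>P x \<partial>Q) = (\<integral>\<^sup>+y. f y \<partial>Q)"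
        using i by simp
    next
      assume a: "\<forall>f\<in>borel_measurable M. (\<integral>\<^sup>+x. \<integral>\<^sup>+y. f y \<partial>P x \<partial>Q) = (\<integral>\<^sup>+y. f y \<partial>Q)"
      show "Q \<bind> P = Q"
      proof (rule measure_eqI)
        show "sets (Q \<bind> P) = sets Q" using sb Q by simp
        fix B assume "B \<in> sets (Q \<bind> P)"
        then have B: "B \<in> sets M" using sb by simp
        then show "emeasure (Q \<bind> P) B = emeasure Q B"
          using a[rule_format, of "indicator B"] i[of "indicator B"] Q sb by simp
      qed
    qed
  qed
  define Q0 where "Q0 = scale_measure (1 / c) \<kappa>"
  have Q0: "prob_space Q0" "sets Q0 = sets M"
    using c s\<kappa> by (auto simp: Q0_def space_scale_measure c_def[symmetric] ennreal_divide_times intro!: prob_spaceI)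
  have inv\<kappa>: "(\<integral>\<^sup>+x. \<integral>\<^sup>+y. f y \<partial>P x \<partial>\<kappa>) = (\<integral>\<^sup>+y. f y \<partial>\<kappa>)" if f: "f \<in> borel_measurable M" for f
  proof -
    \<comment> \<open>\<open>gen\<close> and \<open>tot1\<close> share the tail over
      \<open>kap (Suc k)\<close>. For the constant 1 both sides equal \<open>c\<close>, and
      cancelling the finite tail shows that the mass returning to \<open>o0\<close> is 1; with that
      the two formulas coincide for every \<open>f\<close>.\<close>
    have gen: "(\<integral>\<^sup>+x. \<integral>\<^sup>+y. f y \<partial>P x \<partial>\<kappa>) = f o0 * (\<integral>\<^sup>+x. emeasure (P x) {o0} \<partial>\<kappa>) + (\<Sum>k. \<integral>\<^sup>+y. f y \<partial>kap (Suc k))"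
      if f: "f \<in> borel_measurable M" for f
    proof -
      have "(\<integral>\<^sup>+x. \<integral>\<^sup>+y. f y \<partial>P x \<partial>\<kappa>) = (\<integral>\<^sup>+x. f o0 * emeasure (P x) {o0} + (\<integral>\<^sup>+y. f y \<partial>K x) \<partial>\<kappa>)"
        by (intro nn_integral_cong split f) (simp add: s\<kappa>)
      also have "\<dots> = f o0 * (\<integral>\<^sup>+x. emeasure (P x) {o0} \<partial>\<kappa>) + (\<integral>\<^sup>+x. \<integral>\<^sup>+y. f y \<partial>K x \<partial>\<kappa>)"
        using measurable_transfer_sets[OF Po s\<kappa>(1)] measurable_transfer_sets[OF fK[OF f] s\<kappa>(1)]
        by (subst nn_integral_add) (auto simp: nn_integral_cmult)
      finally show ?thesis using int\<kappa>[OF fK[OF f]] iter[OF f] by simp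
    qed
    have tot1: "(\<integral>\<^sup>+y. f y \<partial>\<kappa>) = f o0 + (\<Sum>k. \<integral>\<^sup>+y. f y \<partial>kap (Suc k))" if f: "f \<in> borel_measurable M" for f
    proof -
      have "(\<integral>\<^sup>+y. f y \<partial>\<kappa>) = (\<Sum>k. \<integral>\<^sup>+y. f y \<partial>kap k)" by (rule int\<kappa>[OF f])
      also have "\<dots> = (\<integral>\<^sup>+y. f y \<partial>kap 0) + (\<Sum>k. \<integral>\<^sup>+y. f y \<partial>kap (Suc k))"
        using suminf_offset[of "\<lambda>k. \<integral>\<^sup>+y. f y \<partial>kap k" 1] by simp
      finally show ?thesis using o f by (simp add: kap0 nn_integral_return)
    qed
    let ?one = "indicator (space M) :: 'a \<Rightarrow> ennreal"
    have "(\<integral>\<^sup>+x. \<integral>\<^sup>+y. ?one y \<partial>P x \<partial>\<kappa>) = (\<integral>\<^sup>+x. 1 \<partial>\<kappa>)"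
      by (intro nn_integral_cong) (use sP prob_space.emeasure_space_1[OF prob] s\<kappa> in auto)
    also have "\<dots> = c" by (simp add: s\<kappa> c_def)
    finally have 1: "c = (\<integral>\<^sup>+x. emeasure (P x) {o0} \<partial>\<kappa>) + (\<Sum>k. \<integral>\<^sup>+y. ?one y \<partial>kap (Suc k))"
      using gen[of ?one] o by simp
    have "(\<integral>\<^sup>+y. ?one y \<partial>\<kappa>) = c" by (simp add: s\<kappa> c_def)
    then have 2: "c = 1 + (\<Sum>k. \<integral>\<^sup>+y. ?one y \<partial>kap (Suc k))" using tot1[of ?one] o by simp
    have "(\<Sum>k. \<integral>\<^sup>+y. ?one y \<partial>kap (Suc k)) \<noteq> \<top>" using 2 c by auto
    then have "(\<integral>\<^sup>+x. emeasure (P x) {o0} \<partial>\<kappa>) = 1" using 1 2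
      by (metis add.commute ennreal_add_left_cancel infinity_ennreal_def)
    then show ?thesis using gen[OF f] tot1[OF f] by simp
  qed
  have Q0inv: "Q0 \<bind> P = Q0"
    unfolding Qiff[OF Q0]
  proof (intro ballI)
    fix f :: "'a \<Rightarrow> ennreal" assume f: "f \<in> borel_measurable M"
    have fk: "f \<in> borel_measurable \<kappa>" "(\<lambda>x. \<integral>\<^sup>+y. f y \<partial>P x) \<in> borel_measurable \<kappa>"
      by (rule measurable_transfer_sets[OF f s\<kappa>(1)], rule measurable_transfer_sets[OF fP[OF f] s\<kappa>(1)])
    show "(\<integral>\<^sup>+x. \<integral>\<^sup>+y. f y \<partial>P x \<partial>Q0) = (\<integral>\<^sup>+y. f y \<partial>Q0)"
      unfolding Q0_def using inv\<kappa>[OF f] by (simp add: nn_integral_scale_measure fk)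
  qed
  \<comment> \<open>Iterating \<open>rep\<close> writes the integral against \<open>Q\<close> as
    \<open>a\<close> times a partial sum for \<kappa> plus a remainder of at most
    \<open>q ^ n\<close>. The limit makes \<open>Q\<close> equal to \<open>a\<close> times \<kappa>,
    and the total mass fixes \<open>a\<close>.\<close>
  have uniq: "Q = Q0" if Q: "prob_space Q" "sets Q = sets M" and inv: "Q \<bind> P = Q" for Q
  proof -
    have spQ: "space Q = space M" using Q sets_eq_imp_space_eq by metis
    define a where "a = emeasure Q {o0}"
    have rep: "(\<integral>\<^sup>+y. f y \<partial>Q) = f o0 * a + (\<integral>\<^sup>+x. \<integral>\<^sup>+y. f y \<partial>K x \<partial>Q)" if f: "f \<in> borel_measurable M" for f
    proof -
      have "(\<integral>\<^sup>+y. f y \<partial>Q) = (\<integral>\<^sup>+x. \<integral>\<^sup>+y. f y \<partial>P x \<partial>Q)" using Qiff[OF Q] inv f by simp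
      also have "\<dots> = (\<integral>\<^sup>+x. f o0 * emeasure (P x) {o0} + (\<integral>\<^sup>+y. f y \<partial>K x) \<partial>Q)"
        by (intro nn_integral_cong split f) (simp add: spQ)
      also have "\<dots> = f o0 * (\<integral>\<^sup>+x. emeasure (P x) {o0} \<partial>Q) + (\<integral>\<^sup>+x. \<integral>\<^sup>+y. f y \<partial>K x \<partial>Q)"
        using measurable_transfer_sets[OF Po Q(2)] measurable_transfer_sets[OF fK[OF f] Q(2)]
        by (subst nn_integral_add) (auto simp: nn_integral_cmult)
      also have "(\<integral>\<^sup>+x. emeasure (P x) {o0} \<partial>Q) = a"
      proof -
        have "(\<integral>\<^sup>+x. emeasure (P x) {o0} \<partial>Q) = (\<integral>\<^sup>+x. \<integral>\<^sup>+y. indicator {o0} y \<partial>P x \<partial>Q)"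
          by (intro nn_integral_cong) (use o sP spQ in simp)
        also have "\<dots> = a" using Qiff[OF Q] inv o Q by (simp add: a_def)
        finally show ?thesis .
      qed
      finally show ?thesis .
    qed
    define Kf where "Kf f x = (\<integral>\<^sup>+y. f y \<partial>K x)" for f :: "'a \<Rightarrow> ennreal" and x
    have Kfk: "(Kf ^^ k) f \<in> borel_measurable M" if "f \<in> borel_measurable M" for f k
      using that fK by (induction k) (auto simp: Kf_def[abs_def])
    have Kfo: "(\<integral>\<^sup>+y. (Kf ^^ j) f y \<partial>kap k) = (\<integral>\<^sup>+y. f y \<partial>kap (j + k))" if f: "f \<in> borel_measurable M" for f j k
    proof (induction j arbitrary: k)
      case (Suc j)
      have "(\<integral>\<^sup>+y. (Kf ^^ Suc j) f y \<partial>kap k) = (\<integral>\<^sup>+y. (Kf ^^ j) f y \<partial>kap (Suc k))"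
        using iter[OF Kfk[OF f], of k j] by (simp add: Kf_def)
      then show ?case using Suc by simp
    qed simp
    have fin_rep: "(\<integral>\<^sup>+y. f y \<partial>Q) = (\<Sum>k<n. \<integral>\<^sup>+y. f y \<partial>kap k) * a + (\<integral>\<^sup>+x. (Kf ^^ n) f x \<partial>Q)"
      if f: "f \<in> borel_measurable M" for f n
    proof (induction n)
      case (Suc n)
      have "(\<integral>\<^sup>+x. (Kf ^^ n) f x \<partial>Q) = (Kf ^^ n) f o0 * a + (\<integral>\<^sup>+x. (Kf ^^ Suc n) f x \<partial>Q)"
        using rep[OF Kfk[OF f], of n] by (simp add: Kf_def)
      moreover have "(Kf ^^ n) f o0 = (\<integral>\<^sup>+y. f y \<partial>kap n)"
        using Kfo[OF f, where j=n and k=0] o Kfk[OF f] by (simp add: kap0 nn_integral_return)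
      ultimately show ?case using Suc by (simp add: algebra_simps)
    qed simp
    have bnd: "(Kf ^^ n) f x \<le> q ^ n" if f: "f \<in> borel_measurable M" "\<And>x. x \<in> space M \<Longrightarrow> f x \<le> 1" and x: "x \<in> space M" for f n x
      using x
    proof (induction n arbitrary: x)
      case 0 then show ?case using f by simp
    next
      case (Suc n)
      have sK: "space (K x) = space M" using sets_kernel[OF K Suc.prems] sets_eq_imp_space_eq by metis
      have "(Kf ^^ Suc n) f x = (\<integral>\<^sup>+y. (Kf ^^ n) f y \<partial>K x)" by (simp add: Kf_def)
      also have "\<dots> \<le> (\<integral>\<^sup>+y. q ^ n \<partial>K x)" by (rule nn_integral_mono) (use Suc.IH sK in simp)
      also have "\<dots> \<le> q ^ n * q" using mult_left_mono[OF Kq[OF Suc.prems], of "q ^ n"] by (simp add: sK)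
      finally show ?case by (simp add: mult.commute)
    qed
    have rep\<kappa>: "(\<integral>\<^sup>+y. f y \<partial>Q) = (\<integral>\<^sup>+y. f y \<partial>\<kappa>) * a"
      if f: "f \<in> borel_measurable M" "\<And>x. x \<in> space M \<Longrightarrow> f x \<le> 1" for f
    proof -
      interpret Q: prob_space Q by fact
      have "(\<lambda>n. \<Sum>k<n. \<integral>\<^sup>+y. f y \<partial>kap k) \<longlonglongrightarrow> (\<integral>\<^sup>+y. f y \<partial>\<kappa>)"
        unfolding int\<kappa>[OF f(1)] by (intro summable_LIMSEQ) simp
      moreover have "a \<noteq> \<top>" unfolding a_def by simp
      moreover have "(\<integral>\<^sup>+y. f y \<partial>\<kappa>) \<noteq> \<top>"
      proof -
        have "(\<integral>\<^sup>+y. f y \<partial>\<kappa>) \<le> (\<integral>\<^sup>+y. 1 \<partial>\<kappa>)" by (intro nn_integral_mono f(2)) (simp add: s\<kappa>)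
        then show ?thesis using c by (auto simp: s\<kappa> c_def[symmetric] top_unique)
      qed
      ultimately have "(\<lambda>n. (\<Sum>k<n. \<integral>\<^sup>+y. f y \<partial>kap k) * a) \<longlonglongrightarrow> (\<integral>\<^sup>+y. f y \<partial>\<kappa>) * a"
        by (intro tendsto_mult_ennreal) auto
      moreover have "(\<lambda>n. (\<integral>\<^sup>+x. (Kf ^^ n) f x \<partial>Q)) \<longlonglongrightarrow> 0"
      proof (rule tendsto_sandwich[of "\<lambda>_. 0" _ _ "\<lambda>n. q ^ n"])
        have "(\<integral>\<^sup>+x. (Kf ^^ n) f x \<partial>Q) \<le> (\<integral>\<^sup>+x. q ^ n \<partial>Q)" for n
          by (intro nn_integral_mono bnd f) (simp_all add: spQ)
        then show "\<forall>\<^sub>F n in sequentially. (\<integral>\<^sup>+x. (Kf ^^ n) f x \<partial>Q) \<le> q ^ n"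
          by (simp add: Q.emeasure_space_1)
        have "(\<lambda>n. ennreal (q' ^ n)) \<longlonglongrightarrow> ennreal 0" using q' by (intro tendsto_ennrealI LIMSEQ_power_zero) simp
        then show "(\<lambda>n. q ^ n) \<longlonglongrightarrow> 0" using q' by (simp add: ennreal_power)
      qed auto
      ultimately have "(\<lambda>n. (\<Sum>k<n. \<integral>\<^sup>+y. f y \<partial>kap k) * a + (\<integral>\<^sup>+x. (Kf ^^ n) f x \<partial>Q)) \<longlonglongrightarrow> (\<integral>\<^sup>+y. f y \<partial>\<kappa>) * a + 0"
        by (rule tendsto_add)
      then show ?thesis using fin_rep[OF f(1)] by (simp add: LIMSEQ_const_iff)
    qed
    have "1 = c * a" using rep\<kappa>[of "indicator (space M)"] s\<kappa> Q prob_space.emeasure_space_1[OF Q(1)] spQ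
      by (simp add: c_def indicator_le_1)
    then have a: "a = 1 / c" using c by (metis ennreal_mult_divide_eq mult.commute)
    show "Q = Q0"
    proof (rule measure_eqI)
      show "sets Q = sets Q0" using Q Q0 by simp
      fix B assume "B \<in> sets Q"
      then have B: "B \<in> sets M" using Q by simp
      show "emeasure Q B = emeasure Q0 B"
        using rep\<kappa>[of "indicator B"] B Q s\<kappa>
        by (simp add: Q0_def a mult.commute[of _ "1 / c"] split: split_indicator)
    qed
  qed
  show ?thesis
  proof (rule ex1I)
    show "prob_space Q0 \<and> sets Q0 = sets M \<and> Q0 \<bind> P = Q0" using Q0 Q0inv by blast
  qed (use uniq in blast)
qed

section \<open>Measurability of the process\<close>

locale resetting =
  fixes \<alpha> \<beta> \<theta> A :: real and ell :: "nat \<Rightarrow> real \<Rightarrow> real" and G :: "real measure"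
  assumes alpha: "\<alpha> > 0" and beta: "\<beta> > 0" and theta: "\<theta> > 0" and A: "\<beta> < A"
    and G_prob: "prob_space G" and G_sets: "sets G = sets (restrict_space borel {0..})"
    and ell_pos: "\<And>n z. n \<ge> 1 \<Longrightarrow> z > 0 \<Longrightarrow> ell n z > 0"
    and ell_cont: "\<And>n. n \<ge> 1 \<Longrightarrow> continuous_on {0..} (ell n)"
    and ell_exp: "\<And>n. n \<ge> 1 \<Longrightarrow>
           distributed G lborel (ell n) (\<lambda>y. ennreal (exponential_density \<theta> y))"
begin

abbreviation S :: "(nat \<times> real) measure" where "S \<equiv> state_space \<beta> A"
abbreviation E :: "real measure" where "E \<equiv> density lborel (\<lambda>y. ennreal (exponential_density 1 y))"
abbreviation D :: "(real \<times> real) measure" where "D \<equiv> E \<Otimes>\<^sub>M G"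
abbreviation \<Omega> :: "(nat \<Rightarrow> real \<times> real) measure" where "\<Omega> \<equiv> driving_space G"
abbreviation W :: "real \<Rightarrow> real \<Rightarrow> real" where "W \<equiv> waiting_time \<alpha> \<beta>"
abbreviation fl :: "real \<Rightarrow> real \<Rightarrow> real" where "fl \<equiv> flow \<alpha> \<beta>"
abbreviation J :: "nat \<times> real \<Rightarrow> real \<Rightarrow> nat \<times> real" where "J \<equiv> jump_map \<beta> A ell"
abbreviation skel where "skel \<equiv> skeleton \<alpha> \<beta> \<beta> A ell"
abbreviation proc where "proc \<equiv> process \<alpha> \<beta> \<beta> A ell"

text \<open>The integrated intensity along the flow in closed form; \<open>integral_fl\<close>
  identifies it with the integral in \<open>waiting_time\<close>.\<close>

definition H :: "real \<Rightarrow> real \<Rightarrow> real" where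
  "H l t = \<beta> * t + (l - \<beta>) * (1 - exp (- (\<alpha> * t))) / \<alpha>"

definition step :: "nat \<times> real \<Rightarrow> real \<times> real \<Rightarrow> nat \<times> real" where
  "step x p = J (fst x, fl (snd x) (W (snd x) (fst p))) (snd p)"

lemma space_S: "space S = UNIV \<times> {\<beta>..<A}"
  by (simp add: state_space_def space_pair_measure space_restrict_space)

lemma space_G: "space G = {0..}"
  using sets_eq_imp_space_eq[OF G_sets] by (simp add: space_restrict_space)

lemma prob_E: "prob_space E"
  by (rule prob_space_exponential_density) simp

lemma prob_D: "prob_space D"
proof -
  interpret E: prob_space E by (rule prob_E)
  interpret G: prob_space G by (rule G_prob)
  interpret pair_prob_space E G ..
  show ?thesis by unfold_locales
qed

sublocale D: prob_space D by (rule prob_D)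

sublocale seq: sequence_space D
  by unfold_locales

lemma Omega_eq: "\<Omega> = Pi\<^sub>M UNIV (\<lambda>_::nat. D)"
  by (simp add: driving_space_def)

lemma prob_Omega: "prob_space \<Omega>"
  unfolding Omega_eq by (rule prob_space_PiM) (rule prob_D)

section \<open>Flow, integrated intensity and waiting time\<close>

lemma fl_ge: "\<beta> \<le> l \<Longrightarrow> \<beta> \<le> fl l t"
  by (simp add: flow_def)

lemma fl_le:
  assumes "\<beta> \<le> l" "0 \<le> t" shows "fl l t \<le> l"
proof -
  have "(l - \<beta>) * exp (- (\<alpha> * t)) \<le> (l - \<beta>) * 1"
    using assms alpha by (intro mult_left_mono) auto
  then show ?thesis by (simp add: flow_def)
qed

lemma fl_fl: "fl (fl l s) t = fl l (s + t)"
  by (simp add: flow_def algebra_simps exp_add[symmetric])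

lemma integral_fl:
  assumes "0 \<le> t" shows "integral {0..t} (fl l) = H l t"
proof -
  have "((\<lambda>s. H l s) has_real_derivative fl l s) (at s)" for s
    unfolding H_def flow_def using alpha
    by (auto intro!: derivative_eq_intros simp: field_simps)
  then have "(fl l has_integral (H l t - H l 0)) {0..t}"
    using assms by (intro fundamental_theorem_of_calculus)
      (auto simp: has_real_derivative_iff_has_vector_derivative[symmetric] intro: has_field_derivative_at_within)
  then show ?thesis by (simp add: H_def integral_unique)
qed

lemma H_0 [simp]: "H l 0 = 0"
  by (simp add: H_def)

lemma H_add: "H l (s + t) = H l s + H (fl l s) t"
proof -
  have e: "exp (- (\<alpha> * (s + t))) = exp (- (\<alpha> * s)) * exp (- (\<alpha> * t))"
    by (simp add: exp_add[symmetric] algebra_simps)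
  show ?thesis unfolding H_def flow_def e using alpha by (simp add: field_simps)
qed

lemma H_ge:
  assumes "\<beta> \<le> l" "0 \<le> t" shows "\<beta> * t \<le> H l t"
  using assms alpha by (simp add: H_def)

lemma H_le:
  assumes "\<beta> \<le> l" "0 \<le> t" shows "H l t \<le> l * t"
proof -
  have "1 - exp (- (\<alpha> * t)) \<le> \<alpha> * t" using exp_ge_add_one_self[of "- (\<alpha> * t)"] by linarith
  then have "(l - \<beta>) * (1 - exp (- (\<alpha> * t))) / \<alpha> \<le> (l - \<beta>) * (\<alpha> * t) / \<alpha>"
    using assms alpha by (intro divide_right_mono mult_left_mono) auto
  also have "\<dots> = (l - \<beta>) * t" using alpha by simp
  finally show ?thesis by (simp add: H_def algebra_simps)
qed

lemma H_strict_mono: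
  assumes "\<beta> \<le> l" "0 \<le> s" "s < t" shows "H l s < H l t"
  using H_add[of l s "t - s"] H_ge[OF fl_ge[OF assms(1)], of "t - s" s] assms beta
  by (smt (verit) mult_pos_pos)

lemma H_mono: "\<beta> \<le> l \<Longrightarrow> 0 \<le> s \<Longrightarrow> s \<le> t \<Longrightarrow> H l s \<le> H l t"
  using H_strict_mono[of l s t] by (cases "s = t") auto

lemma W_set: "{t. 0 \<le> t \<and> e \<le> integral {0..t} (fl l)} = {t. 0 \<le> t \<and> e \<le> H l t}"
  using integral_fl by auto

lemma continuous_H: "continuous_on UNIV (H l)"
  unfolding H_def using alpha by (intro continuous_intros) auto

text \<open>The infimum is attained: the set is closed by continuity of \<open>H l\<close>, bounded
  below by 0, and non-empty because \<open>H l t\<close> is at least \<open>\<beta> * t\<close>.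
  Later arguments use this equivalence in place of \<open>Inf\<close>.\<close>

lemma W_le_iff:
  assumes l: "\<beta> \<le> l" shows "W l e \<le> t \<longleftrightarrow> 0 \<le> t \<and> e \<le> H l t"
proof -
  let ?X = "{t. 0 \<le> t \<and> e \<le> H l t}"
  have W: "W l e = Inf ?X" unfolding waiting_time_def W_set ..
  have "?X = {0..} \<inter> H l -` {e..}" by auto
  moreover have "closed (H l -` {e..})" by (intro closed_vimage continuous_H) auto
  ultimately have cl: "closed ?X" by auto
  have "max 0 (e / \<beta>) \<in> ?X"
    using H_ge[OF l, of "max 0 (e / \<beta>)"] beta by (auto simp: max_def field_simps split: if_splits)
  then have ne: "?X \<noteq> {}" by blast
  have bd: "bdd_below ?X" by (rule bdd_belowI[of _ 0]) auto
  have mem: "W l e \<in> ?X" unfolding W by (rule closed_contains_Inf[OF ne bd cl])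
  show ?thesis
  proof
    assume "W l e \<le> t"
    then show "0 \<le> t \<and> e \<le> H l t" using mem H_mono[OF l, of "W l e" t] by auto
  next
    assume "0 \<le> t \<and> e \<le> H l t"
    then show "W l e \<le> t" unfolding W by (intro cInf_lower bd) auto
  qed
qed

lemma W_nonneg: "\<beta> \<le> l \<Longrightarrow> 0 \<le> W l e"
  using W_le_iff[of l e "W l e"] by simp

lemma less_W_iff: "\<beta> \<le> l \<Longrightarrow> 0 \<le> t \<Longrightarrow> t < W l e \<longleftrightarrow> H l t < e"
  using W_le_iff[of l e t] by linarith

text \<open>The pathwise half of memorylessness. By \<open>H_add\<close> the part of the clock left
  at time \<open>t\<close> is used up by the flow restarted from \<open>fl l t\<close>; the
  probabilistic half is \<open>nn_integral_E_shift\<close>.\<close>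

lemma W_shift:
  assumes l: "\<beta> \<le> l" and t: "0 \<le> t" and e: "0 < e"
  shows "W l (H l t + e) = t + W (fl l t) e"
proof -
  have "W l (H l t + e) \<le> s \<longleftrightarrow> t + W (fl l t) e \<le> s" for s
  proof -
    have "W l (H l t + e) \<le> s \<longleftrightarrow> t \<le> s \<and> H l t + e \<le> H l s"
      using W_le_iff[OF l, of "H l t + e" s] H_mono[OF l, of s t] t e by (cases "s \<le> t") auto
    also have "\<dots> \<longleftrightarrow> 0 \<le> s - t \<and> e \<le> H (fl l t) (s - t)"
      using H_add[of l t "s - t"] by auto
    also have "\<dots> \<longleftrightarrow> W (fl l t) e \<le> s - t" using W_le_iff[OF fl_ge[OF l]] by simp
    finally show ?thesis by auto
  qed
  then show ?thesis by (meson order_antisym order_refl)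
qed

text \<open>Positivity is assumed for \<open>z > 0\<close> only; at \<open>z = 0\<close> it survives
  as a weak inequality by continuity from the right.\<close>

lemma ell_nonneg:
  assumes n: "n \<ge> 1" and z: "z \<ge> 0" shows "ell n z \<ge> 0"
proof (cases "z = 0")
  case True
  have "((ell n) \<longlongrightarrow> ell n 0) (at 0 within {0..})"
    using ell_cont[OF n] by (simp add: continuous_on_def)
  then have "((ell n) \<longlongrightarrow> ell n 0) (at_right 0)"
    by (rule tendsto_within_subset) auto
  moreover have "eventually (\<lambda>z. 0 \<le> ell n z) (at_right 0)"
    using ell_pos[OF n] by (auto simp: eventually_at_right_less eventually_at intro!: exI[of _ 1] less_imp_le)
  ultimately show ?thesis using True by (intro tendsto_lowerbound) auto
qed (use ell_pos[OF n, of z] z in auto)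

section \<open>Invariance of the state space and joint measurability\<close>

lemma jump_in_S:
  assumes "\<beta> \<le> snd x" "z \<ge> 0" shows "\<beta> \<le> snd (J x z)" "snd (J x z) < A"
  using assms A ell_nonneg[of "Suc (fst x)" z] by (auto simp: jump_map_def Let_def)

lemma step_in_S: "\<beta> \<le> snd x \<Longrightarrow> snd p \<ge> 0 \<Longrightarrow> step x p \<in> space S"
  using jump_in_S[of "(fst x, fl (snd x) (W (snd x) (fst p)))" "snd p"]
  by (auto simp: step_def space_S mem_Times_iff fl_ge)

lemma space_D: "space D = UNIV \<times> {0..}"
  by (simp add: space_pair_measure space_G)

lemma measurable_S_I:
  assumes "(\<lambda>p. fst (g p)) \<in> measurable M (count_space UNIV)"
    and "(\<lambda>p. snd (g p)) \<in> borel_measurable M"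
    and "\<And>p. p \<in> space M \<Longrightarrow> \<beta> \<le> snd (g p) \<and> snd (g p) < A"
  shows "g \<in> measurable M S"
  unfolding state_space_def
  by (rule measurable_pair) (use assms in \<open>auto simp: comp_def intro!: measurable_restrict_space2\<close>)

lemma measurable_S_fst [measurable]: "fst \<in> measurable S (count_space UNIV)"
  by (simp add: state_space_def)

lemma measurable_S_snd [measurable]: "snd \<in> borel_measurable S"
  unfolding state_space_def
  using measurable_compose[OF measurable_snd measurable_restrict_space1[OF measurable_ident]]
  by (simp add: id_def)

lemma measurable_W:
  assumes [measurable]: "f \<in> borel_measurable M" "g \<in> borel_measurable M"
    and f: "\<And>p. p \<in> space M \<Longrightarrow> \<beta> \<le> f p"
  shows "(\<lambda>p. W (f p) (g p)) \<in> borel_measurable M"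
proof (subst borel_measurable_iff_le, intro allI)
  fix t
  \<comment> \<open>\<open>W_le_iff\<close> replaces the infimum by the explicit function
    \<open>H\<close>, whose sublevel conditions are visibly measurable.\<close>
  have "{p \<in> space M. W (f p) (g p) \<le> t} = {p \<in> space M. 0 \<le> t \<and> g p \<le> H (f p) t}"
    using W_le_iff[OF f] by auto
  also have "\<dots> \<in> sets M" unfolding H_def by measurable
  finally show "{p \<in> space M. W (f p) (g p) \<le> t} \<in> sets M" .
qed

lemma measurable_ell: "n \<ge> 1 \<Longrightarrow> ell n \<in> borel_measurable G"
  using distributed_measurable[OF ell_exp[of n]] by simp

lemma measurable_jump:
  assumes [measurable]: "(\<lambda>p. fst (g p)) \<in> measurable M (count_space UNIV)"
      "(\<lambda>p. snd (g p)) \<in> borel_measurable M"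
    and z [measurable]: "z \<in> measurable M G" and g: "\<And>p. p \<in> space M \<Longrightarrow> \<beta> \<le> snd (g p)"
  shows "(\<lambda>p. J (g p) (z p)) \<in> measurable M S"
proof (rule measurable_S_I)
  have el [measurable]: "(\<lambda>p. ell (Suc (fst (g p))) (z p)) \<in> borel_measurable M"
    by (rule measurable_compose_countable[of "\<lambda>n p. ell (Suc n) (z p)" M borel "\<lambda>p. fst (g p)"])
      (auto intro!: measurable_compose[OF z] measurable_ell)
  show "(\<lambda>p. fst (J (g p) (z p))) \<in> measurable M (count_space UNIV)"
    unfolding jump_map_def Let_def if_distrib[of fst] fst_conv by measurable
  show "(\<lambda>p. snd (J (g p) (z p))) \<in> borel_measurable M"
    unfolding jump_map_def Let_def if_distrib[of snd] snd_conv by measurable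
  fix p assume "p \<in> space M"
  then show "\<beta> \<le> snd (J (g p) (z p)) \<and> snd (J (g p) (z p)) < A"
    using jump_in_S[OF g] measurable_space[OF z] by (auto simp: space_G)
qed

lemma measurable_step:
  assumes x: "x \<in> measurable M S" and p: "p \<in> measurable M D"
  shows "(\<lambda>w. step (x w) (p w)) \<in> measurable M S"
proof -
  have [measurable]: "(\<lambda>w. fst (x w)) \<in> measurable M (count_space UNIV)" "(\<lambda>w. snd (x w)) \<in> borel_measurable M"
    using measurable_compose[OF x measurable_S_fst] measurable_compose[OF x measurable_S_snd] .
  have xs: "\<beta> \<le> snd (x w)" if "w \<in> space M" for w
    using measurable_space[OF x that] by (auto simp: space_S)
  have p1: "(\<lambda>w. fst (p w)) \<in> borel_measurable M" using measurable_compose[OF p measurable_fst] by simp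
  have p2: "(\<lambda>w. snd (p w)) \<in> measurable M G" using measurable_compose[OF p measurable_snd] by simp
  have [measurable]: "(\<lambda>w. W (snd (x w)) (fst (p w))) \<in> borel_measurable M"
    by (rule measurable_W) (use p1 xs in auto)
  show ?thesis unfolding step_def
    by (rule measurable_jump[OF _ _ p2]) (use fl_ge[OF xs] in \<open>auto simp: flow_def\<close>)
qed

lemma skel_Suc:
  "skel x \<omega> (Suc k) =
    (fst (skel x \<omega> k) + W (snd (snd (skel x \<omega> k))) (fst (\<omega> k)), step (snd (skel x \<omega> k)) (\<omega> k))"
  by (auto simp: step_def Let_def split: prod.splits)

lemma measurable_skel:
  assumes x: "x \<in> measurable M S" and w: "\<omega> \<in> measurable M \<Omega>"
  shows "(\<lambda>p. fst (skel (x p) (\<omega> p) k)) \<in> borel_measurable M \<and>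
    (\<lambda>p. snd (skel (x p) (\<omega> p) k)) \<in> measurable M S"
proof (induction k)
  case 0 then show ?case using x by simp
next
  case (Suc k)
  have c: "(\<lambda>p. \<omega> p k) \<in> measurable M D"
    using w unfolding Omega_eq by (rule measurable_compose) (simp add: measurable_component_singleton)
  have "(\<lambda>p. W (snd (snd (skel (x p) (\<omega> p) k))) (fst (\<omega> p k))) \<in> borel_measurable M"
    using Suc measurable_space[of _ M S] measurable_compose[OF c measurable_fst]
      measurable_compose[of _ M S, OF _ measurable_S_snd]
    by (intro measurable_W) (fastforce simp: space_S mem_Times_iff)+
  then show ?case using Suc measurable_step[OF _ c] by (simp only: skel_Suc fst_conv snd_conv) auto
qed

text \<open>Membership is part of \<open>measurable_skel\<close>, since a measurable map takes its
  values in the target space; a one-point source space turns this into a pointwise fact.\<close>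

lemma skel_in_S:
  assumes "x \<in> space S" "\<omega> \<in> space \<Omega>" shows "snd (skel x \<omega> k) \<in> space S"
proof -
  have "(\<lambda>p. snd (skel x \<omega> k)) \<in> measurable (count_space {()}) S"
    using measurable_skel[of "\<lambda>_. x" "count_space {()}" "\<lambda>_. \<omega>" k] assms by simp
  from measurable_space[OF this, of "()"] show ?thesis by simp
qed

lemma proc_alt:
  "proc x t \<omega> = (let k = (LEAST k. t < fst (skel x \<omega> (Suc k))) in
     (fst (snd (skel x \<omega> k)), fl (snd (snd (skel x \<omega> k))) (t - fst (skel x \<omega> k))))"
  by (simp add: process_def Let_def split_beta del: skeleton.simps)

text \<open>\<open>not_less_Least\<close> needs no witness, so this also covers exploding paths, on
  which the \<open>LEAST\<close> is some unspecified number. Hence the process has values in the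
  state space on every path of \<open>\<Omega>\<close>, as measurability into \<open>S\<close>
  demands.\<close>

lemma skel_time_le:
  assumes "0 \<le> t" and k: "k = (LEAST k. t < fst (skel x \<omega> (Suc k)))"
  shows "fst (skel x \<omega> k) \<le> t"
proof (cases k)
  case (Suc j)
  then have "\<not> t < fst (skel x \<omega> (Suc j))"
    using not_less_Least[of j "\<lambda>k. t < fst (skel x \<omega> (Suc k))"] k by simp
  then show ?thesis using Suc by simp
qed (use assms in simp)

lemma measurable_proc:
  assumes t [measurable]: "t \<in> borel_measurable M" and x: "x \<in> measurable M S" and w: "\<omega> \<in> measurable M \<Omega>"
    and t0: "\<And>p. p \<in> space M \<Longrightarrow> 0 \<le> t p"
  shows "(\<lambda>p. proc (x p) (t p) (\<omega> p)) \<in> measurable M S"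
proof -
  note sk = measurable_skel[OF x w, THEN conjunct1] measurable_skel[OF x w, THEN conjunct2]
  note sk1 = measurable_compose[OF sk(2) measurable_S_fst] measurable_compose[OF sk(2) measurable_S_snd]
  define K where "K p = (LEAST k. t p < fst (skel (x p) (\<omega> p) (Suc k)))" for p
  have K: "K \<in> measurable M (count_space UNIV)"
    unfolding K_def[abs_def] using sk(1)[of "Suc _"] by (intro measurable_Least borel_measurable_pred_less) auto
  have a [measurable]: "(\<lambda>p. fst (snd (skel (x p) (\<omega> p) (K p)))) \<in> measurable M (count_space UNIV)"
    by (rule measurable_compose_countable[OF sk1(1) K])
  have b [measurable]: "(\<lambda>p. snd (snd (skel (x p) (\<omega> p) (K p)))) \<in> borel_measurable M"
    by (rule measurable_compose_countable[OF sk1(2) K])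
  have c [measurable]: "(\<lambda>p. fst (skel (x p) (\<omega> p) (K p))) \<in> borel_measurable M"
    by (rule measurable_compose_countable[OF sk(1) K])
  show ?thesis
    unfolding proc_alt Let_def K_def[symmetric]
  proof (rule measurable_S_I, unfold fst_conv snd_conv)
    show "(\<lambda>p. fl (snd (snd (skel (x p) (\<omega> p) (K p)))) (t p - fst (skel (x p) (\<omega> p) (K p)))) \<in> borel_measurable M"
      unfolding flow_def by measurable
    fix p assume p: "p \<in> space M"
    then have "snd (skel (x p) (\<omega> p) (K p)) \<in> space S"
      using skel_in_S[OF measurable_space[OF x] measurable_space[OF w]] by simp
    then show "\<beta> \<le> fl (snd (snd (skel (x p) (\<omega> p) (K p)))) (t p - fst (skel (x p) (\<omega> p) (K p))) \<and>
      fl (snd (snd (skel (x p) (\<omega> p) (K p)))) (t p - fst (skel (x p) (\<omega> p) (K p))) < A"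
      using skel_time_le[OF t0[OF p] K_def] fl_ge[of "snd (snd (skel (x p) (\<omega> p) (K p)))"]
        fl_le[of "snd (snd (skel (x p) (\<omega> p) (K p)))" "t p - fst (skel (x p) (\<omega> p) (K p))"]
      by (simp add: space_S mem_Times_iff)
  qed (rule a)
qed

end

section \<open>Renewal equation and semigroup\<close>

context resetting
begin

definition T :: "real \<Rightarrow> (nat \<times> real \<Rightarrow> ennreal) \<Rightarrow> nat \<times> real \<Rightarrow> ennreal" where
  "T t f x = (\<integral>\<^sup>+\<omega>. f (proc x t \<omega>) \<partial>\<Omega>)"

abbreviation drift :: "nat \<times> real \<Rightarrow> real \<Rightarrow> nat \<times> real" where
  "drift x t \<equiv> (fst x, fl (snd x) t)"

abbreviation first_jump :: "nat \<times> real \<Rightarrow> real \<times> real \<Rightarrow> real" where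
  "first_jump x p \<equiv> W (snd x) (fst p)"

sublocale Om: prob_space \<Omega> by (rule prob_Omega)

sublocale Gp: prob_space G by (rule G_prob)

lemma space_S_D: "x \<in> space S \<Longrightarrow> \<beta> \<le> snd x \<and> snd x < A"
  by (auto simp: space_S)

lemma drift_in_S: "x \<in> space S \<Longrightarrow> 0 \<le> t \<Longrightarrow> drift x t \<in> space S"
  using fl_ge[of "snd x" t] fl_le[of "snd x" t] by (auto simp: space_S)

section \<open>Restart of the path at the first jump\<close>

lemma measurable_cons:
  assumes "p \<in> measurable M D" "\<omega> \<in> measurable M \<Omega>"
  shows "(\<lambda>x. case_nat (p x) (\<omega> x)) \<in> measurable M \<Omega>"
  using assms unfolding Omega_eq by (rule measurable_case_nat')

text \<open>An infinite product of copies of \<open>D\<close> is the image of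
  \<open>D \<Otimes>\<^sub>M \<Omega>\<close> under prepending a coordinate. This is how one
  conditions on the first clock and mark.\<close>

lemma nn_integral_Omega_iter:
  assumes f: "f \<in> borel_measurable \<Omega>"
  shows "(\<integral>\<^sup>+\<omega>. f \<omega> \<partial>\<Omega>) = (\<integral>\<^sup>+p. \<integral>\<^sup>+\<omega>. f (case_nat p \<omega>) \<partial>\<Omega> \<partial>D)"
proof -
  have m: "(\<lambda>x. case_nat (fst x) (snd x)) \<in> measurable (D \<Otimes>\<^sub>M \<Omega>) \<Omega>"
    by (rule measurable_cons) auto
  have "\<Omega> = distr (D \<Otimes>\<^sub>M \<Omega>) \<Omega> (\<lambda>x. case_nat (fst x) (snd x))"
    using seq.PiM_iter unfolding Omega_eq by (simp add: case_prod_beta')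
  then have "(\<integral>\<^sup>+\<omega>. f \<omega> \<partial>\<Omega>) = (\<integral>\<^sup>+\<omega>. f \<omega> \<partial>distr (D \<Otimes>\<^sub>M \<Omega>) \<Omega> (\<lambda>x. case_nat (fst x) (snd x)))"
    by (rule arg_cong[of _ _ "\<lambda>M. integral\<^sup>N M f"])
  also have "\<dots> = (\<integral>\<^sup>+x. f (case_nat (fst x) (snd x)) \<partial>(D \<Otimes>\<^sub>M \<Omega>))"
    by (rule nn_integral_distr[OF m]) (use f in simp)
  also have "\<dots> = (\<integral>\<^sup>+p. \<integral>\<^sup>+\<omega>. f (case_nat p \<omega>) \<partial>\<Omega> \<partial>D)"
    using Om.nn_integral_fst[OF measurable_compose[OF m f]] by simp
  finally show ?thesis .
qed

lemma skel_cons: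
  "skel x (case_nat p \<omega>) (Suc k) =
    (first_jump x p + fst (skel (step x p) \<omega> k), snd (skel (step x p) \<omega> k))"
proof (induction k)
  case 0
  then show ?case by (simp only: skel_Suc) simp
next
  case (Suc k)
  show ?case
    by (simp only: skel_Suc[of x "case_nat p \<omega>" "Suc k"] Suc skel_Suc[of "step x p" \<omega> k]) simp
qed

lemma proc_cons_early: "t < first_jump x p \<Longrightarrow> proc x t (case_nat p \<omega>) = drift x t"
proof -
  assume t: "t < first_jump x p"
  have "(LEAST k. t < fst (skel x (case_nat p \<omega>) (Suc k))) = 0"
    by (rule Least_eq_0) (use t in \<open>simp only: skel_cons\<close>, simp)
  then show ?thesis by (simp add: proc_alt Let_def)
qed

text \<open>Moving the \<open>LEAST\<close> by one index requires some index at which the time is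
  passed; this hypothesis is where the absence of explosions enters the renewal equation.\<close>

lemma proc_cons_late:
  assumes "\<not> t < first_jump x p" and k: "t - first_jump x p < fst (skel (step x p) \<omega> (Suc k))"
  shows "proc x t (case_nat p \<omega>) = proc (step x p) (t - first_jump x p) \<omega>"
proof -
  let ?P = "\<lambda>k. t < fst (skel x (case_nat p \<omega>) (Suc k))"
  let ?y = "step x p"
  have P: "?P (Suc k) \<longleftrightarrow> t - first_jump x p < fst (skel ?y \<omega> (Suc k))" for k
    by (simp only: skel_cons fst_conv) linarith
  have "(LEAST k. ?P k) = Suc (LEAST k. ?P (Suc k))"
  proof (rule Least_Suc)
    show "?P (Suc k)" using k by (simp only: P)
    show "\<not> ?P 0" using assms(1) by (simp only: skel_cons) simp
  qed
  then show ?thesis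
    unfolding proc_alt Let_def P by (simp only: skel_cons fst_conv snd_conv) (simp add: algebra_simps)
qed

text \<open>Memorylessness of the unit exponential clock: translating by \<open>h\<close> multiplies
  the density by \<open>exp (- h)\<close>.\<close>

lemma nn_integral_E_shift:
  assumes [measurable]: "f \<in> borel_measurable borel" and h: "0 \<le> h"
  shows "(\<integral>\<^sup>+e. indicator {h<..} e * f e \<partial>E) = ennreal (exp (- h)) * (\<integral>\<^sup>+e. f (h + e) \<partial>E)"
proof -
  have "(\<integral>\<^sup>+e. indicator {h<..} e * f e \<partial>E) =
      (\<integral>\<^sup>+e. ennreal (exponential_density 1 e) * (indicator {h<..} e * f e) \<partial>lborel)"
    by (subst nn_integral_density) auto
  also have "\<dots> = (\<integral>\<^sup>+e. ennreal (exponential_density 1 (h + e)) * (indicator {h<..} (h + e) * f (h + e)) \<partial>lborel)"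
    by (subst nn_integral_real_affine[where c=1 and t=h]) auto
  also have "\<dots> = (\<integral>\<^sup>+e. ennreal (exp (- h)) * (ennreal (exponential_density 1 e) * f (h + e)) \<partial>lborel)"
  proof (rule nn_integral_cong_AE, rule AE_mp[OF AE_lborel_singleton[of 0]], rule AE_I2, rule impI)
    \<comment> \<open>At \<open>e = 0\<close> the open indicator vanishes while the density does
      not, so this point has to be discarded as a null set.\<close>
    fix e :: real assume "e \<noteq> 0"
    then show "ennreal (exponential_density 1 (h + e)) * (indicator {h<..} (h + e) * f (h + e)) =
      ennreal (exp (- h)) * (ennreal (exponential_density 1 e) * f (h + e))"
      using h by (cases "e > 0") (auto simp: exponential_density_def mult.assoc[symmetric] ennreal_mult[symmetric] exp_add[symmetric])
  qed
  also have "\<dots> = ennreal (exp (- h)) * (\<integral>\<^sup>+e. f (h + e) \<partial>E)"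
    by (subst nn_integral_cmult) (auto simp: nn_integral_density)
  finally show ?thesis .
qed

lemma AE_E_pos: "AE e in E. 0 < e"
proof -
  have "AE e in lborel. 0 < ennreal (exponential_density 1 e) \<longrightarrow> 0 < e"
    using AE_lborel_singleton[of 0] by eventually_elim (auto simp: exponential_density_def split: if_splits)
  then show ?thesis by (subst AE_density) auto
qed

lemma nn_integral_D_shift:
  assumes f: "f \<in> borel_measurable D" and h: "0 \<le> h"
  shows "(\<integral>\<^sup>+p. indicator {h<..} (fst p) * f p \<partial>D) = ennreal (exp (- h)) * (\<integral>\<^sup>+p. f (h + fst p, snd p) \<partial>D)"
proof -
  interpret E: prob_space E by (rule prob_E)
  interpret EG: pair_sigma_finite E G ..
  have f1: "(\<lambda>p. indicator {h<..} (fst p) * f p) \<in> borel_measurable D"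
    using f by measurable
  have m: "(\<lambda>p. (h + fst p, snd p)) \<in> measurable D D"
    by (rule measurable_Pair) (auto intro!: measurable_transfer_sets[of _ "lborel \<Otimes>\<^sub>M G"] sets_pair_measure_cong)
  have f2: "(\<lambda>p. f (h + fst p, snd p)) \<in> borel_measurable D"
    by (rule measurable_compose[OF m f])
  have sec: "(\<lambda>e. f (e, z)) \<in> borel_measurable borel" if "z \<in> space G" for z
    using measurable_compose[OF measurable_Pair2'[OF that, of E] f] by simp
  have "(\<integral>\<^sup>+p. indicator {h<..} (fst p) * f p \<partial>D) = (\<integral>\<^sup>+z. \<integral>\<^sup>+e. indicator {h<..} e * f (e, z) \<partial>E \<partial>G)"
    using EG.nn_integral_snd[of "\<lambda>p. indicator {h<..} (fst p) * f p"] f1 by simp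
  also have "\<dots> = (\<integral>\<^sup>+z. ennreal (exp (- h)) * (\<integral>\<^sup>+e. f (h + e, z) \<partial>E) \<partial>G)"
    by (intro nn_integral_cong nn_integral_E_shift h sec)
  also have "\<dots> = ennreal (exp (- h)) * (\<integral>\<^sup>+z. \<integral>\<^sup>+e. f (h + e, z) \<partial>E \<partial>G)"
    using E.borel_measurable_nn_integral[of "\<lambda>z e. f (h + e, z)" G]
      measurable_compose[OF measurable_pair_swap' f2]
    by (subst nn_integral_cmult) (auto simp: case_prod_beta')
  also have "\<dots> = ennreal (exp (- h)) * (\<integral>\<^sup>+p. f (h + fst p, snd p) \<partial>D)"
    using EG.nn_integral_snd[of "\<lambda>p. f (h + fst p, snd p)"] f2 by simp
  finally show ?thesis .
qed

lemma measurable_first_jump: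
  assumes x: "x \<in> measurable M S" and p: "p \<in> measurable M D"
  shows "(\<lambda>w. first_jump (x w) (p w)) \<in> borel_measurable M"
  using measurable_compose[OF x measurable_S_snd] measurable_compose[OF p measurable_fst] measurable_space[OF x]
  by (intro measurable_W) (auto dest: space_S_D)

lemma measurable_first_jump' [measurable]: "x \<in> space S \<Longrightarrow> (\<lambda>p. first_jump x p) \<in> borel_measurable D"
  by (rule measurable_first_jump) auto

lemma measurable_step' [measurable]: "x \<in> space S \<Longrightarrow> (\<lambda>p. step x p) \<in> measurable D S"
  by (rule measurable_step) auto

lemma emeasure_late:
  assumes x: "x \<in> space S" and t: "0 \<le> t"
  shows "emeasure D {p \<in> space D. t < first_jump x p} = ennreal (exp (- H (snd x) t))"
    and "emeasure D {p \<in> space D. first_jump x p \<le> t} = ennreal (1 - exp (- H (snd x) t))"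
proof -
  have h: "0 \<le> H (snd x) t" using H_mono[of "snd x" 0 t] space_S_D[OF x] t by simp
  have m [measurable]: "{p \<in> space D. t < first_jump x p} \<in> sets D" using x by measurable
  have "emeasure D {p \<in> space D. t < first_jump x p} = (\<integral>\<^sup>+p. indicator {H (snd x) t<..} (fst p) * 1 \<partial>D)"
    using less_W_iff[of "snd x" t] space_S_D[OF x] t
    by (subst nn_integral_indicator[symmetric, OF m], intro nn_integral_cong) (auto split: split_indicator)
  also have "\<dots> = ennreal (exp (- H (snd x) t))"
    using nn_integral_D_shift[of "\<lambda>_. 1" "H (snd x) t"] h by (simp add: D.emeasure_space_1)
  finally show 1: "emeasure D {p \<in> space D. t < first_jump x p} = ennreal (exp (- H (snd x) t))" .
  have "{p \<in> space D. first_jump x p \<le> t} = space D - {p \<in> space D. t < first_jump x p}" by auto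
  then have "emeasure D {p \<in> space D. first_jump x p \<le> t} = emeasure D (space D) - emeasure D {p \<in> space D. t < first_jump x p}"
    by (simp only:, intro emeasure_compl[OF m]) simp
  then show "emeasure D {p \<in> space D. first_jump x p \<le> t} = ennreal (1 - exp (- H (snd x) t))"
    by (simp add: 1 D.emeasure_space_1 ennreal_minus ennreal_1[symmetric] del: ennreal_1)
qed

text \<open>Iterating the two inequalities bounds the excess of \<open>z\<close> over \<open>v\<close> by the probability of \<open>n\<close> jumps before
  time \<open>t\<close>, which is at most \<open>(1 - exp (- A * t)) ^ n\<close> because the intensity stays below \<open>A\<close>.\<close>

lemma renewal_comparison:
  fixes z v :: "real \<Rightarrow> nat \<times> real \<Rightarrow> ennreal"
  assumes z1: "\<And>t x. 0 \<le> t \<Longrightarrow> x \<in> space S \<Longrightarrow> z t x \<le> 1"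
    and z: "\<And>t x. 0 \<le> t \<Longrightarrow> x \<in> space S \<Longrightarrow>
      z t x \<le> (\<integral>\<^sup>+p. (if t < first_jump x p then F t x else z (t - first_jump x p) (step x p)) \<partial>D)"
    and v: "\<And>t x. 0 \<le> t \<Longrightarrow> x \<in> space S \<Longrightarrow>
      (\<integral>\<^sup>+p. (if t < first_jump x p then F t x else v (t - first_jump x p) (step x p)) \<partial>D) \<le> v t x"
    and vm: "\<And>t x. 0 \<le> t \<Longrightarrow> x \<in> space S \<Longrightarrow>
      (\<lambda>p. if t < first_jump x p then F t x else v (t - first_jump x p) (step x p)) \<in> borel_measurable D"
    and t: "0 \<le> t" and x: "x \<in> space S"
  shows "z t x \<le> v t x"
proof -
  define s where "s = t"
  define q where "q = 1 - exp (- (A * s))"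
  have q: "0 \<le> q" "q < 1" unfolding q_def s_def using A beta t by auto
  \<comment> \<open>The horizon \<open>s\<close> stays fixed while \<open>t\<close> and
    \<open>x\<close> vary: after a jump the claim is used at the remaining time and the new state,
    with the same \<open>q\<close>.\<close>
  have it: "z t x \<le> v t x + ennreal q ^ n" if "0 \<le> t" "t \<le> s" "x \<in> space S" for n t x
    using that
  proof (induction n arbitrary: t x)
    case 0
    then show ?case using z1[of t x] by (simp add: add_increasing)
  next
    case (Suc n)
    let ?w = "\<lambda>p. if t < first_jump x p then F t x else v (t - first_jump x p) (step x p)"
    let ?I = "{p \<in> space D. first_jump x p \<le> t}"
    have x: "\<beta> \<le> snd x" "snd x < A" using space_S_D[OF Suc.prems(3)] by auto
    have I: "?I \<in> sets D" using measurable_first_jump'[OF Suc.prems(3)] by measurable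
    have HA: "H (snd x) t \<le> A * s"
    proof -
      have "H (snd x) t \<le> snd x * t" using H_le x Suc.prems by simp
      also have "\<dots> \<le> A * s" using x beta Suc.prems by (intro mult_mono) auto
      finally show ?thesis .
    qed
    have "z t x \<le> (\<integral>\<^sup>+p. (if t < first_jump x p then F t x else z (t - first_jump x p) (step x p)) \<partial>D)"
      using z Suc.prems by simp
    also have "\<dots> \<le> (\<integral>\<^sup>+p. ?w p + ennreal q ^ n * indicator ?I p \<partial>D)"
    proof (rule nn_integral_mono)
      fix p assume p: "p \<in> space D"
      show "(if t < first_jump x p then F t x else z (t - first_jump x p) (step x p)) \<le> ?w p + ennreal q ^ n * indicator ?I p"
      proof (cases "t < first_jump x p")
        case False
        then show ?thesis
          using Suc.IH[of "t - first_jump x p" "step x p"] p W_nonneg[OF x(1), of "fst p"] Suc.prems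
            step_in_S[OF x(1), of p] by (auto simp: space_D)
      qed simp
    qed
    also have "\<dots> = (\<integral>\<^sup>+p. ?w p \<partial>D) + ennreal q ^ n * emeasure D ?I"
      using vm[OF Suc.prems(1,3)] I by (subst nn_integral_add) (auto simp: nn_integral_cmult_indicator)
    also have "\<dots> \<le> v t x + ennreal q ^ n * ennreal q"
      unfolding emeasure_late[OF Suc.prems(3,1)] q_def
      using v[OF Suc.prems(1,3)] HA by (intro add_mono mult_left_mono ennreal_leI) auto
    finally show ?case by (simp add: mult.commute)
  qed
  have "(\<lambda>n. ennreal (q ^ n)) \<longlonglongrightarrow> ennreal 0" using q by (intro tendsto_ennrealI LIMSEQ_power_zero) simp
  then have "(\<lambda>n. v t x + ennreal q ^ n) \<longlonglongrightarrow> v t x + 0"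
    using q by (intro tendsto_add tendsto_const) (simp add: ennreal_power)
  then show ?thesis
    using it[OF t _ x] by (intro LIMSEQ_le_const[of "\<lambda>n. v t x + ennreal q ^ n"]) (auto simp: s_def)
qed

lemma measurable_proc_Om:
  assumes "x \<in> space S" "0 \<le> t" shows "(\<lambda>\<omega>. proc x t \<omega>) \<in> measurable \<Omega> S"
  by (rule measurable_proc) (use assms in auto)

lemma measurable_skel_time:
  assumes "x \<in> space S" shows "(\<lambda>\<omega>. fst (skel x \<omega> k)) \<in> borel_measurable \<Omega>"
  using measurable_skel[of "\<lambda>_. x" \<Omega> "\<lambda>\<omega>. \<omega>" k] assms by simp

text \<open>The probability that all jump times stay below \<open>t\<close> satisfies the renewal
  equation with zero contribution from paths without a jump. The zero function solves the same
  equation, so \<open>renewal_comparison\<close> makes the probability vanish.\<close>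

lemma AE_no_explosion:
  assumes t: "0 \<le> t" and x: "x \<in> space S"
  shows "AE \<omega> in \<Omega>. \<exists>k. t < fst (skel x \<omega> (Suc k))"
proof -
  define X where "X t x = {\<omega> \<in> space \<Omega>. \<forall>k. fst (skel x \<omega> (Suc k)) \<le> t}" for t :: real and x
  have X: "X t x \<in> sets \<Omega>" if "x \<in> space S" for t x
  proof -
    have [measurable]: "\<And>k. (\<lambda>\<omega>. fst (skel x \<omega> (Suc k))) \<in> borel_measurable \<Omega>"
      using measurable_skel_time[OF that] by blast
    show ?thesis unfolding X_def by measurable
  qed
  have "emeasure \<Omega> (X t x) \<le> 0"
  proof (rule renewal_comparison[where z="\<lambda>t x. emeasure \<Omega> (X t x)" and F="\<lambda>_ _. 0" and v="\<lambda>_ _. 0", OF _ _ _ _ t x])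
    fix t :: real and x :: "nat \<times> real" assume t: "0 \<le> t" and x: "x \<in> space S"
    show "emeasure \<Omega> (X t x) \<le> 1" by (rule Om.emeasure_le_1)
    have "emeasure \<Omega> (X t x) = (\<integral>\<^sup>+\<omega>. indicator (X t x) \<omega> \<partial>\<Omega>)" using X[OF x] by simp
    also have "\<dots> = (\<integral>\<^sup>+p. \<integral>\<^sup>+\<omega>. indicator (X t x) (case_nat p \<omega>) \<partial>\<Omega> \<partial>D)"
      using X[OF x] by (intro nn_integral_Omega_iter) simp
    also have "\<dots> = (\<integral>\<^sup>+p. (if t < first_jump x p then 0 else emeasure \<Omega> (X (t - first_jump x p) (step x p))) \<partial>D)"
    proof (rule nn_integral_cong)
      fix p assume p: "p \<in> space D"
      have y: "step x p \<in> space S" using measurable_space[OF measurable_step'[OF x] p] .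
      have sp: "case_nat p \<omega> \<in> space \<Omega>" if "\<omega> \<in> space \<Omega>" for \<omega>
        using that p by (auto simp: Omega_eq space_PiM PiE_iff split: nat.split)
      have late: "(\<forall>k. fst (skel x (case_nat p \<omega>) (Suc k)) \<le> t) \<longleftrightarrow> first_jump x p \<le> t \<and>
          (\<forall>k. fst (skel (step x p) \<omega> (Suc k)) \<le> t - first_jump x p)" for \<omega>
      proof -
        have "(\<forall>k. fst (skel x (case_nat p \<omega>) (Suc k)) \<le> t) \<longleftrightarrow>
          fst (skel x (case_nat p \<omega>) (Suc 0)) \<le> t \<and> (\<forall>k. fst (skel x (case_nat p \<omega>) (Suc (Suc k))) \<le> t)"
          by (metis not0_implies_Suc)
        then show ?thesis by (simp only: skel_cons) (auto simp: algebra_simps)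
      qed
      have "(\<integral>\<^sup>+\<omega>. indicator (X t x) (case_nat p \<omega>) \<partial>\<Omega>) =
        (\<integral>\<^sup>+\<omega>. (if t < first_jump x p then 0 else indicator (X (t - first_jump x p) (step x p)) \<omega>) \<partial>\<Omega>)"
        by (rule nn_integral_cong) (auto simp: X_def late sp simp del: skeleton.simps split: split_indicator)
      then show "(\<integral>\<^sup>+\<omega>. indicator (X t x) (case_nat p \<omega>) \<partial>\<Omega>) =
        (if t < first_jump x p then 0 else emeasure \<Omega> (X (t - first_jump x p) (step x p)))"
        using X[OF y] by simp
    qed
    finally show "emeasure \<Omega> (X t x) \<le> (\<integral>\<^sup>+p. (if t < first_jump x p then 0 else emeasure \<Omega> (X (t - first_jump x p) (step x p))) \<partial>D)"
      by simp
  qed (auto)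
  then have "AE \<omega> in \<Omega>. \<omega> \<notin> X t x"
    using X[OF x] by (intro AE_not_in) (auto simp: null_sets_def)
  then show ?thesis by (rule AE_mp) (auto simp: X_def not_le simp del: skeleton.simps intro!: AE_I2)
qed

lemma measurable_T:
  assumes [measurable]: "f \<in> borel_measurable S" and x: "x \<in> measurable M S" and t: "t \<in> borel_measurable M"
    and t0: "\<And>p. p \<in> space M \<Longrightarrow> 0 \<le> t p"
  shows "(\<lambda>p. T (t p) f (x p)) \<in> borel_measurable M"
  unfolding T_def
proof (rule Om.borel_measurable_nn_integral)
  have "(\<lambda>w. proc (x (fst w)) (t (fst w)) (snd w)) \<in> measurable (M \<Otimes>\<^sub>M \<Omega>) S"
    by (rule measurable_proc) (use x t t0 in \<open>auto simp: space_pair_measure\<close>)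
  then show "(\<lambda>(p, \<omega>). f (proc (x p) (t p) \<omega>)) \<in> borel_measurable (M \<Otimes>\<^sub>M \<Omega>)"
    using measurable_compose[of _ _ S f] assms(1) by (simp add: case_prod_beta')
qed

lemma measurable_T_after_jump:
  assumes f: "f \<in> borel_measurable S" and x: "x \<in> space S" and s: "0 \<le> s"
  shows "(\<lambda>p. if t < first_jump x p then c else T (t - first_jump x p + s) f (step x p)) \<in> borel_measurable D"
proof -
  \<comment> \<open>\<open>measurable_T\<close> asks for non-negative times everywhere; the
    truncation by \<open>max 0\<close> changes nothing on the branch that is used.\<close>
  have [measurable]: "(\<lambda>p. T (max 0 (t - first_jump x p) + s) f (step x p)) \<in> borel_measurable D"
    by (rule measurable_T) (use f x s in auto)
  have [measurable]: "(\<lambda>p. first_jump x p) \<in> borel_measurable D" using x by simp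
  have "(\<lambda>p. if t < first_jump x p then c else T (max 0 (t - first_jump x p) + s) f (step x p)) \<in> borel_measurable D"
    by measurable
  also have "(\<lambda>p. if t < first_jump x p then c else T (max 0 (t - first_jump x p) + s) f (step x p)) =
    (\<lambda>p. if t < first_jump x p then c else T (t - first_jump x p + s) f (step x p))"
    by (auto simp: fun_eq_iff max_def)
  finally show ?thesis .
qed

text \<open>Splits off the first clock and mark. Before the first jump the path is the flow,
  afterwards it is almost surely the path restarted from \<open>step x p\<close>.\<close>

lemma renewal:
  assumes f [measurable]: "f \<in> borel_measurable S" and t: "0 \<le> t" and x: "x \<in> space S"
  shows "T t f x = (\<integral>\<^sup>+p. (if t < first_jump x p then f (drift x t) else T (t - first_jump x p) f (step x p)) \<partial>D)"
proof -
  have "T t f x = (\<integral>\<^sup>+p. \<integral>\<^sup>+\<omega>. f (proc x t (case_nat p \<omega>)) \<partial>\<Omega> \<partial>D)"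
    unfolding T_def by (rule nn_integral_Omega_iter) (rule measurable_compose[OF measurable_proc_Om[OF x t] f])
  also have "\<dots> = (\<integral>\<^sup>+p. (if t < first_jump x p then f (drift x t) else T (t - first_jump x p) f (step x p)) \<partial>D)"
  proof (rule nn_integral_cong)
    fix p assume p: "p \<in> space D"
    have y: "step x p \<in> space S" using measurable_space[OF measurable_step'[OF x] p] .
    show "(\<integral>\<^sup>+\<omega>. f (proc x t (case_nat p \<omega>)) \<partial>\<Omega>) =
      (if t < first_jump x p then f (drift x t) else T (t - first_jump x p) f (step x p))"
    proof (cases "t < first_jump x p")
      case True
      then show ?thesis by (simp add: proc_cons_early Om.emeasure_space_1)
    next
      case False
      have "(\<integral>\<^sup>+\<omega>. f (proc x t (case_nat p \<omega>)) \<partial>\<Omega>) = (\<integral>\<^sup>+\<omega>. f (proc (step x p) (t - first_jump x p) \<omega>) \<partial>\<Omega>)"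
      proof (rule nn_integral_cong_AE)
        have "AE \<omega> in \<Omega>. \<exists>k. t - first_jump x p < fst (skel (step x p) \<omega> (Suc k))"
          by (rule AE_no_explosion[OF _ y]) (use False in simp)
        then show "AE \<omega> in \<Omega>. f (proc x t (case_nat p \<omega>)) = f (proc (step x p) (t - first_jump x p) \<omega>)"
          by eventually_elim (use proc_cons_late[OF False] in metis)
      qed
      then show ?thesis using False by (simp add: T_def)
    qed
  qed
  finally show ?thesis .
qed

lemma T_le_1:
  assumes "\<And>x. x \<in> space S \<Longrightarrow> f x \<le> 1" "0 \<le> t" "x \<in> space S" shows "T t f x \<le> 1"
proof -
  have "T t f x \<le> (\<integral>\<^sup>+\<omega>. 1 \<partial>\<Omega>)"
    unfolding T_def using assms measurable_space[OF measurable_proc_Om] by (intro nn_integral_mono) auto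
  then show ?thesis by (simp add: Om.emeasure_space_1)
qed

text \<open>This is the equation that \<open>renewal\<close> gives for \<open>T t (T s f)\<close>,
  now for \<open>T (t + s) f\<close>, so the two can be compared. In the renewal equation at time
  \<open>t + s\<close> only the paths without a jump up to \<open>t\<close> need rewriting: there
  the clock exceeds \<open>H (snd x) t\<close>, its excess is again exponential, and by
  \<open>W_shift\<close> the path continues as one started from \<open>drift x t\<close>.\<close>

lemma renewal_shifted:
  assumes f [measurable]: "f \<in> borel_measurable S" and t: "0 \<le> t" and s: "0 \<le> s" and x: "x \<in> space S"
  shows "T (t + s) f x =
    (\<integral>\<^sup>+p. (if t < first_jump x p then T s f (drift x t) else T (t - first_jump x p + s) f (step x p)) \<partial>D)"
proof -
  define g where "g p = (if t + s < first_jump x p then f (drift x (t + s)) else T (t + s - first_jump x p) f (step x p))" for p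
  have l: "\<beta> \<le> snd x" using space_S_D[OF x] by simp
  let ?h = "H (snd x) t"
  have h: "0 \<le> ?h" using H_mono[OF l, of 0 t] t by simp
  have g [measurable]: "g \<in> borel_measurable D"
    unfolding g_def using measurable_T_after_jump[OF f x, of 0 "t + s", unfolded add_0_right] by simp
  have fj [measurable]: "(\<lambda>p. first_jump x p) \<in> borel_measurable D" using x by simp
  have early: "indicator {?h<..} (fst p) = (indicator {p. t < first_jump x p} p :: ennreal)" for p :: "real \<times> real"
    using less_W_iff[OF l t] by (auto split: split_indicator)
  have 1: "(\<integral>\<^sup>+p. indicator {p. t < first_jump x p} p * g p \<partial>D) =
      (\<integral>\<^sup>+p. indicator {p. t < first_jump x p} p * T s f (drift x t) \<partial>D)"
  proof -
    have "(\<integral>\<^sup>+p. g (?h + fst p, snd p) \<partial>D) = T s f (drift x t)"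
      unfolding renewal[OF f s drift_in_S[OF x t]]
    proof (rule nn_integral_cong_AE)
      have "AE p in D. 0 < fst p"
      proof -
        interpret E: prob_space E by (rule prob_E)
        interpret EG: pair_sigma_finite E G ..
        have "{p \<in> space D. 0 < fst p} \<in> sets D" by measurable
        then show ?thesis
          by (rule EG.AE_pair_measure) (use AE_E_pos in auto)
      qed
      then show "AE p in D. g (?h + fst p, snd p) = (if s < first_jump (drift x t) p then f (drift (drift x t) s)
          else T (s - first_jump (drift x t) p) f (step (drift x t) p))"
      proof eventually_elim
        case (elim p)
        have w: "first_jump x (?h + fst p, snd p) = t + first_jump (drift x t) p"
          using W_shift[OF l t elim] by simp
        then have "step x (?h + fst p, snd p) = step (drift x t) p"
          by (simp add: step_def fl_fl)
        then show ?case using w by (simp add: g_def fl_fl)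
      qed
    qed
    then have "(\<integral>\<^sup>+p. indicator {p. t < first_jump x p} p * g p \<partial>D) = ennreal (exp (- ?h)) * T s f (drift x t)"
      using nn_integral_D_shift[OF g h] by (simp add: early)
    moreover have "(\<integral>\<^sup>+p. indicator {p. t < first_jump x p} p * T s f (drift x t) \<partial>D) = ennreal (exp (- ?h)) * T s f (drift x t)"
      using nn_integral_D_shift[of "\<lambda>_. T s f (drift x t)" ?h] h by (simp add: early D.emeasure_space_1)
    ultimately show ?thesis by simp
  qed
  have late [measurable]: "{p \<in> space D. t < first_jump x p} \<in> sets D" by measurable
  have ind [measurable]: "(indicator {p. t < first_jump x p} :: _ \<Rightarrow> ennreal) \<in> borel_measurable D"
    by (subst borel_measurable_indicator_iff) (use late in \<open>simp add: Int_def conj_commute\<close>)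
  let ?r = "\<lambda>p. if t < first_jump x p then 0 else T (t - first_jump x p + s) f (step x p)"
  have r [measurable]: "?r \<in> borel_measurable D" by (rule measurable_T_after_jump[OF f x s])
  have "T (t + s) f x = (\<integral>\<^sup>+p. g p \<partial>D)"
    unfolding g_def by (rule renewal) (use f t s x in auto)
  also have "\<dots> = (\<integral>\<^sup>+p. indicator {p. t < first_jump x p} p * g p + ?r p \<partial>D)"
    by (intro nn_integral_cong) (use s in \<open>auto simp: g_def algebra_simps split: split_indicator\<close>)
  also have "\<dots> = (\<integral>\<^sup>+p. indicator {p. t < first_jump x p} p * g p \<partial>D) + (\<integral>\<^sup>+p. ?r p \<partial>D)"
    by (rule nn_integral_add) measurable
  also have "\<dots> = (\<integral>\<^sup>+p. indicator {p. t < first_jump x p} p * T s f (drift x t) + ?r p \<partial>D)"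
    unfolding 1 by (rule nn_integral_add[symmetric]) measurable
  also have "\<dots> = (\<integral>\<^sup>+p. (if t < first_jump x p then T s f (drift x t) else T (t - first_jump x p + s) f (step x p)) \<partial>D)"
    by (intro nn_integral_cong) (auto split: split_indicator)
  finally show ?thesis .
qed

text \<open>Both sides are bounded by 1 and solve the same renewal equation, by
  \<open>renewal_shifted\<close> and \<open>renewal\<close>; comparison in both directions gives
  equality.\<close>

lemma semigroup:
  assumes f: "f \<in> borel_measurable S" and f1: "\<And>x. x \<in> space S \<Longrightarrow> f x \<le> 1"
    and t: "0 \<le> t" and s: "0 \<le> s" and x: "x \<in> space S"
  shows "T (t + s) f x = T t (T s f) x"
proof -
  have Tm: "T s f \<in> borel_measurable S"
    using measurable_T[OF f measurable_ident, of "\<lambda>_. s"] s by simp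
  have T1: "T s f x \<le> 1" if "x \<in> space S" for x by (rule T_le_1[OF f1 s that])
  have u: "T (t + s) f x = (\<integral>\<^sup>+p. (if t < first_jump x p then T s f (drift x t) else T (t - first_jump x p + s) f (step x p)) \<partial>D)"
    if "0 \<le> t" "x \<in> space S" for t x
    by (rule renewal_shifted[OF f that(1) s that(2)])
  have um: "(\<lambda>p. if t < first_jump x p then T s f (drift x t) else T (t - first_jump x p + s) f (step x p)) \<in> borel_measurable D"
    if "0 \<le> t" "x \<in> space S" for t x
    by (rule measurable_T_after_jump[OF f that(2) s])
  have vm: "(\<lambda>p. if t < first_jump x p then T s f (drift x t) else T (t - first_jump x p) (T s f) (step x p)) \<in> borel_measurable D"
    if "0 \<le> t" "x \<in> space S" for t x
    using measurable_T_after_jump[OF Tm that(2), of 0 t, unfolded add_0_right] by simp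
  note v = renewal[OF Tm]
  have U1: "T (t + s) f x \<le> 1" if "0 \<le> t" "x \<in> space S" for t x
    by (rule T_le_1[OF f1 _ that(2)]) (use that s in auto)
  have V1: "T t (T s f) x \<le> 1" if "0 \<le> t" "x \<in> space S" for t x
    by (rule T_le_1[OF T1 that])
  show ?thesis
  proof (rule antisym)
    show "T (t + s) f x \<le> T t (T s f) x"
      by (rule renewal_comparison[where z="\<lambda>t x. T (t + s) f x" and v="\<lambda>t x. T t (T s f) x" and F="\<lambda>t x. T s f (drift x t)",
            OF U1 eq_refl[OF u] eq_refl[OF v[symmetric]] vm t x])
    show "T t (T s f) x \<le> T (t + s) f x"
      by (rule renewal_comparison[where v="\<lambda>t x. T (t + s) f x" and z="\<lambda>t x. T t (T s f) x" and F="\<lambda>t x. T s f (drift x t)",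
            OF V1 eq_refl[OF v] eq_refl[OF u[symmetric]] um t x])
  qed
qed

section \<open>Minorisation at the reset state\<close>

lemma sets_reset_state: "{(0, \<beta>)} \<in> sets S"
proof -
  have "{0} \<times> {\<beta>} \<in> sets S"
    unfolding state_space_def by (rule pair_measureI) (use A in \<open>auto simp: sets_restrict_space_iff\<close>)
  then show ?thesis by simp
qed

text \<open>The flow fixes \<open>\<beta>\<close>, so without a jump the process stays at
  \<open>(0, \<beta>)\<close>, and jumps occur there at the constant rate
  \<open>\<beta>\<close>.\<close>

lemma T_reset_state:
  assumes r: "0 \<le> r" "r \<le> 1" shows "ennreal (exp (- \<beta>)) \<le> T r (indicator {(0, \<beta>)}) (0, \<beta>)"
proof -
  have o: "(0, \<beta>) \<in> space S" using A by (simp add: space_S)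
  have "ennreal (exp (- \<beta>)) \<le> ennreal (exp (- H \<beta> r))"
    using r beta by (intro ennreal_leI) (simp add: H_def mult_left_le)
  also have "\<dots> = (\<integral>\<^sup>+p. indicator {p \<in> space D. r < first_jump (0, \<beta>) p} p \<partial>D)"
  proof -
    have [measurable]: "(\<lambda>p. first_jump (0, \<beta>) p) \<in> borel_measurable D"
      by (rule measurable_first_jump'[OF o])
    have "{p \<in> space D. r < first_jump (0, \<beta>) p} \<in> sets D" by measurable
    then show ?thesis using emeasure_late(1)[OF o r(1)] by (subst nn_integral_indicator) auto
  qed
  also have "\<dots> \<le> T r (indicator {(0, \<beta>)}) (0, \<beta>)"
    unfolding renewal[OF borel_measurable_indicator[OF sets_reset_state] r(1) o]
    by (intro nn_integral_mono) (auto simp: flow_def split: split_indicator)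
  finally show ?thesis .
qed

text \<open>The three factors bound the probabilities of a jump before time 1 (the intensity is at
  least \<open>\<beta>\<close>), of a jump size above \<open>A - \<beta>\<close> (which forces a
  reset from every intensity), and of no further jump up to time 1.\<close>

lemma T_doeblin:
  assumes x: "x \<in> space S"
  shows "ennreal ((1 - exp (- \<beta>)) * exp (- \<theta> * (A - \<beta>)) * exp (- \<beta>)) \<le> T 1 (indicator {(0, \<beta>)}) x"
proof -
  have l: "\<beta> \<le> snd x" using space_S_D[OF x] by simp
  let ?h = "H (snd x) 1" and ?n = "Suc (fst x)"
  let ?Z = "{z \<in> space G. A - \<beta> < ell ?n z}"
  have n: "?n \<ge> 1" by simp
  have Z: "?Z \<in> sets G" using measurable_ell[OF n] by measurable
  have GZ: "emeasure G ?Z = ennreal (exp (- \<theta> * (A - \<beta>)))"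
    using Gp.exponential_distributedD_gt[OF ell_exp[OF n], of "A - \<beta>"] A theta
    by (simp add: Gp.emeasure_eq_measure algebra_simps)
  interpret E: prob_space E by (rule prob_E)
  have "emeasure E {..?h} = ennreal (1 - exp (- ?h))"
  proof -
    have h0: "0 \<le> ?h" using H_mono[OF l, of 0 1] by simp
    have "emeasure E {?h<..} = ennreal (exp (- ?h))"
      using nn_integral_E_shift[of "\<lambda>_. 1" ?h] h0 E.emeasure_space_1 by simp
    moreover have "emeasure E (space E - {?h<..}) = emeasure E (space E) - emeasure E {?h<..}"
      by (rule emeasure_compl) auto
    moreover have "space E - {?h<..} = {..?h}" by auto
    ultimately show ?thesis
      by (simp only: E.emeasure_space_1) (simp add: ennreal_minus ennreal_1[symmetric] del: ennreal_1)
  qed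
  then have E1: "ennreal (1 - exp (- \<beta>)) \<le> emeasure E {..?h}"
    using H_ge[OF l, of 1] by (simp add: ennreal_leI)
  have "ennreal ((1 - exp (- \<beta>)) * exp (- \<theta> * (A - \<beta>)) * exp (- \<beta>)) =
      ennreal (1 - exp (- \<beta>)) * ennreal (exp (- \<theta> * (A - \<beta>))) * ennreal (exp (- \<beta>))"
    using beta by (simp add: ennreal_mult)
  also have "\<dots> \<le> emeasure E {..?h} * emeasure G ?Z * ennreal (exp (- \<beta>))"
    unfolding GZ by (intro mult_mono E1) auto
  also have "\<dots> = (\<integral>\<^sup>+p. ennreal (exp (- \<beta>)) * indicator ({..?h} \<times> ?Z) p \<partial>D)"
    using Z by (subst nn_integral_cmult_indicator) (auto simp: Gp.emeasure_pair_measure_Times mult.commute)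
  also have "\<dots> \<le> (\<integral>\<^sup>+p. (if 1 < first_jump x p then indicator {(0, \<beta>)} (drift x 1)
      else T (1 - first_jump x p) (indicator {(0, \<beta>)}) (step x p)) \<partial>D)"
  proof (rule nn_integral_mono)
    fix p assume "p \<in> space D"
    show "ennreal (exp (- \<beta>)) * indicator ({..?h} \<times> ?Z) p \<le>
      (if 1 < first_jump x p then indicator {(0, \<beta>)} (drift x 1)
        else T (1 - first_jump x p) (indicator {(0, \<beta>)}) (step x p))"
    proof (cases "p \<in> {..?h} \<times> ?Z")
      case True
      then have w: "first_jump x p \<le> 1" using W_le_iff[OF l, of "fst p" 1] by auto
      have "step x p = (0, \<beta>)"
        using True fl_ge[OF l, of "first_jump x p"] by (auto simp: step_def jump_map_def Let_def)
      then show ?thesis using T_reset_state[of "1 - first_jump x p"] w W_nonneg[OF l, of "fst p"] True by simp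
    qed simp
  qed
  also have "\<dots> = T 1 (indicator {(0, \<beta>)}) x"
    by (rule renewal[symmetric]) (use x sets_reset_state in auto)
  finally show ?thesis .
qed

section \<open>Transition kernels and the unique invariant law\<close>

abbreviation trans where "trans \<equiv> transition \<alpha> \<beta> \<beta> A ell G"

lemma prob_trans:
  assumes "0 \<le> t" "x \<in> space S" shows "prob_space (trans t x)"
  unfolding transition_def using Om.prob_space_distr[OF measurable_proc_Om] assms by blast

lemma nn_integral_trans:
  assumes "0 \<le> t" "x \<in> space S" "f \<in> borel_measurable S"
  shows "(\<integral>\<^sup>+y. f y \<partial>trans t x) = T t f x"
  unfolding transition_def T_def using assms measurable_proc_Om[of x t] by (subst nn_integral_distr) auto

lemma emeasure_trans:
  assumes "0 \<le> t" "x \<in> space S" "B \<in> sets S"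
  shows "emeasure (trans t x) B = T t (indicator B) x"
  using nn_integral_trans[OF assms(1,2), of "indicator B"] assms(3) by (simp add: transition_def)

lemma measurable_trans:
  assumes "0 \<le> t" shows "trans t \<in> measurable S (subprob_algebra S)"
proof -
  have "(\<lambda>x. distr \<Omega> S (proc x t)) \<in> measurable S (subprob_algebra S)"
  proof (rule measurable_distr2)
    show "case_prod (\<lambda>x. proc x t) \<in> measurable (S \<Otimes>\<^sub>M \<Omega>) S"
      unfolding case_prod_beta' by (rule measurable_proc) (use assms in auto)
    show "(\<lambda>_. \<Omega>) \<in> measurable S (subprob_algebra \<Omega>)"
      by (rule measurable_const) (simp add: space_subprob_algebra prob_space_imp_subprob_space prob_Omega)
  qed
  then show ?thesis unfolding transition_def[abs_def] .
qed

text \<open>Chapman-Kolmogorov, from \<open>semigroup\<close> applied to indicators.\<close>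

lemma trans_bind:
  assumes t: "0 \<le> t" and s: "0 \<le> s" and x: "x \<in> space S"
  shows "trans t x \<bind> trans s = trans (t + s) x"
proof (rule measure_eqI)
  have ss: "sets (trans t x) = sets S" "space (trans t x) = space S" for t x by (auto simp: transition_def)
  have ne: "space (trans t x) \<noteq> {}" using x ss by auto
  have ms: "trans s \<in> measurable (trans t x) (subprob_algebra S)"
    by (rule measurable_transfer_sets[OF measurable_trans[OF s] ss(1)])
  have sb: "sets (trans t x \<bind> trans s) = sets S"
    by (rule sets_bind[OF _ ne]) (simp add: ss)
  then show "sets (trans t x \<bind> trans s) = sets (trans (t + s) x)" by (simp add: ss)
  fix B assume "B \<in> sets (trans t x \<bind> trans s)"
  then have B: "B \<in> sets S" using sb by simp
  have iB: "indicator B \<in> borel_measurable S" using B by simp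
  have Tm: "T s (indicator B) \<in> borel_measurable S"
    using measurable_T[OF iB measurable_ident, of "\<lambda>_. s"] s by simp
  have "emeasure (trans t x \<bind> trans s) B = (\<integral>\<^sup>+y. emeasure (trans s y) B \<partial>trans t x)"
    by (rule emeasure_bind[OF ne ms B])
  also have "\<dots> = (\<integral>\<^sup>+y. T s (indicator B) y \<partial>trans t x)"
    by (intro nn_integral_cong emeasure_trans s B) (simp add: ss)
  also have "\<dots> = T t (T s (indicator B)) x" by (rule nn_integral_trans[OF t x Tm])
  also have "\<dots> = T (t + s) (indicator B) x"
    by (rule semigroup[OF iB _ t s x, symmetric]) (simp split: split_indicator)
  also have "\<dots> = emeasure (trans (t + s) x) B"
    using emeasure_trans[of "t + s" x B] t s x B by simp
  finally show "emeasure (trans t x \<bind> trans s) B = emeasure (trans (t + s) x) B" .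
qed

lemma invariant_iff:
  "invariant_measure \<alpha> \<beta> \<beta> A ell G Q \<longleftrightarrow>
    prob_space Q \<and> sets Q = sets S \<and> (\<forall>t\<ge>0. Q \<bind> trans t = Q)"
proof -
  have "(\<forall>B\<in>sets S. (\<integral>\<^sup>+x. emeasure (trans t x) B \<partial>Q) = emeasure Q B) \<longleftrightarrow> Q \<bind> trans t = Q"
    if Q: "prob_space Q" "sets Q = sets S" and t: "0 \<le> t" for t
  proof -
    have ne: "space Q \<noteq> {}" using prob_space.not_empty[OF Q(1)] .
    have mt: "trans t \<in> measurable Q (subprob_algebra S)"
      by (rule measurable_transfer_sets[OF measurable_trans[OF t] Q(2)])
    have sb: "sets (Q \<bind> trans t) = sets S"
      by (rule sets_bind[OF _ ne]) (simp add: transition_def)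
    show ?thesis
    proof
      assume *: "\<forall>B\<in>sets S. (\<integral>\<^sup>+x. emeasure (trans t x) B \<partial>Q) = emeasure Q B"
      show "Q \<bind> trans t = Q"
        by (rule measure_eqI) (use sb Q * emeasure_bind[OF ne mt] in auto)
    next
      assume "Q \<bind> trans t = Q"
      then show "\<forall>B\<in>sets S. (\<integral>\<^sup>+x. emeasure (trans t x) B \<partial>Q) = emeasure Q B"
        using emeasure_bind[OF ne mt] by metis
    qed
  qed
  then show ?thesis unfolding invariant_measure_def by blast
qed

text \<open>The criterion gives a unique invariant law \<open>Q\<close> for time 1. As the kernels
  commute, \<open>Q \<bind> trans t\<close> is again invariant for time 1 and therefore equals
  \<open>Q\<close>, which extends invariance to all times.\<close>

theorem ex1_invariant_measure: "\<exists>!Q. invariant_measure \<alpha> \<beta> \<beta> A ell G Q"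
proof -
  have "\<exists>!Q. prob_space Q \<and> sets Q = sets S \<and> Q \<bind> trans 1 = Q"
  proof (rule doeblin_unique_invariant)
    show "trans 1 \<in> measurable S (subprob_algebra S)" by (rule measurable_trans) simp
    show "prob_space (trans 1 x)" if "x \<in> space S" for x by (rule prob_trans) (use that in auto)
    show "(0, \<beta>) \<in> space S" using A by (simp add: space_S)
    show "{(0, \<beta>)} \<in> sets S" by (rule sets_reset_state)
    show "0 < ennreal ((1 - exp (- \<beta>)) * exp (- \<theta> * (A - \<beta>)) * exp (- \<beta>))" using beta by simp
    show "ennreal ((1 - exp (- \<beta>)) * exp (- \<theta> * (A - \<beta>)) * exp (- \<beta>)) \<le> emeasure (trans 1 x) {(0, \<beta>)}"
      if "x \<in> space S" for x
      using emeasure_trans[OF _ that sets_reset_state, of 1] T_doeblin[OF that] by simp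
  qed
  then obtain Q where Q: "prob_space Q" "sets Q = sets S" "Q \<bind> trans 1 = Q"
    and uniq: "\<And>Q'. prob_space Q' \<Longrightarrow> sets Q' = sets S \<Longrightarrow> Q' \<bind> trans 1 = Q' \<Longrightarrow> Q' = Q"
    by (elim ex1E) blast
  have spQ: "space Q = space S" by (rule sets_eq_imp_space_eq[OF Q(2)])
  have ne: "space Q \<noteq> {}" using prob_space.not_empty[OF Q(1)] .
  have mt: "trans t \<in> measurable Q (subprob_algebra S)" if "0 \<le> t" for t
    by (rule measurable_transfer_sets[OF measurable_trans[OF that] Q(2)])
  have "Q \<bind> trans t = Q" if t: "0 \<le> t" for t
  proof (rule uniq)
    show sb: "sets (Q \<bind> trans t) = sets S"
      by (rule sets_bind[OF _ ne]) (simp add: transition_def)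
    show "prob_space (Q \<bind> trans t)"
      by (rule prob_space.prob_space_bind[OF Q(1) _ mt[OF t]]) (use prob_trans[OF t] spQ in auto)
    have "(Q \<bind> trans t) \<bind> trans 1 = Q \<bind> (\<lambda>x. trans t x \<bind> trans 1)"
      by (rule bind_assoc[OF mt[OF t] measurable_trans]) simp
    also have "\<dots> = Q \<bind> (\<lambda>x. trans 1 x \<bind> trans t)"
      by (rule bind_cong) (use t in \<open>auto simp: spQ trans_bind add.commute\<close>)
    also have "\<dots> = (Q \<bind> trans 1) \<bind> trans t"
      by (rule bind_assoc[OF mt measurable_trans[OF t], symmetric]) simp
    finally show "(Q \<bind> trans t) \<bind> trans 1 = Q \<bind> trans t" by (simp add: Q(3))
  qed
  then have inv: "invariant_measure \<alpha> \<beta> \<beta> A ell G Q"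
    unfolding invariant_iff using Q by blast
  show ?thesis
  proof (rule ex1I, rule inv)
    fix Q' assume "invariant_measure \<alpha> \<beta> \<beta> A ell G Q'"
    then have "prob_space Q'" "sets Q' = sets S" "Q' \<bind> trans 1 = Q'"
      unfolding invariant_iff by simp_all
    then show "Q' = Q" by (rule uniq)
  qed
qed

end

section \<open>The generator\<close>

context resetting
begin

text \<open>Up to an error of order \<open>t\<^sup>2\<close> at most one jump matters before time \<open>t\<close>, and the increments of \<open>g\<close> and
  \<open>\<Gamma>\<close> along the flow can be neglected once that jump has happened.\<close>

lemma invariant_generator:
  fixes g \<Gamma> d :: "real \<Rightarrow> real"
  assumes g [measurable]: "g \<in> borel_measurable borel" and \<Gamma> [measurable]: "\<Gamma> \<in> borel_measurable borel"
    and d [measurable]: "d \<in> borel_measurable borel"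
    and g0: "\<And>l. \<beta> \<le> l \<Longrightarrow> l < A \<Longrightarrow> 0 \<le> g l \<and> g l \<le> B"
    and \<Gamma>0: "\<And>l. \<beta> \<le> l \<Longrightarrow> l < A \<Longrightarrow> 0 \<le> \<Gamma> l \<and> \<Gamma> l \<le> B"
    and gL: "\<And>l t. \<beta> \<le> l \<Longrightarrow> l < A \<Longrightarrow> 0 \<le> t \<Longrightarrow> \<bar>g (fl l t) - g l\<bar> \<le> C * t"
    and \<Gamma>L: "\<And>l t. \<beta> \<le> l \<Longrightarrow> l < A \<Longrightarrow> 0 \<le> t \<Longrightarrow> \<bar>\<Gamma> (fl l t) - \<Gamma> l\<bar> \<le> C * t"
    and jump: "\<And>x. x \<in> space S \<Longrightarrow> (\<integral>z. g (snd (J x z)) \<partial>G) = \<Gamma> (snd x)"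
    and deriv: "\<And>l. \<beta> \<le> l \<Longrightarrow> l < A \<Longrightarrow> ((\<lambda>t. g (fl l t)) has_real_derivative d l) (at 0 within {0..})"
    and Q: "invariant_measure \<alpha> \<beta> \<beta> A ell G Q"
  shows "(\<integral>x. d (snd x) + snd x * (\<Gamma> (snd x) - g (snd x)) \<partial>Q) = 0"
proof -
  have B0: "0 \<le> B" using g0[of \<beta>] A by auto
  have C0: "0 \<le> C" using gL[of \<beta> 1] A by auto
  have A0: "0 < A" using A beta by simp
  \<comment> \<open>The semigroup acts on \<open>ennreal\<close>-valued functions, whence the
    assumption that \<open>g\<close> is non-negative and bounded; \<open>\<tau>\<close> is the
    real-valued form of \<open>T t f\<close>.\<close>
  define f where "f x = ennreal (g (snd x))" for x :: "nat \<times> real"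
  define \<tau> where "\<tau> t x = enn2real (T t f x)" for t x
  have fm [measurable]: "f \<in> borel_measurable S" unfolding f_def by measurable
  have Tf: "T t f x \<le> ennreal B" if "0 \<le> t" "x \<in> space S" for t x
  proof -
    have "T t f x \<le> (\<integral>\<^sup>+\<omega>. ennreal B \<partial>\<Omega>)"
      unfolding T_def f_def using measurable_space[OF measurable_proc_Om[OF that(2,1)]] g0 space_S_D
      by (intro nn_integral_mono ennreal_leI) blast
    then show ?thesis by (simp add: Om.emeasure_space_1)
  qed
  have T\<tau>: "T t f x = ennreal (\<tau> t x)" and \<tau>0: "0 \<le> \<tau> t x" and \<tau>B: "\<tau> t x \<le> B" if "0 \<le> t" "x \<in> space S" for t x
  proof -
    have "T t f x < \<top>" using Tf[OF that] le_less_trans[OF _ ennreal_less_top] by blast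
    then show 1: "T t f x = ennreal (\<tau> t x)" by (simp add: \<tau>_def)
    show 2: "0 \<le> \<tau> t x" by (simp add: \<tau>_def)
    show "\<tau> t x \<le> B" using Tf[OF that] 1 B0 by (simp add: ennreal_le_iff)
  qed
  have \<tau>m: "(\<lambda>p. if t < first_jump x p then c else \<tau> (t - first_jump x p) (step x p)) \<in> borel_measurable D"
    if "x \<in> space S" for t x c
  proof -
    have "(\<lambda>p. enn2real (if t < first_jump x p then ennreal 0 else T (t - first_jump x p) f (step x p))) \<in> borel_measurable D"
      using measurable_T_after_jump[OF fm that, of 0 t "ennreal 0", unfolded add_0_right] by measurable
    moreover have "(\<lambda>p. first_jump x p) \<in> borel_measurable D" using that by simp
    ultimately have "(\<lambda>p. if t < first_jump x p then c else
      enn2real (if t < first_jump x p then ennreal 0 else T (t - first_jump x p) f (step x p))) \<in> borel_measurable D"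
      by measurable
    also have "(\<lambda>p. if t < first_jump x p then c else
      enn2real (if t < first_jump x p then ennreal 0 else T (t - first_jump x p) f (step x p))) =
      (\<lambda>p. if t < first_jump x p then c else \<tau> (t - first_jump x p) (step x p))"
      by (auto simp: \<tau>_def fun_eq_iff)
    finally show ?thesis .
  qed
  have stepS: "step x p \<in> space S" if "x \<in> space S" "p \<in> space D" for x p
    using measurable_space[OF measurable_step'[OF that(1)] that(2)] .
  have W0: "0 \<le> first_jump x p" if "x \<in> space S" for x p
    using W_nonneg space_S_D[OF that] by simp
  have ren: "\<tau> t x = (\<integral>p. (if t < first_jump x p then g (fl (snd x) t) else \<tau> (t - first_jump x p) (step x p)) \<partial>D)"
    if "0 \<le> t" and x: "x \<in> space S" for t x
  proof -
    let ?u = "\<lambda>p. if t < first_jump x p then g (fl (snd x) t) else \<tau> (t - first_jump x p) (step x p)"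
    have u0: "0 \<le> ?u p" if "p \<in> space D" for p
      using g0[of "fl (snd x) t"] space_S_D[OF drift_in_S[OF x \<open>0 \<le> t\<close>]] \<tau>0[of "t - first_jump x p" "step x p"]
        stepS[OF x that] by auto
    have "T t f x = (\<integral>\<^sup>+p. ennreal (?u p) \<partial>D)"
      unfolding renewal[OF fm that]
    proof (rule nn_integral_cong)
      fix p assume p: "p \<in> space D"
      show "(if t < first_jump x p then f (drift x t) else T (t - first_jump x p) f (step x p)) = ennreal (?u p)"
        using T\<tau>[of "t - first_jump x p" "step x p"] stepS[OF x p] by (auto simp: f_def)
    qed
    then show ?thesis
      unfolding \<tau>_def[of t x] using \<tau>m[OF x] u0 by (subst integral_eq_nn_integral) auto
  qed
  let ?I = "\<lambda>t x p. indicator {p \<in> space D. first_jump x p \<le> t} p :: real"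
  have Im: "{p \<in> space D. first_jump x p \<le> t} \<in> sets D" if "x \<in> space S" for t x
    using measurable_first_jump'[OF that] by measurable
  have PI: "(\<integral>p. ?I t x p \<partial>D) = 1 - exp (- H (snd x) t)" if "0 \<le> t" "x \<in> space S" for t x
  proof -
    have "0 \<le> H (snd x) t" using H_mono[of "snd x" 0 t] space_S_D[OF that(2)] that by simp
    then show ?thesis using emeasure_late(2)[OF that(2,1)] Im[OF that(2)] by (simp add: measure_def)
  qed
  have PI': "D.prob ({p \<in> space D. first_jump x p \<le> t} \<inter> space D) = 1 - exp (- H (snd x) t)"
    if "0 \<le> t" "x \<in> space S" for t x
    using PI[OF that] by simp
  have iI: "integrable D (?I t x)" if "x \<in> space S" for t x
    by (rule D.integrable_const_bound[of _ 1]) (use Im[OF that] in \<open>auto intro!: AE_I2 split: split_indicator\<close>)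
  have HA: "H (snd x) t \<le> A * t" "0 \<le> H (snd x) t" if "0 \<le> t" "x \<in> space S" for t x
  proof -
    have "H (snd x) t \<le> snd x * t" using H_le space_S_D[OF that(2)] that by simp
    also have "\<dots> \<le> A * t" using space_S_D[OF that(2)] that by (intro mult_right_mono) auto
    finally show "H (snd x) t \<le> A * t" .
    show "0 \<le> H (snd x) t" using H_mono[of "snd x" 0 t] space_S_D[OF that(2)] that by simp
  qed
  have exA: "1 - exp (- H (snd x) t) \<le> A * t" if "0 \<le> t" "x \<in> space S" for t x
    using HA[OF that] exp_ge_add_one_self[of "- H (snd x) t"] by linarith
  \<comment> \<open>Without a jump the error is a flow increment of at most \<open>C * r\<close>; a
    jump has probability at most \<open>A * r\<close>, and then the error is at most
    \<open>B\<close>.\<close>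
  define C1 where "C1 = C + B * A"
  have C1: "0 \<le> C1" unfolding C1_def using B0 C0 A0 by simp
  have small: "\<bar>\<tau> r y - g (snd y)\<bar> \<le> C1 * r" if r: "0 \<le> r" and y: "y \<in> space S" for r y
  proof -
    let ?u = "\<lambda>p. if r < first_jump y p then g (fl (snd y) r) else \<tau> (r - first_jump y p) (step y p)"
    have bnd: "\<bar>?u p - g (snd y)\<bar> \<le> C * r + B * ?I r y p" if "p \<in> space D" for p
      using that gL[of "snd y" r] space_S_D[OF y] r \<tau>0[of "r - first_jump y p" "step y p"] \<tau>B[of "r - first_jump y p" "step y p"]
        stepS[OF y that] g0[of "snd y"] C0 by (auto simp: not_less intro!: abs_leI add_increasing split: split_indicator)
    have um: "?u \<in> borel_measurable D" by (rule \<tau>m[OF y])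
    have ui: "integrable D ?u"
    proof (rule D.integrable_const_bound[of _ B])
      show "AE p in D. norm (?u p) \<le> B"
        using g0[of "fl (snd y) r"] space_S_D[OF drift_in_S[OF y r]] \<tau>0 \<tau>B stepS[OF y] by (intro AE_I2) auto
    qed (rule um)
    have ib: "integrable D (\<lambda>p. C * r + B * ?I r y p)"
      by (intro Bochner_Integration.integrable_add integrable_mult_right D.integrable_const iI y)
    have "\<bar>\<tau> r y - g (snd y)\<bar> = \<bar>\<integral>p. ?u p - g (snd y) \<partial>D\<bar>"
      unfolding ren[OF r y] using ui by (simp add: D.prob_space)
    also have "\<dots> \<le> (\<integral>p. C * r + B * ?I r y p \<partial>D)"
      by (rule order_trans[OF integral_abs_bound]) (intro integral_mono integrable_abs Bochner_Integration.integrable_diff ui D.integrable_const ib bnd)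
    also have "\<dots> = C * r + B * (1 - exp (- H (snd y) r))"
      using iI[OF y, of r] PI'[OF r y] by (subst Bochner_Integration.integral_add) (auto simp: D.prob_space)
    also have "\<dots> \<le> C * r + B * (A * r)" using exA[OF r y] B0 by (intro add_left_mono mult_left_mono) auto
    finally show ?thesis by (simp add: C1_def algebra_simps)
  qed
  \<comment> \<open>First-order expansion of \<open>\<tau> t x - g (snd x)\<close>: either no jump
    and pure flow, or one jump whose position and aftermath are ignored.\<close>
  define \<psi> where "\<psi> t l = exp (- H l t) * g (fl l t) + (1 - exp (- H l t)) * \<Gamma> l - g l" for t l
  define C2 where "C2 = (C1 + C) * A"
  have expand: "\<bar>\<tau> t x - g (snd x) - \<psi> t (snd x)\<bar> \<le> C2 * t\<^sup>2" if t: "0 \<le> t" and x: "x \<in> space S" for t x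
  proof -
    let ?l = "snd x"
    have l: "\<beta> \<le> ?l" "?l < A" using space_S_D[OF x] by auto
    have stepm: "(\<lambda>p. g (snd (step x p))) \<in> borel_measurable D"
      using measurable_compose[OF measurable_step'[OF x] measurable_S_snd] by measurable
    have fjm [measurable]: "(\<lambda>p. first_jump x p) \<in> borel_measurable D" using x by simp
    have flm: "(\<lambda>p. \<Gamma> (fl ?l (first_jump x p))) \<in> borel_measurable D" unfolding flow_def by measurable
    have flA: "\<beta> \<le> fl ?l (first_jump x p)" "fl ?l (first_jump x p) < A" for p
      using fl_ge[OF l(1)] le_less_trans[OF fl_le[OF l(1) W0[OF x]] l(2)] by auto
    have gstep: "0 \<le> g (snd (step x p)) \<and> g (snd (step x p)) \<le> B" if "p \<in> space D" for p
      using g0 space_S_D[OF stepS[OF x that]] by blast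
    have i1: "integrable D (\<lambda>p. ?I t x p * g (snd (step x p)))"
      by (rule D.integrable_const_bound[of _ B]) (use Im[OF x] stepm gstep B0 in \<open>auto intro!: AE_I2 split: split_indicator\<close>)
    have i2: "integrable D (\<lambda>p. ?I t x p * \<Gamma> (fl ?l (first_jump x p)))"
      by (rule D.integrable_const_bound[of _ B]) (use Im[OF x] flm \<Gamma>0[OF flA] B0 in \<open>auto intro!: AE_I2 split: split_indicator\<close>)
    \<comment> \<open>The mark is independent of the clock, so integrating over it first replaces
      \<open>g\<close> after the jump by its mean \<open>\<Gamma>\<close> at the intensity just
      before the jump.\<close>
    have fub: "(\<integral>p. ?I t x p * g (snd (step x p)) \<partial>D) = (\<integral>p. ?I t x p * \<Gamma> (fl ?l (first_jump x p)) \<partial>D)"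
    proof -
      interpret E: prob_space E by (rule prob_E)
      interpret EG: pair_sigma_finite E G ..
      have I: "?I t x (e, z) = indicator {e. W ?l e \<le> t} e" if "z \<in> space G" for e z
        using that by (auto simp: space_D space_G split: split_indicator)
      have dr: "(fst x, fl ?l (W ?l e)) \<in> space S" for e using flA[of "(e, 0)"] by (simp add: space_S)
      have "(\<integral>p. ?I t x p * g (snd (step x p)) \<partial>D) = (\<integral>e. \<integral>z. ?I t x (e, z) * g (snd (step x (e, z))) \<partial>G \<partial>E)"
        by (rule EG.integral_fst'[OF i1, symmetric])
      also have "\<dots> = (\<integral>e. \<integral>z. ?I t x (e, z) * \<Gamma> (fl ?l (first_jump x (e, z))) \<partial>G \<partial>E)"
      proof (rule Bochner_Integration.integral_cong[OF refl])
        fix e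
        have "(\<integral>z. ?I t x (e, z) * g (snd (step x (e, z))) \<partial>G) = (\<integral>z. indicator {e. W ?l e \<le> t} e * g (snd (step x (e, z))) \<partial>G)"
          by (rule Bochner_Integration.integral_cong[OF refl]) (simp only: I)
        also have "\<dots> = indicator {e. W ?l e \<le> t} e * \<Gamma> (fl ?l (W ?l e))"
          using jump[OF dr, of e] by (simp add: step_def)
        also have "\<dots> = (\<integral>z. indicator {e. W ?l e \<le> t} e * \<Gamma> (fl ?l (first_jump x (e, z))) \<partial>G)"
          by (simp add: Gp.prob_space)
        also have "\<dots> = (\<integral>z. ?I t x (e, z) * \<Gamma> (fl ?l (first_jump x (e, z))) \<partial>G)"
          by (rule Bochner_Integration.integral_cong[OF refl]) (simp only: I)
        finally show "(\<integral>z. ?I t x (e, z) * g (snd (step x (e, z))) \<partial>G) = (\<integral>z. ?I t x (e, z) * \<Gamma> (fl ?l (first_jump x (e, z))) \<partial>G)" .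
      qed
      also have "\<dots> = (\<integral>p. ?I t x p * \<Gamma> (fl ?l (first_jump x p)) \<partial>D)"
        by (rule EG.integral_fst'[OF i2])
      finally show ?thesis .
    qed
    let ?u = "\<lambda>p. if t < first_jump x p then g (fl ?l t) else \<tau> (t - first_jump x p) (step x p)"
    have um: "?u \<in> borel_measurable D" by (rule \<tau>m[OF x])
    have ui: "integrable D ?u"
    proof (rule D.integrable_const_bound[of _ B])
      show "AE p in D. norm (?u p) \<le> B"
        using g0[of "fl ?l t"] space_S_D[OF drift_in_S[OF x t]] \<tau>0 \<tau>B stepS[OF x] by (intro AE_I2) auto
    qed (rule um)
    let ?k = "\<lambda>p. (1 - ?I t x p) * g (fl ?l t) + ?I t x p * \<Gamma> ?l"
    have ki: "integrable D ?k"
      by (intro Bochner_Integration.integrable_add integrable_mult_left Bochner_Integration.integrable_diff D.integrable_const iI[OF x])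
    have kI: "(\<integral>p. ?k p \<partial>D) = \<psi> t ?l + g ?l"
      using iI[OF x, of t] by (simp add: PI'[OF t x] D.prob_space \<psi>_def)
    have "\<tau> t x - g ?l - \<psi> t ?l = (\<integral>p. ?u p - ?k p \<partial>D)"
      using ui ki by (simp add: ren[OF t x] kI)
    \<comment> \<open>By \<open>fub\<close> the added terms have integral zero. They make the
      integrand vanish without a jump and, after a jump, leave only the change of
      \<open>\<tau>\<close> in the remaining time and the change of \<open>\<Gamma>\<close> along
      the flow, both of order \<open>t\<close>. The jump probability supplies the second factor
      \<open>t\<close> in \<open>C2 * t\<^sup>2\<close>.\<close>
    also have "\<dots> = (\<integral>p. (?u p - ?k p) - ?I t x p * g (snd (step x p)) + ?I t x p * \<Gamma> (fl ?l (first_jump x p)) \<partial>D)"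
      using ui ki i1 i2 fub by simp
    finally have eq: "\<tau> t x - g ?l - \<psi> t ?l =
       (\<integral>p. (?u p - ?k p) - ?I t x p * g (snd (step x p)) + ?I t x p * \<Gamma> (fl ?l (first_jump x p)) \<partial>D)" .
    have bnd: "\<bar>(?u p - ?k p) - ?I t x p * g (snd (step x p)) + ?I t x p * \<Gamma> (fl ?l (first_jump x p))\<bar>
        \<le> (C1 + C) * t * ?I t x p" if p: "p \<in> space D" for p
    proof (cases "t < first_jump x p")
      case False
      have "\<bar>\<tau> (t - first_jump x p) (step x p) - g (snd (step x p))\<bar> \<le> C1 * (t - first_jump x p)"
        using small[OF _ stepS[OF x p], of "t - first_jump x p"] False by simp
      also have "\<dots> \<le> C1 * t" using W0[OF x, of p] C1 by (intro mult_left_mono) auto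
      finally have 1: "\<bar>\<tau> (t - first_jump x p) (step x p) - g (snd (step x p))\<bar> \<le> C1 * t" .
      have "\<bar>\<Gamma> (fl ?l (first_jump x p)) - \<Gamma> ?l\<bar> \<le> C * first_jump x p"
        by (rule \<Gamma>L[OF l W0[OF x]])
      also have "\<dots> \<le> C * t" using False C0 by (intro mult_left_mono) auto
      finally have 2: "\<bar>\<Gamma> (fl ?l (first_jump x p)) - \<Gamma> ?l\<bar> \<le> C * t" .
      show ?thesis using 1 2 False p by (simp add: algebra_simps)
    qed (use p in simp)
    have "\<bar>\<tau> t x - g ?l - \<psi> t ?l\<bar> \<le> (\<integral>p. (C1 + C) * t * ?I t x p \<partial>D)"
      unfolding eq by (rule order_trans[OF integral_abs_bound])
        (intro integral_mono integrable_abs Bochner_Integration.integrable_add Bochner_Integration.integrable_diff ui ki i1 i2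
          integrable_mult_right iI[OF x] bnd)
    also have "\<dots> = (C1 + C) * t * (1 - exp (- H ?l t))" by (simp add: PI'[OF t x])
    also have "\<dots> \<le> (C1 + C) * t * (A * t)" using exA[OF t x] C1 C0 t by (intro mult_left_mono) auto
    finally show ?thesis by (simp add: C2_def power2_eq_square algebra_simps)
  qed
  have Qp: "prob_space Q" and Qs: "sets Q = sets S" and Qi: "\<And>t. 0 \<le> t \<Longrightarrow> Q \<bind> trans t = Q"
    using Q unfolding invariant_iff by auto
  interpret Q: prob_space Q by (rule Qp)
  have spQ: "space Q = space S" by (rule sets_eq_imp_space_eq[OF Qs])
  have sndQ [measurable]: "snd \<in> borel_measurable Q" by (rule measurable_transfer_sets[OF measurable_S_snd Qs])
  have \<tau>Q: "\<tau> t \<in> borel_measurable Q" if "0 \<le> t" for t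
  proof -
    have "(\<lambda>x. T t f x) \<in> borel_measurable S" using that by (intro measurable_T) auto
    then show ?thesis unfolding \<tau>_def[abs_def] by (intro measurable_transfer_sets[OF _ Qs]) measurable
  qed
  have inv: "(\<integral>x. \<tau> t x \<partial>Q) = (\<integral>x. g (snd x) \<partial>Q)" if t: "0 \<le> t" for t
  proof -
    have mt: "trans t \<in> measurable Q (subprob_algebra S)"
      by (rule measurable_transfer_sets[OF measurable_trans[OF t] Qs])
    have "(\<integral>\<^sup>+x. f x \<partial>Q) = (\<integral>\<^sup>+x. f x \<partial>(Q \<bind> trans t))" using Qi[OF t] by simp
    also have "\<dots> = (\<integral>\<^sup>+x. \<integral>\<^sup>+y. f y \<partial>trans t x \<partial>Q)" by (rule nn_integral_bind[OF fm mt])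
    also have "\<dots> = (\<integral>\<^sup>+x. ennreal (\<tau> t x) \<partial>Q)"
      by (intro nn_integral_cong) (use t in \<open>simp add: spQ nn_integral_trans T\<tau>\<close>)
    finally have e: "(\<integral>\<^sup>+x. ennreal (g (snd x)) \<partial>Q) = (\<integral>\<^sup>+x. ennreal (\<tau> t x) \<partial>Q)" by (simp add: f_def)
    have "(\<integral>x. \<tau> t x \<partial>Q) = enn2real (\<integral>\<^sup>+x. ennreal (\<tau> t x) \<partial>Q)"
      by (rule integral_eq_nn_integral) (use \<tau>Q[OF t] \<tau>0[OF t] in \<open>auto intro!: AE_I2 simp: spQ\<close>)
    also have "\<dots> = (\<integral>x. g (snd x) \<partial>Q)"
      unfolding e[symmetric] by (rule integral_eq_nn_integral[symmetric]) (use g0 space_S_D in \<open>auto intro!: AE_I2 simp: spQ\<close>)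
    finally show ?thesis .
  qed
  have gi: "integrable Q (\<lambda>x. g (snd x))"
    by (rule Q.integrable_const_bound[of _ B]) (use g0 space_S_D in \<open>auto intro!: AE_I2 simp: spQ\<close>)
  have \<tau>i: "integrable Q (\<tau> t)" if "0 \<le> t" for t
    by (rule Q.integrable_const_bound[of _ B]) (use \<tau>Q[OF that] \<tau>0[OF that] \<tau>B[OF that] in \<open>auto intro!: AE_I2 simp: spQ\<close>)
  have Hm [measurable]: "(\<lambda>l. H l t) \<in> borel_measurable borel" for t unfolding H_def by measurable
  have \<psi>m: "(\<lambda>x. \<psi> t (snd x)) \<in> borel_measurable Q" for t unfolding \<psi>_def flow_def by measurable
  \<comment> \<open>A flow increment of at most \<open>C * t\<close>, plus a jump probability of at
    most \<open>A * t\<close> times a difference of at most \<open>2 * B\<close>. This constant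
    dominates the difference quotients of \<open>\<psi>\<close>.\<close>
  define C3 where "C3 = C + 2 * B * A"
  have \<psi>b: "\<bar>\<psi> t (snd x)\<bar> \<le> C3 * t" if t: "0 \<le> t" and x: "x \<in> space S" for t x
  proof -
    let ?l = "snd x" and ?e = "1 - exp (- H (snd x) t)"
    have l: "\<beta> \<le> ?l" "?l < A" using space_S_D[OF x] by auto
    have fl: "0 \<le> g (fl ?l t)" "g (fl ?l t) \<le> B" using g0 space_S_D[OF drift_in_S[OF x t]] by auto
    have e: "0 \<le> ?e" "?e \<le> A * t" using exA[OF t x] HA[OF t x] by auto
    have "\<psi> t ?l = (g (fl ?l t) - g ?l) + ?e * (\<Gamma> ?l - g (fl ?l t))" by (simp add: \<psi>_def algebra_simps)
    moreover have "\<bar>?e * (\<Gamma> ?l - g (fl ?l t))\<bar> \<le> (A * t) * (2 * B)"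
      unfolding abs_mult using e \<Gamma>0[OF l] fl mult_nonneg_nonneg[of A t] A0 t by (intro mult_mono) auto
    ultimately show ?thesis using gL[OF l t] by (simp add: C3_def algebra_simps)
  qed
  have \<psi>i: "integrable Q (\<lambda>x. \<psi> t (snd x))" if "0 \<le> t" for t
    by (rule Q.integrable_const_bound[of _ "C3 * t"]) (use \<psi>m \<psi>b[OF that] in \<open>auto intro!: AE_I2 simp: spQ\<close>)
  have small\<psi>: "\<bar>\<integral>x. \<psi> t (snd x) \<partial>Q\<bar> \<le> C2 * t\<^sup>2" if t: "0 \<le> t" for t
  proof -
    have "(\<integral>x. \<psi> t (snd x) \<partial>Q) = - (\<integral>x. \<tau> t x - g (snd x) - \<psi> t (snd x) \<partial>Q)"
      using gi \<tau>i[OF t] \<psi>i[OF t] inv[OF t] by simp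
    then have "\<bar>\<integral>x. \<psi> t (snd x) \<partial>Q\<bar> = \<bar>\<integral>x. \<tau> t x - g (snd x) - \<psi> t (snd x) \<partial>Q\<bar>" by simp
    also have "\<dots> \<le> (\<integral>x. C2 * t\<^sup>2 \<partial>Q)"
      by (rule order_trans[OF integral_abs_bound])
        (intro integral_mono integrable_abs Bochner_Integration.integrable_diff gi \<tau>i[OF t] \<psi>i[OF t] Q.integrable_const expand t, simp add: spQ)
    finally show ?thesis by (simp add: Q.prob_space)
  qed
  let ?t = "\<lambda>n. inverse (real (Suc n))"
  have tl: "filterlim ?t (at 0 within {0..}) sequentially"
    unfolding filterlim_at using LIMSEQ_inverse_real_of_nat by (auto intro!: always_eventually)
  \<comment> \<open>The derivative of \<open>\<psi>\<close> at time 0 is the generator applied to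
    \<open>g\<close>; of \<open>g\<close> itself only the right derivative along the flow is
    used.\<close>
  have lim: "(\<lambda>n. \<psi> (?t n) l / ?t n) \<longlonglongrightarrow> d l + l * (\<Gamma> l - g l)" if l: "\<beta> \<le> l" "l < A" for l
  proof -
    have HD: "(H l has_real_derivative l) (at 0 within {0..})"
      unfolding H_def using alpha by (auto intro!: derivative_eq_intros)
    have "((\<lambda>t. \<psi> t l) has_real_derivative d l + l * (\<Gamma> l - g l)) (at 0 within {0..})"
      unfolding \<psi>_def using HD deriv[OF l]
      by (auto intro!: derivative_eq_intros simp: flow_0 algebra_simps)
    then have "((\<lambda>t. (\<psi> t l - \<psi> 0 l) / (t - 0)) \<longlongrightarrow> d l + l * (\<Gamma> l - g l)) (at 0 within {0..})"
      by (simp add: has_field_derivative_iff)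
    from filterlim_compose[OF this tl] show ?thesis by (simp add: \<psi>_def flow_0)
  qed
  have "(\<lambda>n. \<integral>x. \<psi> (?t n) (snd x) / ?t n \<partial>Q) \<longlonglongrightarrow> (\<integral>x. d (snd x) + snd x * (\<Gamma> (snd x) - g (snd x)) \<partial>Q)"
  proof (rule integral_dominated_convergence[where w="\<lambda>_. C3"])
    show "(\<lambda>x. d (snd x) + snd x * (\<Gamma> (snd x) - g (snd x))) \<in> borel_measurable Q" by measurable
    show "(\<lambda>x. \<psi> (?t n) (snd x) / ?t n) \<in> borel_measurable Q" for n
      using \<psi>m[of "?t n"] by (intro borel_measurable_divide borel_measurable_const)
    show "integrable Q (\<lambda>_. C3)" by simp
    show "AE x in Q. (\<lambda>n. \<psi> (?t n) (snd x) / ?t n) \<longlonglongrightarrow> d (snd x) + snd x * (\<Gamma> (snd x) - g (snd x))"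
      using lim space_S_D by (intro AE_I2) (simp add: spQ)
    fix n
    have "\<bar>\<psi> (?t n) (snd x) / ?t n\<bar> \<le> C3" if "x \<in> space S" for x
      using \<psi>b[OF _ that, of "?t n"] unfolding abs_divide by (subst pos_divide_le_eq) auto
    then show "AE x in Q. norm (\<psi> (?t n) (snd x) / ?t n) \<le> C3" by (intro AE_I2) (simp add: spQ)
  qed
  moreover have "(\<lambda>n. \<integral>x. \<psi> (?t n) (snd x) / ?t n \<partial>Q) \<longlonglongrightarrow> 0"
  proof (rule Lim_null_comparison)
    have "\<bar>\<integral>x. \<psi> (?t n) (snd x) / ?t n \<partial>Q\<bar> \<le> C2 * ?t n" for n
    proof -
      have "\<bar>\<integral>x. \<psi> (?t n) (snd x) / ?t n \<partial>Q\<bar> = \<bar>\<integral>x. \<psi> (?t n) (snd x) \<partial>Q\<bar> / ?t n" by (simp add: abs_mult)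
      also have "\<dots> \<le> C2 * (?t n)\<^sup>2 / ?t n" by (intro divide_right_mono small\<psi>) auto
      also have "\<dots> = C2 * ?t n" by (simp add: power2_eq_square)
      finally show ?thesis .
    qed
    then show "\<forall>\<^sub>F n in sequentially. norm (\<integral>x. \<psi> (?t n) (snd x) / ?t n \<partial>Q) \<le> C2 * ?t n" by simp
    show "(\<lambda>n. C2 * ?t n) \<longlonglongrightarrow> 0" using tendsto_mult_right_zero[OF LIMSEQ_inverse_real_of_nat] by simp
  qed
  ultimately show ?thesis by (rule LIMSEQ_unique)
qed

end

section \<open>Kummer's series\<close>

text \<open>\<open>kser b x\<close> is Kummer's function with parameters \<open>1\<close> and \<open>b + 1\<close> divided by \<open>b\<close>, and \<open>kint b\<close> is its
  antiderivative (the term \<open>k = 0\<close> of \<open>kint\<close> vanishes because \<open>1 / 0 = 0\<close>).\<close>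

definition kser :: "real \<Rightarrow> real \<Rightarrow> real" where
  "kser b x = (\<Sum>k. 1 / pochhammer b (Suc k) * x ^ k)"

definition kser' :: "real \<Rightarrow> real \<Rightarrow> real" where
  "kser' b x = (\<Sum>k. diffs (\<lambda>k. 1 / pochhammer b (Suc k)) k * x ^ k)"

definition kint :: "real \<Rightarrow> real \<Rightarrow> real" where
  "kint b x = (\<Sum>k. 1 / (real k * pochhammer b k) * x ^ k)"

text \<open>Compares the coefficients with those of the exponential series, so that
  \<open>kser\<close> converges everywhere.\<close>

lemma pochhammer_Suc_ge:
  fixes b :: real
  assumes "0 < b" shows "b * fact k \<le> pochhammer b (Suc k)"
proof (induction k)
  case (Suc k)
  have "b * fact (Suc k) = (b * fact k) * real (Suc k)" by simp
  also have "\<dots> \<le> pochhammer b (Suc k) * (b + real (Suc k))"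
    using Suc assms by (intro mult_mono) (auto intro!: pochhammer_nonneg)
  finally show ?case by (simp only: pochhammer_Suc[of b "Suc k"])
qed simp

lemma summable_kser:
  assumes b: "0 < b" shows "summable (\<lambda>k. 1 / pochhammer b (Suc k) * x ^ k :: real)"
proof (rule summable_comparison_test')
  show "summable (\<lambda>k. 1 / b * (inverse (fact k) * \<bar>x\<bar> ^ k))"
    by (intro summable_mult summable_exp)
  fix k :: nat
  have "1 / pochhammer b (Suc k) \<le> 1 / (b * fact k)"
    using pochhammer_Suc_ge[OF b, of k] b by (intro divide_left_mono) (auto intro!: mult_pos_pos pochhammer_pos)
  then have "1 / pochhammer b (Suc k) * \<bar>x\<bar> ^ k \<le> 1 / (b * fact k) * \<bar>x\<bar> ^ k"
    by (rule mult_right_mono) simp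
  then show "norm (1 / pochhammer b (Suc k) * x ^ k) \<le> 1 / b * (inverse (fact k) * \<bar>x\<bar> ^ k)"
    using pochhammer_pos[OF b, of "Suc k"] by (simp add: abs_mult power_abs field_simps)
qed

lemma summable_kint:
  assumes b: "0 < b" shows "summable (\<lambda>k. 1 / (real k * pochhammer b k) * x ^ k)"
proof (subst summable_Suc_iff[symmetric], rule summable_comparison_test')
  show "summable (\<lambda>k. \<bar>x\<bar> * (1 / pochhammer b (Suc k) * \<bar>x\<bar> ^ k))"
    by (rule summable_mult[OF summable_kser[OF b]])
  fix k :: nat
  have p: "0 < pochhammer b (Suc k)" by (rule pochhammer_pos[OF b])
  have "1 / (real (Suc k) * pochhammer b (Suc k)) \<le> 1 / pochhammer b (Suc k)"
    using p by (intro divide_left_mono) auto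
  then have "1 / (real (Suc k) * pochhammer b (Suc k)) * \<bar>x\<bar> ^ Suc k \<le> 1 / pochhammer b (Suc k) * \<bar>x\<bar> ^ Suc k"
    by (rule mult_right_mono) simp
  then show "norm (1 / (real (Suc k) * pochhammer b (Suc k)) * x ^ Suc k) \<le> \<bar>x\<bar> * (1 / pochhammer b (Suc k) * \<bar>x\<bar> ^ k)"
    using p by (simp add: abs_mult power_abs mult_ac del: pochhammer_Suc)
qed

lemma DERIV_kser: "0 < b \<Longrightarrow> (kser b has_real_derivative kser' b x) (at x)"
  unfolding kser_def[abs_def] kser'_def
  by (rule termdiffs_strong_converges_everywhere) (rule summable_kser)

lemma isCont_kser': assumes b: "0 < b" shows "isCont (kser' b) x"
proof -
  have "((\<lambda>x. \<Sum>k. diffs (\<lambda>k. 1 / pochhammer b (Suc k)) k * x ^ k) has_real_derivative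
      (\<Sum>k. diffs (diffs (\<lambda>k. 1 / pochhammer b (Suc k))) k * x ^ k)) (at x)"
    by (rule termdiffs_strong_converges_everywhere, rule termdiff_converges_all) (rule summable_kser[OF b])
  then show ?thesis unfolding kser'_def[abs_def] by (rule DERIV_isCont)
qed

lemma DERIV_kint:
  assumes b: "0 < b" shows "(kint b has_real_derivative kser b x) (at x)"
proof -
  have "diffs (\<lambda>k. 1 / (real k * pochhammer b k)) = (\<lambda>k. 1 / pochhammer b (Suc k))"
    by (rule ext) (simp add: diffs_def del: of_nat_Suc pochhammer_Suc)
  moreover have "(kint b has_real_derivative (\<Sum>k. diffs (\<lambda>k. 1 / (real k * pochhammer b k)) k * x ^ k)) (at x)"
    unfolding kint_def[abs_def] by (rule termdiffs_strong_converges_everywhere) (rule summable_kint[OF b])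
  ultimately show ?thesis by (simp add: kser_def)
qed

text \<open>As \<open>b + k\<close> is the last factor of \<open>pochhammer b (Suc k)\<close>,
  multiplying the \<open>k\<close>-th coefficient by it gives the previous one. So the operator
  \<open>x * d/dx + b\<close> sends \<open>kser b\<close> to
  \<open>1 + x * kser b x\<close>.\<close>

lemma kser_ode:
  assumes b: "0 < b" shows "x * kser' b x + (b - x) * kser b x = 1"
proof -
  let ?s = "\<lambda>k. 1 / pochhammer b (Suc k)"
  have p: "0 < pochhammer b (Suc k)" for k by (rule pochhammer_pos[OF b])
  have s: "summable (\<lambda>k. ?s k * x ^ k)" by (rule summable_kser[OF b])
  have d: "(\<lambda>n. of_nat n * ?s n * x ^ (n - Suc 0)) sums kser' b x"
    unfolding kser'_def using termdiff_converges_all[OF summable_kser[OF b], of x]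
    by (intro diffs_equiv) simp
  have 1: "(\<lambda>n. real n * ?s n * x ^ n) sums (x * kser' b x)"
  proof -
    have "x * (of_nat n * ?s n * x ^ (n - Suc 0)) = real n * ?s n * x ^ n" for n
      by (cases n) (simp_all add: mult_ac)
    then show ?thesis using sums_mult[OF d, of x] by (simp only:)
  qed
  have 2: "(\<lambda>n. b * (?s n * x ^ n)) sums (b * kser b x)"
    unfolding kser_def by (intro sums_mult summable_sums s)
  have sum12: "(\<lambda>n. (real n + b) * ?s n * x ^ n) sums (x * kser' b x + b * kser b x)"
    using sums_add[OF 1 2] by (simp only: algebra_simps)
  have "(real (Suc n) + b) * ?s (Suc n) * x ^ Suc n = x * (?s n * x ^ n)" for n
    using p[of n] p[of "Suc n"] b unfolding pochhammer_Suc[of b "Suc n"]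
    by (simp add: field_simps del: pochhammer_Suc)
  then have "(\<lambda>n. (real (Suc n) + b) * ?s (Suc n) * x ^ Suc n) sums (x * kser b x)"
    unfolding kser_def by (simp only: sums_mult[OF summable_sums[OF s]])
  then have "(\<lambda>n. (real n + b) * ?s n * x ^ n) sums (x * kser b x + (real 0 + b) * ?s 0 * x ^ 0)"
    by (subst (asm) sums_Suc_iff) simp
  with sum12 have "x * kser' b x + b * kser b x = x * kser b x + 1"
    using b by (auto dest: sums_unique2)
  then show ?thesis by (simp add: algebra_simps)
qed

text \<open>Every term of positive index carries a factor \<open>h\<close>, because
  \<open>pochhammer h (Suc k) = h * pochhammer (h + 1) k\<close>. The difference quotient at 0 is
  therefore exactly the series of \<open>a k h\<close>, and Tannery's theorem lets \<open>h\<close>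
  tend to 0 termwise; at \<open>h = 0\<close> the Pochhammer symbol is
  \<open>fact k\<close>.\<close>

lemma kummer_deriv1_0:
  assumes b: "0 < b" shows "kummer_deriv1 0 b x = kint b x"
proof -
  define a where "a k h = pochhammer (h + 1) k / pochhammer b (Suc k) * (x ^ Suc k / fact (Suc k))" for k and h :: real
  have p: "0 < pochhammer b (Suc k)" for k by (rule pochhammer_pos[OF b])
  \<comment> \<open>For \<open>\<bar>h\<bar> \<le> 1\<close> the factor \<open>h + 1 + j\<close> is
    at most \<open>j + 2\<close> in absolute value, and the product of these bounds is
    \<open>fact (Suc k)\<close>.\<close>
  have ph: "\<bar>pochhammer (h + 1) k\<bar> \<le> fact (Suc k)" if "\<bar>h\<bar> \<le> 1" for h :: real and k
  proof (induction k)
    case (Suc k)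
    have "\<bar>pochhammer (h + 1) (Suc k)\<bar> = \<bar>pochhammer (h + 1) k\<bar> * \<bar>h + 1 + real k\<bar>"
      by (simp add: pochhammer_Suc abs_mult)
    also have "\<dots> \<le> fact (Suc k) * real (Suc (Suc k))"
      using that by (intro mult_mono Suc) auto
    finally show ?case by (simp add: mult_ac)
  qed simp
  define M where "M k = \<bar>x\<bar> * (1 / pochhammer b (Suc k) * \<bar>x\<bar> ^ k)" for k
  have aM: "norm (a k h) \<le> M k" if "\<bar>h\<bar> \<le> 1" for h k
  proof -
    have "norm (a k h) = \<bar>pochhammer (h + 1) k\<bar> / fact (Suc k) * M k"
      using p[of k] by (simp add: a_def M_def abs_mult power_abs field_simps del: fact_Suc pochhammer_Suc)
    also have "\<dots> \<le> 1 * M k"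
      using ph[OF that, of k] p[of k] by (intro mult_right_mono) (auto simp: M_def simp del: fact_Suc)
    finally show ?thesis by simp
  qed
  have ev: "eventually (\<lambda>h. \<bar>h\<bar> \<le> 1) (at (0::real))"
    by (auto simp: eventually_at intro!: exI[of _ 1])
  have tann: "eventually (\<lambda>h. summable (\<lambda>k. norm (a k h))) (at 0) \<and> summable (\<lambda>k. norm (a k 0)) \<and>
      ((\<lambda>h. \<Sum>k. a k h) \<longlongrightarrow> (\<Sum>k. a k 0)) (at 0)"
  proof (rule tannerys_theorem)
    show "((\<lambda>h. a k h) \<longlongrightarrow> a k 0) (at 0)" for k
    proof -
      have "((\<lambda>h. pochhammer (h + 1) k) \<longlongrightarrow> pochhammer (0 + 1 :: real) k) (at 0)"
        unfolding pochhammer_prod by (intro tendsto_intros)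
      then show ?thesis
        unfolding a_def using p[of k] by (intro tendsto_mult tendsto_divide tendsto_const) auto
    qed
    show "eventually (\<lambda>(k, h). norm (a k h) \<le> M k) (at_top \<times>\<^sub>F at 0)"
      using eventually_prodI[OF eventually_True[of at_top] ev] by eventually_elim (auto intro: aM[unfolded real_norm_def])
    show "summable M" unfolding M_def by (rule summable_mult[OF summable_kser[OF b]])
  qed simp
  have split: "kummer h b x = 1 + h * (\<Sum>k. a k h)" if h: "summable (\<lambda>k. norm (a k h))" for h
  proof -
    let ?t = "\<lambda>k. pochhammer h k / pochhammer b k * (x ^ k / fact k)"
    have t: "?t (Suc k) = h * a k h" for k
      by (simp only: pochhammer_rec[of h] a_def add.commute[of h 1] mult.assoc times_divide_eq_left times_divide_eq_right)
    have s: "summable (a_h :: nat \<Rightarrow> real)" if "a_h = (\<lambda>k. a k h)" for a_h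
      using summable_norm_cancel[OF h] that by simp
    have "(\<lambda>k. ?t (Suc k)) sums (h * (\<Sum>k. a k h))"
      unfolding t by (intro sums_mult summable_sums s refl)
    then have "?t sums (h * (\<Sum>k. a k h) + ?t 0)" by (rule sums_Suc)
    then show ?thesis unfolding kummer_def by (simp add: sums_iff)
  qed
  have a0: "(\<Sum>k. a k 0) = kint b x"
  proof -
    have "(\<Sum>k. a k 0) = (\<Sum>k. 1 / (real (Suc k) * pochhammer b (Suc k)) * x ^ Suc k)"
      by (intro suminf_cong) (simp add: a_def pochhammer_fact[symmetric] field_simps del: of_nat_Suc pochhammer_Suc)
    also have "\<dots> = kint b x"
      unfolding kint_def using suminf_split_head[OF summable_kint[OF b, of x]] by simp
    finally show ?thesis .
  qed
  have "((\<lambda>h. kummer h b x) has_field_derivative kint b x) (at 0)"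
    unfolding has_field_derivative_iff
  proof (rule Lim_transform_eventually[OF tann[THEN conjunct2, THEN conjunct2, unfolded a0]])
    have k0: "kummer 0 b x = 1" using split[of 0] tann by simp
    have "eventually (\<lambda>h. h \<noteq> 0) (at (0::real))" by (auto simp: eventually_at intro!: exI[of _ 1])
    with tann[THEN conjunct1] show "\<forall>\<^sub>F h in at 0. (\<Sum>k. a k h) = (kummer h b x - kummer 0 b x) / (h - 0)"
      by eventually_elim (simp add: split k0)
  qed
  then show ?thesis unfolding kummer_deriv1_def by (rule DERIV_imp_deriv)
qed

text \<open>For \<open>c \<noteq> 0\<close> the function \<open>- kint b (- (c * x)) / c\<close> is
  an antiderivative, and \<open>kint\<close> is the Kummer derivative in \<open>K3\<close>; the
  factor \<open>\<alpha> / (1 - \<alpha> * \<theta>)\<close> is \<open>1 / c\<close>. For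
  \<open>c = 0\<close> the integrand is the constant \<open>1 / b\<close>.\<close>

lemma K3_has_integral:
  assumes "0 < \<alpha>" "0 < \<beta>" "0 < \<theta>" "\<beta> < A" and b: "b = \<beta> / \<alpha>" and c: "c = 1 / \<alpha> - \<theta>"
  shows "((\<lambda>x. kser b (- (c * x))) has_integral K3 \<alpha> \<beta> \<theta> A) {0..A - \<beta>}"
proof (cases "c = 0")
  case True
  have "0 < b" using assms by simp
  then have k: "kser b 0 = 1 / b" by (simp only: kser_def powser_zero) simp
  have "((\<lambda>x. 1 / b) has_integral (1 / b * (A - \<beta>))) {0..A - \<beta>}"
    using has_integral_const_real[of "1 / b" 0 "A - \<beta>"] assms by (simp add: mult.commute)
  moreover have "\<alpha> = 1 / \<theta>" using True assms by (simp add: field_simps)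
  ultimately show ?thesis using True k b by (simp add: K3_def mult.commute)
next
  case False
  have b0: "0 < b" using assms by simp
  have ne: "\<alpha> \<noteq> 1 / \<theta>" using False assms by (auto simp: field_simps)
  have "((\<lambda>x. - (1 / c) * kint b (- (c * x))) has_real_derivative kser b (- (c * x))) (at x)" for x
    using False by (auto intro!: derivative_eq_intros DERIV_chain2[OF DERIV_kint[OF b0]])
  then have "((\<lambda>x. kser b (- (c * x))) has_integral
      (- (1 / c) * kint b (- (c * (A - \<beta>))) - (- (1 / c) * kint b (- (c * 0))))) {0..A - \<beta>}"
    using assms(4) by (intro fundamental_theorem_of_calculus)
      (auto simp: has_real_derivative_iff_has_vector_derivative[symmetric] intro: has_field_derivative_at_within)
  moreover have "kint b 0 = 0" by (simp only: kint_def powser_zero) simp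
  moreover have "(\<alpha> * \<theta> - 1) * (A - \<beta>) / \<alpha> = - (c * (A - \<beta>))" "\<alpha> / (1 - \<alpha> * \<theta>) = 1 / c"
    using assms ne False by (auto simp: c field_simps)
  ultimately show ?thesis using ne kummer_deriv1_0[OF b0] by (simp add: K3_def b[symmetric])
qed

text \<open>An incomplete gamma integral in terms of \<open>kser\<close>: differentiating the
  right-hand side, \<open>kser_ode\<close> collapses the result to the integrand.\<close>

lemma kser_has_integral:
  assumes b: "0 < b" and x: "0 \<le> x"
  shows "((\<lambda>y. y powr (b - 1) * exp (c * y)) has_integral x powr b * exp (c * x) * kser b (- (c * x))) {0..x}"
proof -
  let ?V = "\<lambda>x. x powr b * exp (c * x) * kser b (- (c * x))"
  have "((\<lambda>y. y powr (b - 1) * exp (c * y)) has_integral (?V x - ?V 0)) {0..x}"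
  \<comment> \<open>Only continuity is available at 0: for \<open>b < 1\<close> the power
    \<open>x powr b\<close> has no derivative there.\<close>
  proof (rule fundamental_theorem_of_calculus_interior[OF x])
    have "continuous_on UNIV (kser b)"
      using DERIV_kser[OF b] by (auto simp: continuous_on_eq_continuous_at intro: DERIV_isCont)
    then have k: "continuous_on {0..x} (\<lambda>x. kser b (- (c * x)))"
      by (rule continuous_on_compose2) (auto intro!: continuous_intros)
    show "continuous_on {0..x} ?V"
      using b by (intro continuous_intros k continuous_on_powr') auto
    fix y assume "y \<in> {0<..<x}"
    then have y: "0 < y" by simp
    have "(?V has_real_derivative (b * y powr (b - 1) * exp (c * y) * kser b (- (c * y)) +
       y powr b * (exp (c * y) * c) * kser b (- (c * y)) + y powr b * exp (c * y) * (kser' b (- (c * y)) * (- c)))) (at y)"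
      using y by (auto intro!: derivative_eq_intros DERIV_chain2[OF DERIV_kser[OF b]] simp: algebra_simps)
    also have "y powr b = y powr (b - 1) * y" using y by (simp add: powr_diff)
    also have "b * y powr (b - 1) * exp (c * y) * kser b (- (c * y)) +
       y powr (b - 1) * y * (exp (c * y) * c) * kser b (- (c * y)) + y powr (b - 1) * y * exp (c * y) * (kser' b (- (c * y)) * (- c)) =
       y powr (b - 1) * exp (c * y) * ((- (c * y)) * kser' b (- (c * y)) + (b - (- (c * y))) * kser b (- (c * y)))"
      by (simp add: algebra_simps)
    also have "\<dots> = y powr (b - 1) * exp (c * y)" by (simp only: kser_ode[OF b] mult_1_right)
    finally show "(?V has_vector_derivative y powr (b - 1) * exp (c * y)) (at y)"
      by (simp add: has_real_derivative_iff_has_vector_derivative)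
  qed
  then show ?thesis by simp
qed

text \<open>For negative \<open>x\<close> the series alternates, so the sign is read off from the
  integral representation on \<open>{0..1}\<close>.\<close>

lemma kser_nonneg:
  assumes b: "0 < b" shows "0 \<le> kser b x"
proof -
  have "0 \<le> exp (- x) * kser b x"
    using has_integral_nonneg[OF kser_has_integral[OF b, of 1 "- x"]] by simp
  then show ?thesis by (simp add: zero_le_mult_iff)
qed

text \<open>The solution of the homogeneous equation \<open>x * f' x + (b + c * x) * f x = 0\<close>
  for \<open>x > 0\<close>; it blows up at 0.\<close>

definition outflow :: "real \<Rightarrow> real \<Rightarrow> real \<Rightarrow> real" where
  "outflow b c x = x powr (- b) * exp (- (c * x))"

text \<open>\<open>outflow b c x\<close> times the integral of \<open>y powr (b - 1) * exp (c * y)\<close> over \<open>y \<le> min x q\<close>, in a form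
  that is continuous at \<open>x = 0\<close>.\<close>

definition truncated :: "real \<Rightarrow> real \<Rightarrow> real \<Rightarrow> real \<Rightarrow> real" where
  "truncated b c q x = kser b (- (c * min x q)) * (outflow b c (max x q) / outflow b c q)"

lemma outflow_pos: "0 < x \<Longrightarrow> 0 < outflow b c x"
  by (simp add: outflow_def)

lemma truncated_eq:
  assumes x: "0 < x" and q: "0 < q"
  shows "truncated b c q x =
    outflow b c x * ((min x q) powr b * exp (c * min x q) * kser b (- (c * min x q)))"
  using x q by (auto simp: truncated_def outflow_def min_def max_def exp_minus powr_minus field_simps)

lemma truncated_nonneg: "0 < b \<Longrightarrow> 0 < q \<Longrightarrow> 0 \<le> truncated b c q x"
  unfolding truncated_def
  by (intro mult_nonneg_nonneg divide_nonneg_nonneg kser_nonneg less_imp_le[OF outflow_pos]) auto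

lemma continuous_truncated:
  assumes b: "0 < b" and q: "0 < q" shows "continuous_on UNIV (truncated b c q)"
proof -
  have "continuous_on UNIV (kser b)"
    using DERIV_kser[OF b] by (auto simp: continuous_on_eq_continuous_at intro: DERIV_isCont)
  then have "continuous_on UNIV (\<lambda>x. kser b (- (c * min x q)))"
    by (rule continuous_on_compose2) (auto intro!: continuous_intros)
  moreover have "continuous_on UNIV (\<lambda>x. outflow b c (max x q))"
    unfolding outflow_def using q by (intro continuous_intros) auto
  ultimately show ?thesis
    unfolding truncated_def[abs_def] using outflow_pos[OF q, of b c] by (intro continuous_intros) auto
qed

text \<open>The stated density without its factor
  \<open>K0 / \<beta> * (\<beta> * \<theta> / \<alpha>)\<close>, in the variable
  \<open>y = l - \<beta>\<close>.\<close>

definition tail_kernel :: "real \<Rightarrow> real \<Rightarrow> real \<Rightarrow> real \<Rightarrow> real" where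
  "tail_kernel b c L y = 1 / y * integral {y..L} (\<lambda>x. (x / y) powr (- b) * exp (- c * (x - y)))"

text \<open>Fubini for \<open>outflow b c x * y powr (b - 1) * exp (c * y)\<close> on the region
  \<open>0 < y \<le> q\<close>, \<open>y \<le> x \<le> L\<close>. The integral over \<open>y\<close>
  is \<open>truncated\<close> by \<open>kser_has_integral\<close>, the one over \<open>x\<close> is
  \<open>tail_kernel\<close>. The second claim follows because the function is an inner integral of
  a jointly measurable one.\<close>

lemma nn_integral_truncated:
  assumes b: "0 < b" and q: "0 < q" "q \<le> L"
  shows "(\<integral>\<^sup>+x. ennreal (truncated b c q x) * indicator {0..L} x \<partial>lborel) =
      (\<integral>\<^sup>+y. ennreal (tail_kernel b c L y) * indicator {0<..q} y \<partial>lborel)"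
    and "(\<lambda>y. ennreal (tail_kernel b c L y) * indicator {0<..q} y) \<in> borel_measurable borel"
proof -
  let ?i = "\<lambda>y. y powr (b - 1) * exp (c * y)"
  let ?F = "\<lambda>(x, y). ennreal (outflow b c x * ?i y) * indicator {(x, y). 0 < y \<and> y \<le> q \<and> y \<le> x \<and> x \<le> L} (x, y)"
  have in_x: "(\<integral>\<^sup>+y. ?F (x, y) \<partial>lborel) = ennreal (truncated b c q x) * indicator {0..L} x" if "x \<noteq> 0" for x
  proof (cases "0 < x \<and> x \<le> L")
    case True
    have "(\<integral>\<^sup>+y. ?F (x, y) \<partial>lborel) = (\<integral>\<^sup>+y. ennreal (outflow b c x) * (ennreal (?i y) * indicator {0..min x q} y) \<partial>lborel)"
      by (rule nn_integral_cong_AE, rule AE_mp[OF AE_lborel_singleton[of 0]], rule AE_I2)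
        (use True in \<open>auto simp: ennreal_mult less_imp_le[OF outflow_pos] split: split_indicator\<close>)
    also have "\<dots> = ennreal (outflow b c x) * (\<integral>\<^sup>+y. ennreal (?i y) * indicator {0..min x q} y \<partial>lborel)"
      by (rule nn_integral_cmult) measurable
    also have "(\<integral>\<^sup>+y. ennreal (?i y) * indicator {0..min x q} y \<partial>lborel) =
        ennreal ((min x q) powr b * exp (c * min x q) * kser b (- (c * min x q)))"
      by (rule nn_integral_has_integral_lebesgue'[OF _ kser_has_integral[OF b]]) (use True q in auto)
    finally show ?thesis
      using True q by (simp add: truncated_eq ennreal_mult' less_imp_le[OF outflow_pos])
  next
    case False
    have "(\<integral>\<^sup>+y. ?F (x, y) \<partial>lborel) = (\<integral>\<^sup>+y. 0 \<partial>(lborel :: real measure))"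
      by (rule nn_integral_cong) (use False in \<open>auto split: split_indicator\<close>)
    then show ?thesis using False that by (auto split: split_indicator)
  qed
  have in_y: "(\<integral>\<^sup>+x. ?F (x, y) \<partial>lborel) = ennreal (tail_kernel b c L y) * indicator {0<..q} y" for y
  proof (cases "0 < y \<and> y \<le> q")
    case True
    let ?f = "\<lambda>x. (x / y) powr (- b) * exp (- c * (x - y))"
    have "continuous_on {y..L} ?f" using True by (intro continuous_intros) auto
    then have "(?f has_integral integral {y..L} ?f) {y..L}"
      by (intro integrable_integral integrable_continuous_real)
    then have "((\<lambda>x. 1 / y * ?f x) has_integral (1 / y * integral {y..L} ?f)) {y..L}"
      by (rule has_integral_mult_right)
    then have "(\<integral>\<^sup>+x. ennreal (1 / y * ?f x) * indicator {y..L} x \<partial>lborel) = ennreal (1 / y * integral {y..L} ?f)"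
      by (rule nn_integral_has_integral_lebesgue'[rotated]) (use True in auto)
    moreover have "(\<integral>\<^sup>+x. ?F (x, y) \<partial>lborel) = (\<integral>\<^sup>+x. ennreal (1 / y * ?f x) * indicator {y..L} x \<partial>lborel)"
    proof (rule nn_integral_cong)
      fix x
      have "outflow b c x * ?i y = 1 / y * ?f x" if "y \<le> x"
      proof -
        have "(x / y) powr (- b) = x powr (- b) * y powr b"
          using True that by (simp add: powr_divide powr_minus field_simps)
        moreover have "exp (- c * (x - y)) = exp (- (c * x)) * exp (c * y)"
          by (simp add: exp_add[symmetric] algebra_simps)
        moreover have "y powr (b - 1) = y powr b / y" using True by (simp add: powr_diff)
        ultimately show ?thesis by (simp add: outflow_def)
      qed
      then show "?F (x, y) = ennreal (1 / y * ?f x) * indicator {y..L} x"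
        using True by (auto split: split_indicator)
    qed
    ultimately show ?thesis using True by (simp add: tail_kernel_def)
  next
    case False
    have "(\<integral>\<^sup>+x. ?F (x, y) \<partial>lborel) = (\<integral>\<^sup>+x. 0 \<partial>(lborel :: real measure))"
      by (rule nn_integral_cong) (use False in \<open>auto split: split_indicator\<close>)
    then show ?thesis using False by (auto split: split_indicator)
  qed
  have "{(x, y). 0 < y \<and> y \<le> q \<and> y \<le> x \<and> x \<le> L} = {p \<in> space (borel \<Otimes>\<^sub>M borel). 0 < snd p \<and> snd p \<le> q \<and> snd p \<le> fst p \<and> fst p \<le> L}"
    by (auto simp: space_pair_measure)
  also have "\<dots> \<in> sets (borel \<Otimes>\<^sub>M borel)" by measurable
  finally have [measurable]: "{(x, y). 0 < y \<and> y \<le> q \<and> y \<le> x \<and> x \<le> L} \<in> sets (borel \<Otimes>\<^sub>M borel)" .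
  have m: "?F \<in> borel_measurable (lborel \<Otimes>\<^sub>M lborel)"
    unfolding outflow_def by measurable
  have "(\<integral>\<^sup>+x. ennreal (truncated b c q x) * indicator {0..L} x \<partial>lborel) = (\<integral>\<^sup>+x. \<integral>\<^sup>+y. ?F (x, y) \<partial>lborel \<partial>lborel)"
    by (rule nn_integral_cong_AE, rule AE_mp[OF AE_lborel_singleton[of 0]], rule AE_I2) (use in_x in auto)
  also have "\<dots> = (\<integral>\<^sup>+y. \<integral>\<^sup>+x. ?F (x, y) \<partial>lborel \<partial>lborel)"
    by (rule lborel_pair.Fubini[OF m, symmetric])
  finally show "(\<integral>\<^sup>+x. ennreal (truncated b c q x) * indicator {0..L} x \<partial>lborel) =
      (\<integral>\<^sup>+y. ennreal (tail_kernel b c L y) * indicator {0<..q} y \<partial>lborel)" by (simp only: in_y)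
  have "(\<lambda>y. \<integral>\<^sup>+x. ?F (x, y) \<partial>lborel) \<in> borel_measurable lborel"
    by (rule lborel.borel_measurable_nn_integral) (use measurable_compose[OF measurable_pair_swap' m] in \<open>simp add: case_prod_beta'\<close>)
  then show "(\<lambda>y. ennreal (tail_kernel b c L y) * indicator {0<..q} y) \<in> borel_measurable borel"
    by (simp only: in_y) simp
qed

section \<open>Lipschitz bounds and derivatives along the flow\<close>

lemma continuous_on_Icc_bounded:
  fixes f :: "real \<Rightarrow> real"
  assumes "continuous_on {p..r} f" shows "\<exists>M>0. \<forall>x\<in>{p..r}. \<bar>f x\<bar> \<le> M"
proof -
  have "bounded (f ` {p..r})"
    by (intro compact_imp_bounded compact_continuous_image assms) simp
  then show ?thesis by (auto simp: bounded_pos)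
qed

lemma C1_lipschitz:
  fixes f :: "real \<Rightarrow> real"
  assumes "\<And>x. x \<in> {p..r} \<Longrightarrow> (f has_real_derivative f' x) (at x)" "continuous_on {p..r} f'"
  shows "\<exists>K\<ge>0. \<forall>x\<in>{p..r}. \<forall>y\<in>{p..r}. \<bar>f x - f y\<bar> \<le> K * \<bar>x - y\<bar>"
proof -
  obtain K where K: "0 < K" "\<And>x. x \<in> {p..r} \<Longrightarrow> norm (f' x) \<le> K"
    using continuous_on_Icc_bounded[OF assms(2)] by auto
  have "norm (f x - f y) \<le> K * norm (x - y)" if "x \<in> {p..r}" "y \<in> {p..r}" for x y
    by (rule field_differentiable_bound[of "{p..r}" f f']) (use assms K that in \<open>auto intro: has_field_derivative_at_within\<close>)
  then show ?thesis using K(1) by (intro exI[of _ K]) auto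
qed

lemma DERIV_outflow:
  "0 < x \<Longrightarrow> (outflow b c has_real_derivative - (b / x + c) * outflow b c x) (at x)"
  unfolding outflow_def by (auto intro!: derivative_eq_intros simp: powr_diff field_simps)

text \<open>The function has a kink at \<open>q\<close>, so the mean value bound is applied to its
  two factors separately: each is continuously differentiable on its own interval and composed with
  the 1-Lipschitz map \<open>min\<close> or \<open>max\<close>.\<close>

lemma truncated_lipschitz:
  assumes b: "0 < b" and q: "0 < q" "q \<le> L"
  shows "\<exists>K\<ge>0. \<forall>x\<in>{0..L}. \<forall>y\<in>{0..L}. \<bar>truncated b c q x - truncated b c q y\<bar> \<le> K * \<bar>x - y\<bar>"
proof -
  let ?f = "\<lambda>x. kser b (- (c * x))" and ?g = "\<lambda>x. outflow b c x / outflow b c q"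
  have fD: "(?f has_real_derivative kser' b (- (c * x)) * (- c)) (at x)" for x
    by (rule DERIV_cong[OF DERIV_chain2[where f="kser b", OF DERIV_kser[OF b]]]) (auto intro!: derivative_eq_intros)
  have "\<exists>K\<ge>0. \<forall>x\<in>{0..q}. \<forall>y\<in>{0..q}. \<bar>?f x - ?f y\<bar> \<le> K * \<bar>x - y\<bar>"
  proof (rule C1_lipschitz[OF fD])
    have "continuous_on UNIV (kser' b)"
      using isCont_kser'[OF b] by (auto simp: continuous_on_eq_continuous_at)
    then have "continuous_on {0..q} (\<lambda>x. kser' b (- (c * x)))"
      by (rule continuous_on_compose2) (auto intro!: continuous_intros)
    then show "continuous_on {0..q} (\<lambda>x. kser' b (- (c * x)) * (- c))" by (intro continuous_intros)
  qed
  then obtain K1 where K1: "0 \<le> K1" "\<And>x y. x \<in> {0..q} \<Longrightarrow> y \<in> {0..q} \<Longrightarrow> \<bar>?f x - ?f y\<bar> \<le> K1 * \<bar>x - y\<bar>" by blast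
  have gc: "continuous_on {q..L} ?g"
    unfolding outflow_def using q by (intro continuous_intros) auto
  have gD: "(?g has_real_derivative - (b / x + c) * ?g x) (at x)" if "x \<in> {q..L}" for x
    using DERIV_cdivide[OF DERIV_outflow[of x b c], of "outflow b c q"] that q by simp
  have "\<exists>K\<ge>0. \<forall>x\<in>{q..L}. \<forall>y\<in>{q..L}. \<bar>?g x - ?g y\<bar> \<le> K * \<bar>x - y\<bar>"
    by (rule C1_lipschitz[OF gD], assumption, rule continuous_on_mult[OF _ gc])
      (use q in \<open>auto intro!: continuous_intros\<close>)
  then obtain K2 where K2: "0 \<le> K2" "\<And>x y. x \<in> {q..L} \<Longrightarrow> y \<in> {q..L} \<Longrightarrow> \<bar>?g x - ?g y\<bar> \<le> K2 * \<bar>x - y\<bar>" by blast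
  obtain M2 where M2: "0 < M2" "\<And>x. x \<in> {q..L} \<Longrightarrow> \<bar>?g x\<bar> \<le> M2"
    using continuous_on_Icc_bounded[OF gc] by auto
  have "continuous_on {0..q} ?f"
    by (intro continuous_at_imp_continuous_on ballI) (rule DERIV_isCont[OF fD])
  then obtain M1 where M1: "0 < M1" "\<And>x. x \<in> {0..q} \<Longrightarrow> \<bar>?f x\<bar> \<le> M1"
    using continuous_on_Icc_bounded by blast
  have "\<bar>truncated b c q x - truncated b c q y\<bar> \<le> (M1 * K2 + K1 * M2) * \<bar>x - y\<bar>"
    if xy: "x \<in> {0..L}" "y \<in> {0..L}" for x y
  proof -
    have m: "min x q \<in> {0..q}" "min y q \<in> {0..q}" "max x q \<in> {q..L}" "max y q \<in> {q..L}" using xy q by auto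
    have 1: "\<bar>?f (min x q)\<bar> * \<bar>?g (max x q) - ?g (max y q)\<bar> \<le> M1 * (K2 * \<bar>x - y\<bar>)"
    proof (rule mult_mono[OF M1(2)[OF m(1)] order_trans[OF K2(2)[OF m(3,4)]]])
      show "K2 * \<bar>max x q - max y q\<bar> \<le> K2 * \<bar>x - y\<bar>" using K2(1) by (intro mult_left_mono) auto
    qed (use M1 in auto)
    have 2: "\<bar>?f (min x q) - ?f (min y q)\<bar> * \<bar>?g (max y q)\<bar> \<le> (K1 * \<bar>x - y\<bar>) * M2"
    proof (rule mult_mono[OF order_trans[OF K1(2)[OF m(1,2)]] M2(2)[OF m(4)]])
      show "K1 * \<bar>min x q - min y q\<bar> \<le> K1 * \<bar>x - y\<bar>" using K1(1) by (intro mult_left_mono) auto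
    qed (use K1 in auto)
    have "truncated b c q x - truncated b c q y = ?f (min x q) * (?g (max x q) - ?g (max y q)) +
        (?f (min x q) - ?f (min y q)) * ?g (max y q)"
      unfolding truncated_def by (simp only: right_diff_distrib left_diff_distrib)
    then have "\<bar>truncated b c q x - truncated b c q y\<bar> \<le> \<bar>?f (min x q)\<bar> * \<bar>?g (max x q) - ?g (max y q)\<bar> +
        \<bar>?f (min x q) - ?f (min y q)\<bar> * \<bar>?g (max y q)\<bar>"
      by (simp only: abs_mult[symmetric] abs_triangle_ineq)
    then show ?thesis using 1 2 by (simp add: algebra_simps)
  qed
  moreover have "0 \<le> M1 * K2 + K1 * M2" using K1 K2 M1 M2 by simp
  ultimately show ?thesis by blast
qed

text \<open>The functions \<open>kser b (- (c * x))\<close> and \<open>truncated b c q x\<close> of \<open>x\<close> solve \<open>x * f' x + (b + c * x) * f x = s x\<close>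
  with \<open>s = 1\<close> and with \<open>s\<close> the indicator of \<open>{..q}\<close>.  Since the flow decreases, the right derivative in time only
  sees \<open>s\<close> to the left of \<open>x\<close>, so the jump of \<open>s\<close> at \<open>q\<close> does no harm.\<close>

lemma DERIV_kser_flow:
  assumes b: "0 < b"
  shows "((\<lambda>t. kser b (- (c * (x * exp (- (a * t)))))) has_real_derivative a * ((b + c * x) * kser b (- (c * x)) - 1)) (at 0)"
proof -
  have "((\<lambda>t. kser b (- (c * (x * exp (- (a * t)))))) has_real_derivative
      kser' b (- (c * x)) * (c * (x * a))) (at 0)"
    by (rule DERIV_cong[OF DERIV_chain2[where f="kser b", OF DERIV_kser[OF b]]]) (auto intro!: derivative_eq_intros)
  moreover have "kser' b (- (c * x)) * (c * (x * a)) = a * ((b + c * x) * kser b (- (c * x)) - 1)"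
    using kser_ode[OF b, of "- (c * x)"] by (simp add: algebra_simps)
  ultimately show ?thesis by simp
qed

lemma DERIV_truncated_flow:
  assumes b: "0 < b" and q: "0 < q" and x: "0 \<le> x" and a: "0 < a"
  shows "((\<lambda>t. truncated b c q (x * exp (- (a * t)))) has_real_derivative
    a * ((b + c * x) * truncated b c q x - (if x \<le> q then 1 else 0))) (at 0 within {0..})"
proof (cases "x \<le> q")
  case True
  have o: "outflow b c q \<noteq> 0" using outflow_pos[OF q, of b c] by simp
  have le: "truncated b c q (x * exp (- (a * t))) = kser b (- (c * (x * exp (- (a * t)))))" if "0 \<le> t" for t
  proof -
    have "x * exp (- (a * t)) \<le> x * 1" using x a that by (intro mult_left_mono) auto
    then have "x * exp (- (a * t)) \<le> q" using True by simp
    then show ?thesis using o by (simp add: truncated_def min_absorb1 max_absorb2)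
  qed
  have "((\<lambda>t. kser b (- (c * (x * exp (- (a * t)))))) has_real_derivative
      a * ((b + c * x) * kser b (- (c * x)) - 1)) (at 0 within {0..})"
    by (rule has_field_derivative_at_within[OF DERIV_kser_flow[OF b]])
  then have "((\<lambda>t. truncated b c q (x * exp (- (a * t)))) has_real_derivative
      a * ((b + c * x) * kser b (- (c * x)) - 1)) (at 0 within {0..})"
    by (rule has_field_derivative_transform_within[where d=1]) (auto simp: le)
  then show ?thesis using True le[of 0] by simp
next
  case False
  \<comment> \<open>To the right of \<open>q\<close> the function is a constant multiple of the
    homogeneous solution, and for small times the flow has not yet reached \<open>q\<close>.\<close>
  let ?k = "kser b (- (c * q)) / outflow b c q"
  have x0: "0 < x" using False q by simp
  have "((\<lambda>t. outflow b c (x * exp (- (a * t)))) has_real_derivative (- (b / x + c) * outflow b c x) * (- (x * a))) (at 0)"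
    by (rule DERIV_cong[OF DERIV_chain2[where f="outflow b c", OF DERIV_outflow]])
      (use x0 in \<open>auto intro!: derivative_eq_intros\<close>)
  from DERIV_cmult[OF this, of ?k]
  have D: "((\<lambda>t. ?k * outflow b c (x * exp (- (a * t)))) has_real_derivative a * ((b + c * x) * (?k * outflow b c x))) (at 0)"
  proof (rule DERIV_cong)
    have "k * (- B * f * - (x * a)) = a * ((B * x) * (k * f))" for k B f :: real by (simp add: mult_ac)
    then have "?k * (- (b / x + c) * outflow b c x * - (x * a)) = a * (((b / x + c) * x) * (?k * outflow b c x))" .
    also have "(b / x + c) * x = b + c * x" using x0 by (simp add: distrib_right)
    finally show "?k * (- (b / x + c) * outflow b c x * - (x * a)) = a * ((b + c * x) * (?k * outflow b c x))" .
  qed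
  have eq: "truncated b c q y = ?k * outflow b c y" if "q < y" for y
    using that by (simp add: truncated_def min_def max_def)
  have "((\<lambda>t. x * exp (- (a * t))) \<longlongrightarrow> x * exp (- (a * 0))) (at 0)" by (intro tendsto_intros)
  then have "eventually (\<lambda>t. q < x * exp (- (a * t))) (at 0)"
    using False by (intro order_tendstoD(1)) auto
  then have "eventually (\<lambda>t. q < x * exp (- (a * t))) (nhds 0)"
    using False by (subst eventually_nhds_conv_at) simp
  then have ev: "eventually (\<lambda>t. ?k * outflow b c (x * exp (- (a * t))) = truncated b c q (x * exp (- (a * t)))) (nhds 0)"
    by eventually_elim (simp add: eq)
  have "((\<lambda>t. truncated b c q (x * exp (- (a * t)))) has_real_derivative a * ((b + c * x) * (?k * outflow b c x))) (at 0)"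
    by (rule DERIV_cong_ev[THEN iffD1, OF refl ev refl D])
  then have "((\<lambda>t. truncated b c q (x * exp (- (a * t)))) has_real_derivative a * ((b + c * x) * (?k * outflow b c x))) (at 0 within {0..})"
    by (rule has_field_derivative_at_within)
  then show ?thesis using False eq[of x] by simp
qed

section \<open>The marginal law of the intensity\<close>

context resetting
begin

text \<open>For \<open>m\<close> as claimed, a function \<open>g\<close> is built to which the
  generator assigns \<open>indicator {..a} - m\<close>; \<open>invariant_generator\<close> then says
  that the measure of \<open>{..a}\<close> is \<open>m\<close>.\<close>

lemma measure_marginal_atMost:
  assumes K0: "K0 / \<beta> = \<alpha> / (\<alpha> + \<beta> * \<theta> * K3 \<alpha> \<beta> \<theta> A)"
    and Q: "invariant_measure \<alpha> \<beta> \<beta> A ell G Q" and a: "\<beta> < a" "a \<le> A"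
    and R: "(truncated (\<beta> / \<alpha>) (1 / \<alpha> - \<theta>) (a - \<beta>) has_integral R) {0..A - \<beta>}"
  shows "measure (intensity_marginal Q) {..a} = K0 / \<beta> + K0 / \<beta> * (\<beta> * \<theta> / \<alpha>) * R"
proof -
  define b where "b = \<beta> / \<alpha>"
  define c where "c = 1 / \<alpha> - \<theta>"
  define q where "q = a - \<beta>"
  define L where "L = A - \<beta>"
  define m where "m = K0 / \<beta> + K0 / \<beta> * (\<beta> * \<theta> / \<alpha>) * R"
  define \<kappa> where "\<kappa> = K3 \<alpha> \<beta> \<theta> A"
  have b: "0 < b" using alpha beta by (simp add: b_def)
  have ab: "\<alpha> * b = \<beta>" using alpha by (simp add: b_def)
  have ac: "\<alpha> * c = 1 - \<alpha> * \<theta>" using alpha by (simp add: c_def algebra_simps)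
  have q: "0 < q" "q \<le> L" using a by (auto simp: q_def L_def)
  have L: "0 < L" using A by (simp add: L_def)
  have K3: "((\<lambda>x. kser b (- (c * x))) has_integral \<kappa>) {0..L}"
    unfolding L_def \<kappa>_def by (rule K3_has_integral) (use alpha beta theta A in \<open>auto simp: b_def c_def\<close>)
  have K30: "0 \<le> \<kappa>" by (rule has_integral_nonneg[OF K3]) (rule kser_nonneg[OF b])
  have R': "(truncated b c q has_integral R) {0..L}" using R by (simp add: b_def c_def q_def L_def)
  \<comment> \<open>The derivative of the function \<open>F\<close> below. Away from the jump of the
    indicator it solves \<open>x * w' + (b + c * x) * w = \<theta> / \<alpha> * (s - m)\<close>, by
    superposition of the two solutions regular at 0.\<close>
  define w where "w x = \<theta> / \<alpha> * (truncated b c q x - m * kser b (- (c * x)))" for x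
  have kc: "continuous_on UNIV (\<lambda>x. kser b (- (c * x)))"
  proof -
    have "continuous_on UNIV (kser b)"
      by (intro continuous_at_imp_continuous_on ballI) (rule DERIV_isCont[OF DERIV_kser[OF b]])
    then show ?thesis by (rule continuous_on_compose2) (auto intro!: continuous_intros)
  qed
  have wc: "continuous_on UNIV w"
    unfolding w_def[abs_def] by (intro continuous_intros continuous_truncated b q kc)
  have "\<exists>F. \<forall>x::real. - \<infinity> < ereal x \<longrightarrow> ereal x < \<infinity> \<longrightarrow> (F has_vector_derivative w x) (at x)"
    by (rule einterval_antiderivative) (use wc in \<open>auto simp: continuous_on_eq_continuous_at\<close>)
  then obtain F0 where F0: "\<And>x. (F0 has_real_derivative w x) (at x)"
    by (auto simp: has_real_derivative_iff_has_vector_derivative)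
  define F where "F x = F0 x - F0 0" for x
  have F: "(F has_real_derivative w x) (at x)" for x
    unfolding F_def[abs_def] by (rule DERIV_cong[OF DERIV_diff[OF F0 DERIV_const]]) simp
  have F0': "F 0 = 0" by (simp add: F_def)
  have Fc: "continuous_on X F" for X
    by (intro continuous_at_imp_continuous_on ballI) (rule DERIV_isCont[OF F])
  have w0: "w 0 / \<theta> = (1 - m) / \<beta>"
  proof -
    have "kser b 0 = 1 / b" by (simp only: kser_def powser_zero) simp
    moreover have "truncated b c q 0 = kser b 0"
      using q outflow_pos[of q b c] by (simp add: truncated_def)
    ultimately have "w 0 = \<theta> / (\<alpha> * b) * (1 - m)" using b alpha by (simp add: w_def field_simps)
    then show ?thesis using theta by (simp add: ab)
  qed
  \<comment> \<open>The reset condition. As \<open>F L\<close> is the integral of \<open>w\<close>,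
    it says \<open>\<theta> / \<alpha> * (R - m * \<kappa>) = - (1 - m) / \<beta>\<close>, a linear
    equation for \<open>m\<close>; the hypothesis on \<open>K0\<close> makes the claimed value its
    solution.\<close>
  have FL: "F L = - w 0 / \<theta>"
  proof -
    have "(w has_integral (F L - F 0)) {0..L}"
      using L F by (intro fundamental_theorem_of_calculus)
        (auto simp: has_real_derivative_iff_has_vector_derivative[symmetric] intro: has_field_derivative_at_within)
    moreover have "(w has_integral \<theta> / \<alpha> * (R - m * \<kappa>)) {0..L}"
      unfolding w_def[abs_def] by (intro has_integral_mult_right has_integral_diff R' K3)
    ultimately have 1: "F L = \<theta> / \<alpha> * (R - m * \<kappa>)" using F0' by (metis diff_zero has_integral_unique)
    have D: "\<alpha> + \<beta> * \<theta> * \<kappa> > 0" using alpha beta theta K30 by (intro add_pos_nonneg mult_nonneg_nonneg) auto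
    have "m = K0 / \<beta> * (1 + \<beta> * \<theta> / \<alpha> * R)"
      by (simp only: m_def distrib_left mult.assoc mult_1_right)
    then have "m * (\<alpha> + \<beta> * \<theta> * \<kappa>) = (K0 / \<beta> * (\<alpha> + \<beta> * \<theta> * \<kappa>)) * (1 + \<beta> * \<theta> / \<alpha> * R)"
      by (simp only: mult_ac)
    also have "K0 / \<beta> * (\<alpha> + \<beta> * \<theta> * \<kappa>) = \<alpha>" using K0 D by (simp add: \<kappa>_def)
    also have "\<alpha> * (1 + \<beta> * \<theta> / \<alpha> * R) = \<alpha> + \<beta> * (\<theta> * R)" using alpha by (simp add: distrib_left)
    finally have "m * \<alpha> + \<beta> * (m * \<theta> * \<kappa>) = \<alpha> + \<beta> * (\<theta> * R)" by (simp add: algebra_simps)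
    then have "\<beta> * (\<theta> * (R - m * \<kappa>)) = - (1 - m) * \<alpha>" by (simp add: algebra_simps)
    then have "\<theta> / \<alpha> * (R - m * \<kappa>) = - ((1 - m) / \<beta>)" using alpha beta by (simp add: field_simps)
    then show ?thesis using 1 w0 by simp
  qed
  obtain M1 where M1: "0 < M1" "\<And>x. x \<in> {0..L} \<Longrightarrow> \<bar>F x\<bar> \<le> M1"
    using continuous_on_Icc_bounded[OF Fc] by blast
  obtain M2 where M2: "0 < M2" "\<And>x. x \<in> {0..L} \<Longrightarrow> \<bar>w x\<bar> \<le> M2"
    using continuous_on_Icc_bounded[OF continuous_on_subset[OF wc subset_UNIV]] by blast
  \<comment> \<open>The generator kills constants, so adding one is harmless; this one puts
    \<open>g\<close> and \<open>\<Gamma>\<close> between 0 and \<open>2 * M\<close>, as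
    \<open>invariant_generator\<close> requires.\<close>
  define M where "M = M1 + M2 / \<theta>"
  have M: "0 < M" "M1 \<le> M" using M1 M2 theta by (auto simp: M_def add_pos_pos)
  define \<Gamma> where "\<Gamma> l = F (l - \<beta>) + M" for l
  define g where "g l = \<Gamma> l - w (l - \<beta>) / \<theta>" for l
  have wL: "\<exists>K\<ge>0. \<forall>x\<in>{0..L}. \<forall>y\<in>{0..L}. \<bar>w x - w y\<bar> \<le> K * \<bar>x - y\<bar>"
  proof -
    obtain K1 where K1: "0 \<le> K1" "\<And>x y. x \<in> {0..L} \<Longrightarrow> y \<in> {0..L} \<Longrightarrow> \<bar>truncated b c q x - truncated b c q y\<bar> \<le> K1 * \<bar>x - y\<bar>"
      using truncated_lipschitz[OF b q] by blast
    have "\<exists>K\<ge>0. \<forall>x\<in>{0..L}. \<forall>y\<in>{0..L}. \<bar>kser b (- (c * x)) - kser b (- (c * y))\<bar> \<le> K * \<bar>x - y\<bar>"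
    proof (rule C1_lipschitz)
      show "((\<lambda>x. kser b (- (c * x))) has_real_derivative kser' b (- (c * x)) * (- c)) (at x)" for x
        by (rule DERIV_cong[OF DERIV_chain2[where f="kser b", OF DERIV_kser[OF b]]]) (auto intro!: derivative_eq_intros)
      have "continuous_on UNIV (kser' b)"
        using isCont_kser'[OF b] by (auto simp: continuous_on_eq_continuous_at)
      then have "continuous_on {0..L} (\<lambda>x. kser' b (- (c * x)))"
        by (rule continuous_on_compose2) (auto intro!: continuous_intros)
      then show "continuous_on {0..L} (\<lambda>x. kser' b (- (c * x)) * (- c))" by (intro continuous_intros)
    qed
    then obtain K2 where K2: "0 \<le> K2" "\<And>x y. x \<in> {0..L} \<Longrightarrow> y \<in> {0..L} \<Longrightarrow> \<bar>kser b (- (c * x)) - kser b (- (c * y))\<bar> \<le> K2 * \<bar>x - y\<bar>"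
      by blast
    have "\<bar>w x - w y\<bar> \<le> (\<theta> / \<alpha> * (K1 + \<bar>m\<bar> * K2)) * \<bar>x - y\<bar>" if "x \<in> {0..L}" "y \<in> {0..L}" for x y
    proof -
      have "w x - w y = \<theta> / \<alpha> * ((truncated b c q x - truncated b c q y) + - m * (kser b (- (c * x)) - kser b (- (c * y))))"
        by (simp add: w_def algebra_simps)
      also have "\<bar>\<dots>\<bar> = \<theta> / \<alpha> * \<bar>(truncated b c q x - truncated b c q y) + - m * (kser b (- (c * x)) - kser b (- (c * y)))\<bar>"
        using alpha theta by (simp add: abs_mult)
      also have "\<dots> \<le> \<theta> / \<alpha> * (K1 * \<bar>x - y\<bar> + \<bar>m\<bar> * (K2 * \<bar>x - y\<bar>))"
      proof (rule mult_left_mono[OF order_trans[OF abs_triangle_ineq add_mono[OF K1(2)[OF that]]]])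
        show "\<bar>- m * (kser b (- (c * x)) - kser b (- (c * y)))\<bar> \<le> \<bar>m\<bar> * (K2 * \<bar>x - y\<bar>)"
          unfolding abs_mult using mult_left_mono[OF K2(2)[OF that], of "\<bar>m\<bar>"] by simp
      qed (use alpha theta in simp)
      finally show ?thesis by (simp add: algebra_simps)
    qed
    moreover have "0 \<le> \<theta> / \<alpha> * (K1 + \<bar>m\<bar> * K2)" using K1 K2 alpha theta by simp
    ultimately show ?thesis by blast
  qed
  have FL': "\<exists>K\<ge>0. \<forall>x\<in>{0..L}. \<forall>y\<in>{0..L}. \<bar>F x - F y\<bar> \<le> K * \<bar>x - y\<bar>"
    by (rule C1_lipschitz[OF F continuous_on_subset[OF wc subset_UNIV]])
  obtain K1 where K1: "0 \<le> K1" "\<And>x y. x \<in> {0..L} \<Longrightarrow> y \<in> {0..L} \<Longrightarrow> \<bar>w x - w y\<bar> \<le> K1 * \<bar>x - y\<bar>" using wL by blast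
  obtain K2 where K2: "0 \<le> K2" "\<And>x y. x \<in> {0..L} \<Longrightarrow> y \<in> {0..L} \<Longrightarrow> \<bar>F x - F y\<bar> \<le> K2 * \<bar>x - y\<bar>" using FL' by blast
  define C where "C = (K2 + K1 / \<theta>) * (L * \<alpha>)"
  have in_L: "l - \<beta> \<in> {0..L}" if "\<beta> \<le> l" "l < A" for l using that by (auto simp: L_def)
  have flm: "\<bar>(fl l t - \<beta>) - (l - \<beta>)\<bar> \<le> L * \<alpha> * t" if l: "\<beta> \<le> l" "l < A" and t: "0 \<le> t" for l t
  proof -
    have e: "0 \<le> 1 - exp (- (\<alpha> * t))" "1 - exp (- (\<alpha> * t)) \<le> \<alpha> * t"
      using exp_ge_add_one_self[of "- (\<alpha> * t)"] alpha t by auto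
    have "\<bar>(fl l t - \<beta>) - (l - \<beta>)\<bar> = (l - \<beta>) * (1 - exp (- (\<alpha> * t)))"
      using fl_le[OF l(1) t] by (simp add: flow_def algebra_simps)
    also have "\<dots> \<le> L * (\<alpha> * t)" using e in_L[OF l] by (intro mult_mono) auto
    finally show ?thesis by (simp add: mult.assoc)
  qed
  have flin: "fl l t - \<beta> \<in> {0..L}" if l: "\<beta> \<le> l" "l < A" and t: "0 \<le> t" for l t
    using fl_ge[OF l(1)] fl_le[OF l(1) t] l(2) by (auto simp: L_def)
  have FLip: "\<bar>F (fl l t - \<beta>) - F (l - \<beta>)\<bar> \<le> K2 * (L * \<alpha> * t)" if l: "\<beta> \<le> l" "l < A" and t: "0 \<le> t" for l t
    using order_trans[OF K2(2)[OF flin[OF l t] in_L[OF l]] mult_left_mono[OF flm[OF l t] K2(1)]] .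
  have wLip: "\<bar>w (fl l t - \<beta>) - w (l - \<beta>)\<bar> \<le> K1 * (L * \<alpha> * t)" if l: "\<beta> \<le> l" "l < A" and t: "0 \<le> t" for l t
    using order_trans[OF K1(2)[OF flin[OF l t] in_L[OF l]] mult_left_mono[OF flm[OF l t] K1(1)]] .
  have [measurable]: "w \<in> borel_measurable borel" "F \<in> borel_measurable borel"
    using borel_measurable_continuous_onI[OF wc] borel_measurable_continuous_onI[OF Fc] by simp_all
  define s where "s x = (if x \<le> q then 1 else 0 :: real)" for x
  have [measurable]: "s \<in> borel_measurable borel" unfolding s_def[abs_def] by measurable
  \<comment> \<open>The derivative of \<open>g\<close> along the flow. The first term comes from
    \<open>F\<close>, the quotient from \<open>w\<close>; there \<open>x * w'\<close> has been
    eliminated by the differential equation, so the formula also makes sense at the jump of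
    \<open>s\<close>.\<close>
  define d where "d l = - (\<alpha> * (l - \<beta>)) * w (l - \<beta>) - ((\<beta> + \<alpha> * c * (l - \<beta>)) * w (l - \<beta>) - \<theta> * (s (l - \<beta>) - m)) / \<theta>" for l
  have gB: "0 \<le> g l \<and> g l \<le> 2 * M" and \<Gamma>B: "0 \<le> \<Gamma> l \<and> \<Gamma> l \<le> 2 * M" if l: "\<beta> \<le> l" "l < A" for l
  proof -
    have "\<bar>w (l - \<beta>) / \<theta>\<bar> \<le> M2 / \<theta>" using M2(2)[OF in_L[OF l]] theta by (simp add: divide_right_mono)
    then have "w (l - \<beta>) / \<theta> \<le> M2 / \<theta>" "- (M2 / \<theta>) \<le> w (l - \<beta>) / \<theta>" by linarith+
    moreover have "F (l - \<beta>) \<le> M1" "- M1 \<le> F (l - \<beta>)" using M1(2)[OF in_L[OF l]] by linarith+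
    ultimately have "0 \<le> g l" "g l \<le> 2 * M" unfolding g_def \<Gamma>_def M_def by simp_all
    then show "0 \<le> g l \<and> g l \<le> 2 * M" by simp
    show "0 \<le> \<Gamma> l \<and> \<Gamma> l \<le> 2 * M" using M1(2)[OF in_L[OF l]] M unfolding \<Gamma>_def by linarith
  qed
  have g\<beta>: "g \<beta> = F L + M" by (simp add: g_def \<Gamma>_def F0' FL)
  have main: "(\<integral>x. d (snd x) + snd x * (\<Gamma> (snd x) - g (snd x)) \<partial>Q) = 0"
  proof (rule invariant_generator[OF _ _ _ gB \<Gamma>B _ _ _ _ Q, where C=C])
    show "g \<in> borel_measurable borel" "\<Gamma> \<in> borel_measurable borel" "d \<in> borel_measurable borel"
      unfolding g_def[abs_def] \<Gamma>_def[abs_def] d_def[abs_def] by measurable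
    fix l t :: real assume l: "\<beta> \<le> l" "l < A" and t: "0 \<le> t"
    have "K1 / \<theta> * (L * \<alpha> * t) \<ge> 0" using K1 L alpha t theta by simp
    then show "\<bar>\<Gamma> (fl l t) - \<Gamma> l\<bar> \<le> C * t"
      using FLip[OF l t] by (simp add: \<Gamma>_def C_def algebra_simps)
    have "\<bar>w (fl l t - \<beta>) / \<theta> - w (l - \<beta>) / \<theta>\<bar> \<le> K1 * (L * \<alpha> * t) / \<theta>"
      using wLip[OF l t] theta by (simp add: diff_divide_distrib[symmetric] divide_right_mono)
    then have "\<bar>g (fl l t) - g l\<bar> \<le> K2 * (L * \<alpha> * t) + K1 * (L * \<alpha> * t) / \<theta>"
      using FLip[OF l t] unfolding g_def \<Gamma>_def by linarith
    also have "\<dots> = C * t" by (simp add: C_def algebra_simps)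
    finally show "\<bar>g (fl l t) - g l\<bar> \<le> C * t" .
  next
    fix x assume x: "x \<in> space S"
    let ?l = "snd x" and ?n = "Suc (fst x)" and ?f = "exponential_density \<theta>"
    have l: "\<beta> \<le> ?l" "?l < A" using space_S_D[OF x] by auto
    define \<phi> where "\<phi> y = (if ?l + y < A then g (?l + y) else g \<beta>)" for y
    have gm: "g \<in> borel_measurable borel" unfolding g_def[abs_def] \<Gamma>_def[abs_def] by measurable
    have \<phi>m: "\<phi> \<in> borel_measurable borel" unfolding \<phi>_def[abs_def] using gm by measurable
    have n: "?n \<ge> 1" by simp
    have fin: "(\<integral>z. u (ell ?n z) \<partial>G) = (\<integral>y. ?f y * u y \<partial>lborel)" if "u \<in> borel_measurable borel" for u :: "real \<Rightarrow> real"
      by (rule distributed_integral[OF ell_exp[OF n], symmetric]) (use that exponential_density_nonneg[OF theta] in auto)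
    define T0 where "T0 = A - ?l"
    have T0: "0 < T0" using l by (simp add: T0_def)
    \<comment> \<open>Why \<open>g = \<Gamma> - \<Gamma>' / \<theta>\<close> has mean
      \<open>\<Gamma>\<close>: up to the factor \<open>\<theta> * exp (- (\<theta> * y))\<close> it
      is the derivative of \<open>- exp (- (\<theta> * y)) * \<Gamma> (l + y)\<close>, so the jumps
      that stay below \<open>A\<close> contribute boundary terms only.\<close>
    have bI: "has_bochner_integral lborel (\<lambda>y. (\<theta> * exp (- (\<theta> * y)) * g (?l + y)) * indicator {0..T0} y)
        ((- exp (- (\<theta> * T0)) * \<Gamma> (?l + T0)) - (- exp (- (\<theta> * 0)) * \<Gamma> (?l + 0)))"
    proof (rule has_bochner_integral_FTC_Icc_real)
      show "0 \<le> T0" using T0 by simp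
      fix y
      have "((\<lambda>y. \<Gamma> (?l + y)) has_real_derivative w (?l + y - \<beta>)) (at y)"
        unfolding \<Gamma>_def by (rule DERIV_cong[OF DERIV_add[OF DERIV_chain2[where f=F, OF F] DERIV_const]])
          (auto intro!: derivative_eq_intros)
      then show "((\<lambda>y. - exp (- (\<theta> * y)) * \<Gamma> (?l + y)) has_real_derivative \<theta> * exp (- (\<theta> * y)) * g (?l + y)) (at y)"
        using theta by (auto intro!: derivative_eq_intros simp: g_def field_simps)
      have "continuous_on UNIV (\<lambda>y. \<theta> * exp (- (\<theta> * y)) * g (?l + y))"
        unfolding g_def \<Gamma>_def
        by (intro continuous_intros continuous_on_compose2[OF Fc[of UNIV]] continuous_on_compose2[OF wc]) (use theta in auto)
      then show "isCont (\<lambda>y. \<theta> * exp (- (\<theta> * y)) * g (?l + y)) y"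
        by (simp add: continuous_on_eq_continuous_at)
    qed
    have tail: "(\<integral>y. ?f y * indicator {T0<..} y \<partial>lborel) = exp (- (\<theta> * T0))"
    proof -
      have "(\<integral>y. ?f y * indicator {T0<..} y \<partial>lborel) = (\<integral>z. indicator {T0<..} (ell ?n z) \<partial>G)"
        by (rule fin[symmetric]) simp
      also have "\<dots> = (\<integral>z. indicator {z \<in> space G. T0 < ell ?n z} z \<partial>G)"
        by (rule Bochner_Integration.integral_cong) (auto split: split_indicator)
      also have "\<dots> = measure G {z \<in> space G. T0 < ell ?n z}"
        using measurable_ell[OF n] by (subst Bochner_Integration.integral_indicator) (auto simp: Int_absorb2)
      also have "\<dots> = exp (- T0 * \<theta>)"
        using Gp.exponential_distributedD_gt[OF ell_exp[OF n], of T0] T0 theta by simp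
      finally show ?thesis by (simp add: mult.commute)
    qed
    have ti: "integrable lborel (\<lambda>y. g \<beta> * (?f y * indicator {T0<..} y))"
    proof -
      have "integrable lborel ?f"
      proof (rule integrableI_nn_integral_finite[of _ _ 1])
        show "(\<integral>\<^sup>+y. ennreal (?f y) \<partial>lborel) = ennreal 1"
          using prob_space.emeasure_space_1[OF prob_space_exponential_density[OF theta]]
          by (simp add: emeasure_density)
      qed (use exponential_density_nonneg[OF theta] in auto)
      then show ?thesis by (intro integrable_mult_right integrable_mult_indicator[of "{T0<..}" lborel ?f, simplified, unfolded mult.commute[of "indicator _ _"]]) auto
    qed
    have "(\<integral>z. g (snd (J x z)) \<partial>G) = (\<integral>z. \<phi> (ell ?n z) \<partial>G)"
      by (rule Bochner_Integration.integral_cong) (auto simp: jump_map_def Let_def \<phi>_def)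
    also have "\<dots> = (\<integral>y. ?f y * \<phi> y \<partial>lborel)" by (rule fin[OF \<phi>m])
    also have "\<dots> = (\<integral>y. (\<theta> * exp (- (\<theta> * y)) * g (?l + y)) * indicator {0..T0} y + g \<beta> * (?f y * indicator {T0<..} y) \<partial>lborel)"
    proof (rule integral_cong_AE)
      \<comment> \<open>At \<open>y = T0\<close> the process resets, because the test in
        \<open>jump_map\<close> is strict, whereas the closed interval takes \<open>g A\<close>; a
        single point is negligible.\<close>
      show "AE y in lborel. ?f y * \<phi> y =
          (\<theta> * exp (- (\<theta> * y)) * g (?l + y)) * indicator {0..T0} y + g \<beta> * (?f y * indicator {T0<..} y)"
        using AE_lborel_singleton[of T0]
        by eventually_elim (use T0 in \<open>auto simp: \<phi>_def T0_def exponential_density_def mult.commute split: split_indicator\<close>)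
    qed (use \<phi>m gm in measurable)
    also have "\<dots> = ((- exp (- (\<theta> * T0)) * \<Gamma> (?l + T0)) - (- exp (- (\<theta> * 0)) * \<Gamma> (?l + 0))) + g \<beta> * exp (- (\<theta> * T0))"
      using bI ti tail
      by (subst Bochner_Integration.integral_add) (auto dest: has_bochner_integral_integral_eq integrable.intros)
    \<comment> \<open>The boundary term at \<open>A\<close> cancels against the contribution of the
      resets, since \<open>g \<beta> = \<Gamma> A\<close>.\<close>
    also have "\<dots> = \<Gamma> ?l" by (simp add: T0_def g\<beta> \<Gamma>_def L_def algebra_simps)
    finally show "(\<integral>z. g (snd (J x z)) \<partial>G) = \<Gamma> (snd x)" .
  next
    fix l :: real assume l: "\<beta> \<le> l" "l < A"
    define x where "x = l - \<beta>"
    have x: "0 \<le> x" using l by (simp add: x_def)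
    have fx: "fl l t - \<beta> = x * exp (- (\<alpha> * t))" for t by (simp add: flow_def x_def)
    have wD: "((\<lambda>t. w (x * exp (- (\<alpha> * t)))) has_real_derivative (\<beta> + \<alpha> * c * x) * w x - \<theta> * (s x - m)) (at 0 within {0..})"
    proof -
      have "((\<lambda>t. w (x * exp (- (\<alpha> * t)))) has_real_derivative \<theta> / \<alpha> *
          (\<alpha> * ((b + c * x) * truncated b c q x - (if x \<le> q then 1 else 0)) -
           m * (\<alpha> * ((b + c * x) * kser b (- (c * x)) - 1)))) (at 0 within {0..})"
        unfolding w_def
        by (intro DERIV_cmult DERIV_diff DERIV_truncated_flow b q x alpha has_field_derivative_at_within[OF DERIV_kser_flow[OF b]])
      moreover have "\<theta> / \<alpha> * (\<alpha> * ((b + c * x) * truncated b c q x - (if x \<le> q then 1 else 0)) -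
           m * (\<alpha> * ((b + c * x) * kser b (- (c * x)) - 1))) = (\<beta> + \<alpha> * c * x) * w x - \<theta> * (s x - m)"
        using alpha by (simp add: w_def s_def ab[symmetric] field_simps)
      ultimately show ?thesis by simp
    qed
    have FD: "((\<lambda>t. F (x * exp (- (\<alpha> * t)))) has_real_derivative - (\<alpha> * x) * w x) (at 0 within {0..})"
    proof (rule has_field_derivative_at_within)
      show "((\<lambda>t. F (x * exp (- (\<alpha> * t)))) has_real_derivative - (\<alpha> * x) * w x) (at 0)"
        by (rule DERIV_cong[OF DERIV_chain2[where f=F, OF F]]) (auto intro!: derivative_eq_intros)
    qed
    have "((\<lambda>t. F (x * exp (- (\<alpha> * t))) + M - w (x * exp (- (\<alpha> * t))) / \<theta>) has_real_derivative
        (- (\<alpha> * x) * w x + 0 - ((\<beta> + \<alpha> * c * x) * w x - \<theta> * (s x - m)) / \<theta>)) (at 0 within {0..})"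
      by (intro DERIV_diff DERIV_add DERIV_const DERIV_cdivide FD wD)
    then show "((\<lambda>t. g (fl l t)) has_real_derivative d l) (at 0 within {0..})"
      by (simp add: g_def \<Gamma>_def fx d_def x_def[symmetric])
  qed
  \<comment> \<open>All terms with \<open>w\<close> cancel because
    \<open>\<alpha> * c + \<alpha> * \<theta> = 1\<close>; this identity dictates the choice of
    \<open>c\<close>.\<close>
  have val: "d l + l * (\<Gamma> l - g l) = s (l - \<beta>) - m" for l
  proof -
    have "d l + l * (\<Gamma> l - g l) =
        w (l - \<beta>) * (l - (\<beta> + \<alpha> * \<theta> * (l - \<beta>) + (\<alpha> * c) * (l - \<beta>))) / \<theta> + (s (l - \<beta>) - m)"
      using theta by (simp add: d_def g_def field_simps)
    also have "l - (\<beta> + \<alpha> * \<theta> * (l - \<beta>) + (\<alpha> * c) * (l - \<beta>)) = 0" by (simp add: ac algebra_simps)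
    finally show ?thesis by simp
  qed
  have Qp: "prob_space Q" and Qs: "sets Q = sets S" using Q unfolding invariant_iff by auto
  interpret Q: prob_space Q by (rule Qp)
  have sndQ: "snd \<in> borel_measurable Q" by (rule measurable_transfer_sets[OF measurable_S_snd Qs])
  have seq: "s (l - \<beta>) = indicator {..a} l" for l by (simp add: s_def q_def)
  have "(\<integral>x. indicator {..a} (snd x) - m \<partial>Q) = 0"
    using main by (simp only: val seq)
  moreover have "(\<integral>x. indicator {..a} (snd x) - m \<partial>Q) = measure Q (snd -` {..a} \<inter> space Q) - m"
  proof -
    have sq: "snd -` {..a} \<inter> space Q \<in> sets Q" using sndQ by (rule measurable_sets) simp
    have i: "integrable Q (\<lambda>x. indicator {..a} (snd x) :: real)"
      by (rule Q.integrable_const_bound[of _ 1]) (use sndQ in \<open>auto split: split_indicator intro: borel_measurable_indicator'\<close>)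
    have "(\<integral>x. indicator {..a} (snd x) \<partial>Q) = (\<integral>x. indicator (snd -` {..a} \<inter> space Q) x \<partial>Q :: real)"
      by (rule Bochner_Integration.integral_cong) (auto split: split_indicator)
    also have "\<dots> = measure Q (snd -` {..a} \<inter> space Q)" using sq by (simp add: Int_absorb2)
    finally show ?thesis using i by (simp add: Q.prob_space)
  qed
  moreover have "measure (intensity_marginal Q) {..a} = measure Q (snd -` {..a} \<inter> space Q)"
    unfolding intensity_marginal_def by (rule measure_distr[OF sndQ]) simp
  ultimately show ?thesis by (simp add: m_def)
qed

text \<open>The shift \<open>y = l - \<beta>\<close> turns the density into a multiple of
  \<open>tail_kernel\<close>, and both claims reduce to
  \<open>nn_integral_truncated\<close>.\<close>

lemma nn_integral_pi_density:
  assumes K0: "0 \<le> K0 / \<beta>" and a: "\<beta> < a" "a \<le> A"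
    and R: "(truncated (\<beta> / \<alpha>) (1 / \<alpha> - \<theta>) (a - \<beta>) has_integral R) {0..A - \<beta>}"
  shows "(\<integral>\<^sup>+l. ennreal (pi_density \<alpha> \<beta> \<theta> A K0 l) * indicator {\<beta><..a} l \<partial>lborel) =
      ennreal (K0 / \<beta> * (\<beta> * \<theta> / \<alpha>) * R)"
    and "(\<lambda>l. ennreal (pi_density \<alpha> \<beta> \<theta> A K0 l) * indicator {\<beta><..a} l) \<in> borel_measurable borel"
proof -
  define C where "C = K0 / \<beta> * (\<beta> * \<theta> / \<alpha>)"
  let ?k = "tail_kernel (\<beta> / \<alpha>) (1 / \<alpha> - \<theta>) (A - \<beta>)"
  let ?h = "\<lambda>y. ennreal (?k y) * indicator {0<..a - \<beta>} y"
  have b: "0 < \<beta> / \<alpha>" using alpha beta by simp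
  have C: "0 \<le> C" unfolding C_def using K0 alpha beta theta by (intro mult_nonneg_nonneg) auto
  have q: "0 < a - \<beta>" "a - \<beta> \<le> A - \<beta>" using a by auto
  have [measurable]: "?h \<in> borel_measurable borel" by (rule nn_integral_truncated(2)[OF b q])
  have shift: "pi_density \<alpha> \<beta> \<theta> A K0 l = C * ?k (l - \<beta>)" for l
  proof -
    have "integral {l..A} (\<lambda>u. ((u - \<beta>) / (l - \<beta>)) powr (- (\<beta> / \<alpha>)) * exp (- (1 / \<alpha> - \<theta>) * (u - l))) =
      integral {l - \<beta>..A - \<beta>} (\<lambda>x. (x / (l - \<beta>)) powr (- (\<beta> / \<alpha>)) * exp (- (1 / \<alpha> - \<theta>) * (x - (l - \<beta>))))"
      by (subst integral_shift_real_ivl[where c=\<beta>, symmetric]) (simp add: algebra_simps)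
    then show ?thesis unfolding pi_density_def tail_kernel_def C_def by (simp only: minus_mult_left) simp
  qed
  have eq: "ennreal (pi_density \<alpha> \<beta> \<theta> A K0 l) * indicator {\<beta><..a} l = ennreal C * ?h (l - \<beta>)" for l
    unfolding shift ennreal_mult'[OF C] by (auto split: split_indicator)
  show "(\<lambda>l. ennreal (pi_density \<alpha> \<beta> \<theta> A K0 l) * indicator {\<beta><..a} l) \<in> borel_measurable borel"
    unfolding eq by measurable
  have "(\<integral>\<^sup>+l. ennreal (pi_density \<alpha> \<beta> \<theta> A K0 l) * indicator {\<beta><..a} l \<partial>lborel) = ennreal C * (\<integral>\<^sup>+l. ?h (l - \<beta>) \<partial>lborel)"
    unfolding eq by (rule nn_integral_cmult) measurable
  also have "(\<integral>\<^sup>+l. ?h (l - \<beta>) \<partial>lborel) = (\<integral>\<^sup>+y. ?h y \<partial>lborel)"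
    by (subst nn_integral_real_affine[where c=1 and t=\<beta>]) auto
  also have "\<dots> = (\<integral>\<^sup>+x. ennreal (truncated (\<beta> / \<alpha>) (1 / \<alpha> - \<theta>) (a - \<beta>) x) * indicator {0..A - \<beta>} x \<partial>lborel)"
    by (rule nn_integral_truncated(1)[OF b q, symmetric])
  also have "\<dots> = ennreal R"
    by (rule nn_integral_has_integral_lebesgue'[OF _ R]) (rule truncated_nonneg[OF b q(1)])
  finally show "(\<integral>\<^sup>+l. ennreal (pi_density \<alpha> \<beta> \<theta> A K0 l) * indicator {\<beta><..a} l \<partial>lborel) = ennreal (K0 / \<beta> * (\<beta> * \<theta> / \<alpha>) * R)"
    by (simp only: ennreal_mult'[OF C] C_def[symmetric])
qed

text \<open>The distribution function is known for \<open>\<beta> < a \<le> A\<close>, which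
  determines the law above \<open>\<beta>\<close> through its finite tails. The law is carried by
  \<open>{\<beta>..<A}\<close>, so all remaining mass sits at \<open>\<beta>\<close>.\<close>

theorem emeasure_marginal:
  assumes K0: "K0 / \<beta> = \<alpha> / (\<alpha> + \<beta> * \<theta> * K3 \<alpha> \<beta> \<theta> A)"
    and Q: "invariant_measure \<alpha> \<beta> \<beta> A ell G Q" and B: "B \<in> sets borel"
  shows "emeasure (intensity_marginal Q) B =
    ennreal (K0 / \<beta>) * emeasure (return borel \<beta>) B +
    (\<integral>\<^sup>+l\<in>B \<inter> {\<beta><..<A}. ennreal (pi_density \<alpha> \<beta> \<theta> A K0 l) \<partial>lborel)"
proof -
  let ?tr = "\<lambda>a. truncated (\<beta> / \<alpha>) (1 / \<alpha> - \<theta>) (a - \<beta>)"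
  define k where "k = K0 / \<beta>"
  define C where "C = k * (\<beta> * \<theta> / \<alpha>)"
  let ?p = "\<lambda>l. ennreal (pi_density \<alpha> \<beta> \<theta> A K0 l)"
  define R where "R a = integral {0..A - \<beta>} (?tr a)" for a
  have b: "0 < \<beta> / \<alpha>" using alpha beta by simp
  have R: "(?tr a has_integral R a) {0..A - \<beta>}" and R0: "0 \<le> R a" if "\<beta> < a" for a
  proof -
    show 1: "(?tr a has_integral R a) {0..A - \<beta>}"
      unfolding R_def by (intro integrable_integral integrable_continuous_real
          continuous_on_subset[OF continuous_truncated[OF b]]) (use that in auto)
    show "0 \<le> R a" by (rule has_integral_nonneg[OF 1]) (rule truncated_nonneg[OF b], use that in simp)
  qed
  have "0 \<le> K3 \<alpha> \<beta> \<theta> A"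
    by (rule has_integral_nonneg[OF K3_has_integral[OF alpha beta theta A refl refl]]) (rule kser_nonneg[OF b])
  then have K00: "0 \<le> K0 / \<beta>" unfolding K0 using alpha beta theta by simp
  then have k0: "0 \<le> k" by (simp add: k_def)
  have C: "0 \<le> C" unfolding C_def using k0 alpha beta theta by (intro mult_nonneg_nonneg) auto
  define \<mu> where "\<mu> = intensity_marginal Q"
  have Qp: "prob_space Q" and Qs: "sets Q = sets S" using Q unfolding invariant_iff by auto
  have spQ: "space Q = space S" by (rule sets_eq_imp_space_eq[OF Qs])
  have sndQ: "snd \<in> borel_measurable Q" by (rule measurable_transfer_sets[OF measurable_S_snd Qs])
  have s\<mu> [measurable_cong, simp]: "sets \<mu> = sets borel" by (simp add: \<mu>_def intensity_marginal_def)
  have sp\<mu> [simp]: "space \<mu> = UNIV" by (simp add: \<mu>_def intensity_marginal_def)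
  interpret \<mu>: prob_space \<mu>
    unfolding \<mu>_def intensity_marginal_def by (rule prob_space.prob_space_distr[OF Qp sndQ])
  have AE\<mu>: "AE l in \<mu>. \<beta> \<le> l \<and> l < A"
    unfolding \<mu>_def intensity_marginal_def
    by (subst AE_distr_iff[OF sndQ]) (auto intro!: AE_I2 simp: spQ space_S)
  have cdf: "emeasure \<mu> {..a} = ennreal (k + C * R a)" if "\<beta> < a" "a \<le> A" for a
    using measure_marginal_atMost[OF K0 Q that R[OF that(1)]] by (simp only: \<mu>.emeasure_eq_measure \<mu>_def[symmetric] k_def[symmetric] C_def[symmetric])
  \<comment> \<open>The normalisation is not computed from the density: the marginal is a
    probability measure on \<open>{\<beta>..<A}\<close>, so its distribution function at
    \<open>A\<close> is 1.\<close>
  have total: "k + C * R A = 1"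
  proof -
    have "emeasure \<mu> {..A} = emeasure \<mu> (space \<mu>)"
      by (rule emeasure_eq_AE) (use AE\<mu> in \<open>auto elim: eventually_mono\<close>)
    then have "ennreal (k + C * R A) = ennreal 1"
      using cdf[OF A order_refl] \<mu>.emeasure_space_1 by simp
    then show ?thesis using k0 C R0[OF A] by (subst (asm) ennreal_inj) auto
  qed
  define \<nu> where "\<nu> = density lborel (\<lambda>l. ?p l * indicator {\<beta><..<A} l)"
  have pm: "(\<lambda>l. ?p l * indicator {\<beta><..<A} l) \<in> borel_measurable borel"
  proof -
    have "(\<lambda>l. ?p l * indicator {\<beta><..A} l * indicator {..<A} l) \<in> borel_measurable borel"
      using nn_integral_pi_density(2)[OF K00 A order_refl R[OF A]] by measurable
    moreover have "(\<lambda>l. ?p l * indicator {\<beta><..A} l * indicator {..<A} l) = (\<lambda>l. ?p l * indicator {\<beta><..<A} l)"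
      by (auto split: split_indicator)
    ultimately show ?thesis by simp
  qed
  have em\<nu>: "emeasure \<nu> X = (\<integral>\<^sup>+l. ?p l * indicator {\<beta><..<A} l * indicator X l \<partial>lborel)" if "X \<in> sets borel" for X
    unfolding \<nu>_def using pm that by (intro emeasure_density) auto
  have \<nu>cdf: "emeasure \<nu> {..a} = ennreal (C * R a)" if a: "\<beta> < a" "a \<le> A" for a
  proof -
    have "emeasure \<nu> {..a} = (\<integral>\<^sup>+l. ?p l * indicator {\<beta><..a} l \<partial>lborel)"
      unfolding em\<nu>[OF atMost_borel]
      by (rule nn_integral_cong_AE, rule AE_mp[OF AE_lborel_singleton[of A]], rule AE_I2)
        (use a in \<open>auto split: split_indicator\<close>)
    then show ?thesis using nn_integral_pi_density(1)[OF K00 a R[OF a(1)]] by (simp only: k_def[symmetric] C_def[symmetric])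
  qed
  have UB: "UNIV \<in> sets (borel :: real measure)" by simp
  have \<nu>A: "emeasure \<nu> {..A} = emeasure \<nu> UNIV"
    unfolding em\<nu>[OF atMost_borel] em\<nu>[OF UB] by (rule nn_integral_cong) (auto split: split_indicator)
  have s\<nu> [simp]: "sets \<nu> = sets borel" "space \<nu> = UNIV" by (simp_all add: \<nu>_def)
  have tail: "emeasure \<mu> {x<..} = emeasure \<nu> {x<..}" if x: "\<beta> < x" for x
  proof (cases "x < A")
    case True
    have "emeasure \<mu> {x<..} = emeasure \<mu> (space \<mu>) - emeasure \<mu> {..x}"
      using emeasure_compl[of "{..x}" \<mu>] by (simp add: Compl_eq_Diff_UNIV[symmetric])
    also have "\<dots> = ennreal (C * R A - C * R x)"
    proof -
      have "emeasure \<mu> (space \<mu>) - emeasure \<mu> {..x} = ennreal (1 - (k + C * R x))"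
        using cdf[OF x less_imp_le[OF True]] k0 C R0[OF x] \<mu>.emeasure_space_1
        by (simp add: ennreal_minus ennreal_1[symmetric] del: ennreal_1 ennreal_plus)
      also have "1 - (k + C * R x) = C * R A - C * R x" using total by linarith
      finally show ?thesis .
    qed
    also have "\<dots> = emeasure \<nu> (space \<nu>) - emeasure \<nu> {..x}"
      using \<nu>cdf[OF x less_imp_le[OF True]] \<nu>cdf[OF A order_refl] \<nu>A C R0[OF x] by (simp add: ennreal_minus)
    also have "\<dots> = emeasure \<nu> {x<..}"
      using emeasure_compl[of "{..x}" \<nu>] \<nu>cdf[OF x less_imp_le[OF True]] by (simp add: Compl_eq_Diff_UNIV[symmetric])
    finally show ?thesis .
  next
    case False
    have "emeasure \<mu> {x<..} = emeasure \<mu> {}"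
      by (rule emeasure_eq_AE, rule AE_mp[OF AE\<mu>], rule AE_I2) (use False in auto)
    moreover have "emeasure \<nu> {x<..} = (\<integral>\<^sup>+l. 0 \<partial>(lborel :: real measure))"
      unfolding em\<nu>[OF greaterThan_borel] by (rule nn_integral_cong) (use False in \<open>auto split: split_indicator\<close>)
    ultimately show ?thesis by simp
  qed
  \<comment> \<open>\<open>truncated\<close> needs a positive cut-off \<open>a - \<beta>\<close>, so
    the tail at \<open>\<beta>\<close> itself is reached by continuity from below along points
    decreasing to \<open>\<beta>\<close>.\<close>
  have tail\<beta>: "emeasure \<mu> {\<beta><..} = emeasure \<nu> {\<beta><..}"
  proof -
    let ?I = "\<lambda>n. {\<beta> + inverse (real (Suc n))<..}"
    have inc: "incseq ?I"
      by (rule incseq_SucI) (auto intro!: less_imp_inverse_less elim: le_less_trans[rotated] simp del: inverse_inverse_eq)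
    have U: "(\<Union>n. ?I n) = {\<beta><..}"
    proof (intro equalityI subsetI)
      fix l assume "l \<in> {\<beta><..}"
      then obtain n where "inverse (real (Suc n)) < l - \<beta>" using reals_Archimedean[of "l - \<beta>"] by auto
      then have "l \<in> ?I n" by simp
      then show "l \<in> (\<Union>n. ?I n)" by blast
    next
      fix l assume "l \<in> (\<Union>n. ?I n)"
      then obtain n where "\<beta> + inverse (real (Suc n)) < l" by auto
      moreover have "0 < inverse (real (Suc n))" by simp
      ultimately show "l \<in> {\<beta><..}" unfolding greaterThan_iff by linarith
    qed
    have "(\<lambda>n. emeasure \<mu> (?I n)) \<longlonglongrightarrow> emeasure \<mu> (\<Union>n. ?I n)"
      by (rule Lim_emeasure_incseq[OF _ inc]) auto
    moreover have "(\<lambda>n. emeasure \<nu> (?I n)) \<longlonglongrightarrow> emeasure \<nu> (\<Union>n. ?I n)"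
      by (rule Lim_emeasure_incseq[OF _ inc]) auto
    moreover have "emeasure \<mu> (?I n) = emeasure \<nu> (?I n)" for n by (rule tail) simp
    ultimately show ?thesis unfolding U by (simp add: LIMSEQ_unique)
  qed
  define \<mu>' where "\<mu>' = density \<mu> (indicator {\<beta><..})"
  have em\<mu>': "emeasure \<mu>' X = emeasure \<mu> (X \<inter> {\<beta><..})" if "X \<in> sets borel" for X
    unfolding \<mu>'_def using that by (subst emeasure_density) (auto simp: nn_integral_indicator[symmetric] indicator_inter_arith mult.commute simp del: nn_integral_indicator)
  have "\<mu>' = \<nu>"
  proof (rule measure_eqI_lessThan)
    show "sets \<mu>' = sets borel" "sets \<nu> = sets borel" by (simp_all add: \<mu>'_def)
    fix x :: real
    have *: "{x<..} \<inter> {\<beta><..} = {max x \<beta><..}" by auto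
    show "emeasure \<mu>' {x<..} < \<infinity>" unfolding em\<mu>'[OF greaterThan_borel] by (simp add: less_top[symmetric])
    have "emeasure \<nu> {x<..} = emeasure \<nu> {max x \<beta><..}"
      unfolding em\<nu>[OF greaterThan_borel] by (rule nn_integral_cong) (auto split: split_indicator)
    then show "emeasure \<mu>' {x<..} = emeasure \<nu> {x<..}"
      unfolding em\<mu>'[OF greaterThan_borel] * using tail[of x] tail\<beta> by (cases "\<beta> < x") (auto simp: max_def)
  qed
  have "emeasure \<mu> {..\<beta>} = emeasure \<mu> (space \<mu>) - emeasure \<mu> {\<beta><..}"
    using emeasure_compl[of "{\<beta><..}" \<mu>] by (simp add: Compl_eq_Diff_UNIV[symmetric])
  also have "emeasure \<mu> {\<beta><..} = ennreal (C * R A)"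
  proof -
    have "emeasure \<nu> {\<beta><..} = emeasure \<nu> {..A}"
      unfolding em\<nu>[OF greaterThan_borel] em\<nu>[OF atMost_borel] by (rule nn_integral_cong) (auto split: split_indicator)
    then show ?thesis using tail\<beta> \<nu>cdf[OF A order_refl] by simp
  qed
  finally have atom: "emeasure \<mu> {..\<beta>} = ennreal k"
    using total k0 C R0[OF A] \<mu>.emeasure_space_1
    by (simp add: ennreal_minus ennreal_1[symmetric] del: ennreal_1)
  have "emeasure \<mu> B = emeasure \<mu> ((B \<inter> {..\<beta>}) \<union> (B \<inter> {\<beta><..}))" by (rule arg_cong[of _ _ "emeasure \<mu>"]) auto
  also have "\<dots> = emeasure \<mu> (B \<inter> {..\<beta>}) + emeasure \<mu> (B \<inter> {\<beta><..})"
    using B by (intro plus_emeasure[symmetric]) auto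
  also have "emeasure \<mu> (B \<inter> {..\<beta>}) = ennreal (K0 / \<beta>) * emeasure (return borel \<beta>) B"
  proof (cases "\<beta> \<in> B")
    case True
    have "emeasure \<mu> (B \<inter> {..\<beta>}) = emeasure \<mu> {..\<beta>}"
      by (rule emeasure_eq_AE) (use AE\<mu> B True in \<open>auto elim!: eventually_mono\<close>)
    then show ?thesis using atom True B by (simp add: k_def)
  next
    case False
    have "emeasure \<mu> (B \<inter> {..\<beta>}) = emeasure \<mu> {}"
      by (rule emeasure_eq_AE) (use AE\<mu> B False in \<open>auto elim!: eventually_mono\<close>)
    then show ?thesis using False B by simp
  qed
  also have "emeasure \<mu> (B \<inter> {\<beta><..}) = (\<integral>\<^sup>+l\<in>B \<inter> {\<beta><..<A}. ?p l \<partial>lborel)"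
  proof -
    have "emeasure \<mu> (B \<inter> {\<beta><..}) = emeasure \<nu> B" using em\<mu>'[OF B] \<open>\<mu>' = \<nu>\<close> by simp
    also have "\<dots> = (\<integral>\<^sup>+l\<in>B \<inter> {\<beta><..<A}. ?p l \<partial>lborel)"
      unfolding em\<nu>[OF B] by (rule nn_integral_cong) (auto split: split_indicator)
    finally show ?thesis .
  qed
  finally show ?thesis unfolding \<mu>_def .
qed

end

theorem theorem5p1:
  fixes \<alpha> \<beta> \<theta> lam0 A K0 :: real
    and ell :: "nat \<Rightarrow> real \<Rightarrow> real"
    and G :: "real measure"
  assumes "\<alpha> > 0" and "\<beta> > 0" and "\<theta> > 0"
    and "lam0 = \<beta>" and "\<beta> < A"
    and "prob_space G" and "sets G = sets (restrict_space borel {0..})"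
    and "integrable G (\<lambda>z. z\<^sup>2)"
    and "\<And>n z. n \<ge> 1 \<Longrightarrow> z > 0 \<Longrightarrow> ell n z > 0"
    and "\<And>n. n \<ge> 1 \<Longrightarrow> mono_on {0..} (ell n)"
    and "\<And>n. n \<ge> 1 \<Longrightarrow> continuous_on {0..} (ell n)"
    and "\<And>n. n \<ge> 1 \<Longrightarrow>
           distributed G lborel (ell n) (\<lambda>y. ennreal (exponential_density \<theta> y))"
    and "K0 / \<beta> = \<alpha> / (\<alpha> + \<beta> * \<theta> * K3 \<alpha> \<beta> \<theta> A)"
  shows "(\<exists>!Q. invariant_measure \<alpha> \<beta> lam0 A ell G Q) \<and>
         (\<forall>Q. invariant_measure \<alpha> \<beta> lam0 A ell G Q \<longrightarrow>
            (\<forall>B\<in>sets borel.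
               emeasure (intensity_marginal Q) B =
                 ennreal (K0 / \<beta>) * emeasure (return borel \<beta>) B +
                 (\<integral>\<^sup>+l\<in>B \<inter> {\<beta><..<A}. ennreal (pi_density \<alpha> \<beta> \<theta> A K0 l) \<partial>lborel)))"
proof -
  interpret resetting \<alpha> \<beta> \<theta> A ell G
    by (rule resetting.intro[OF assms(1,2,3,5,6,7,9,11,12)])
  show ?thesis
    unfolding assms(4)
    by (intro conjI allI impI ballI ex1_invariant_measure emeasure_marginal[OF assms(13)])
qed

end
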